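(* Let $t>0$. For $d=1$ (so $R^1(t)=|B(t)|$) and $m\in\{0,1\}$, $$P\left\{X_m(|B(t)|)\in dx\right\}=dx\int_{-ct}^{ct}\frac{\sqrt{t}\,e^{-\frac{x^2t}{2y^2}}}{\sqrt{2\pi y^2}}\,p^m(y,t)\,dy,\qquad x\in\mathbb{R}.$$ For $d=2$, $$P\left\{X_0(R^2(t))\in dx\right\}=dx\,e^{-\lambda t}\left\{\frac{\lambda t}{2}\int_0^1\frac{e^{\lambda t\sqrt{1-w}}}{\sqrt{1-w}}\,\frac{e^{-\frac{x^2}{2c^2tw}}}{\sqrt{2\pi tw}\,c}\,dw+\frac{e^{-\frac{x^2}{2c^2t}}}{\sqrt{2\pi t}\,c}\right\},$$ $$P\left\{X_1(R^2(t))\in dx\right\}=dx\int_0^1e^{-\lambda tw}\left[1+\lambda t(1-w)\right]\frac{e^{-\frac{x^2}{2c^2tw}}}{\sqrt{2\pi tw}\,c}\,dw.$$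
   Context: Fix $c>0$, $\lambda>0$. For $m\in\{0,1\}$ let $X_m(s)=c\sum_{j=1}^{N(s)+1}(s_j-s_{j-1})\cos\theta_j$, where $N$ is a homogeneous Poisson process of rate $\lambda$ with event times $s_1<s_2<\cdots$, $s_0=0$, $s_{N(s)+1}=s$, and the $\theta_j$ are i.i.d. (independent of $N$) with density $\frac{\Gamma(m+1)}{\sqrt\pi\,\Gamma(m+\frac12)}\sin^{2m}\theta$ on $(0,\pi)$. For an integer $n\ge0$ put $v_0=\frac n2$, $v_1=n+1$ and let $p_n^m(x,s)$ be the density of $X_m(s)$ given $N(s)=n$; explicitly $p_n^m(x,s)=\frac{\Gamma(v_m)\Gamma(v_m+1)}{2\pi\Gamma(2v_m)}\left(\frac{2}{cs}\right)^{2v_m}(c^2s^2-x^2)^{v_m-\frac12}$ for $|x|<cs$ and $0$ otherwise, with $\Gamma(v)/\Gamma(2v)$ read as $2$ when $v=0$ (so $p_0^0(x,s)=\frac{1}{\pi\sqrt{c^2s^2-x^2}}$). The density of $X_m(t)$ is $p^m(\cdot,t)$, given for $|x|<ct$ by $p^0(x,t)=\frac{\lambda e^{-\lambda t}}{2c}\sum_{k=0}^{\infty}\left(\frac{\lambda}{2c}\sqrt{c^2t^2-x^2}\right)^{k-1}\frac{1}{\Gamma^2(\frac{k+1}{2})}$ and $p^1(x,t)=\frac{e^{-\lambda t}}{c\sqrt{\lambda\pi t^3}}\sum_{k=0}^{\infty}\left(\frac{\lambda}{c^2t}(c^2t^2-x^2)\right)^{k+\frac12}\frac{k+1}{\Gamma(k+\frac32)}$.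 $R^d(t)=\sqrt{\sum_{i=1}^dB_i^2(t)}$ with $B_i$ independent standard Brownian motions is the Bessel process started at zero, independent of $X_m$ and $N$; its density is $f^d(r)=\frac{1}{\Gamma(d/2)}\frac{r^{d-1}}{2^{d/2-1}t^{d/2}}e^{-r^2/(2t)}$, $r>0$; $B(t)$ denotes a standard Brownian motion. For an independent positive random time $T$ (depending on the parameter $t$), the conditional law is $P\{X_m(T)\in dx\,|\,N(t)=n\}=dx\int_0^\infty p_n^m(x,s)\,P\{T\in ds\}$, and the unconditional law is $P\{X_m(T)\in dx\}=\sum_{n=0}^\infty e^{-\lambda t}\frac{(\lambda t)^n}{n!}P\{X_m(T)\in dx\,|\,N(t)=n\}$ (the number of Poisson events is that of the interval $[0,t]$). Equalities of laws are equalities of Lebesgue densities (a.e. $x$). *)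

theory Defs
  imports "HOL-Probability.Probability"
begin

section \<open>The random motions \<open>X\<^sub>m\<close>\<close>

text \<open>
  A homogeneous Poisson process of rate \<open>lam\<close> is given by its i.i.d. exponential waiting times
  \<open>W 1, W 2, \<dots>\<close>; the event times are their partial sums.
\<close>

definition event_time :: "(nat \<Rightarrow> 'a \<Rightarrow> real) \<Rightarrow> nat \<Rightarrow> 'a \<Rightarrow> real" where
  "event_time W j \<omega> = (\<Sum>i=1..j. W i \<omega>)"

text \<open>The event times tend to infinity almost surely, so the set below is finite off a null set.\<close>

definition event_count :: "(nat \<Rightarrow> 'a \<Rightarrow> real) \<Rightarrow> real \<Rightarrow> 'a \<Rightarrow> nat" where
  "event_count W s \<omega> = card {j. 1 \<le> j \<and> event_time W j \<omega> \<le> s}"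

definition motion ::
  "real \<Rightarrow> (nat \<Rightarrow> 'a \<Rightarrow> real) \<Rightarrow> (nat \<Rightarrow> 'a \<Rightarrow> real) \<Rightarrow> real \<Rightarrow> 'a \<Rightarrow> real" where
  "motion c W \<Theta> s \<omega> =
     (let n = event_count W s \<omega>;
          \<tau> = (\<lambda>j. if j = n + 1 then s else event_time W j \<omega>)
      in c * (\<Sum>j=1..n+1. (\<tau> j - \<tau> (j - 1)) * cos (\<Theta> j \<omega>)))"

definition angle_density :: "nat \<Rightarrow> real \<Rightarrow> real" where
  "angle_density m \<theta> =
     (if 0 < \<theta> \<and> \<theta> < pi
      then Gamma (real m + 1) / (sqrt pi * Gamma (real m + 1/2)) * sin \<theta> ^ (2 * m)
      else 0)"

text \<open>
  \<open>W\<close> are the waiting times of the Poisson process and \<open>\<Theta>\<close> the angles. The disjoint sum of the two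
  index sets expresses that all \<open>W j\<close> and \<open>\<Theta> j\<close> together form one independent family.
\<close>

definition motion_data ::
  "'a measure \<Rightarrow> real \<Rightarrow> nat \<Rightarrow> (nat \<Rightarrow> 'a \<Rightarrow> real) \<Rightarrow> (nat \<Rightarrow> 'a \<Rightarrow> real) \<Rightarrow> bool" where
  "motion_data M lam m W \<Theta> \<longleftrightarrow>
     prob_space M \<and>
     (\<forall>j\<ge>1. distributed M lborel (W j) (\<lambda>x. ennreal (exponential_density lam x))) \<and>
     (\<forall>j\<ge>1. distributed M lborel (\<Theta> j) (\<lambda>x. ennreal (angle_density m x))) \<and>
     prob_space.indep_vars M (\<lambda>_. borel) (case_sum W \<Theta>) ({1..} <+> {1..})"

text \<open>
  The density \<open>p\<^sup>m\<close> of the motion at time \<open>t\<close> for \<open>m = 0\<close> and \<open>m = 1\<close> (the value for larger \<open>m\<close> is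
  immaterial). In the first series the exponent \<open>k - 1\<close> is \<open>-1\<close> for \<open>k = 0\<close>.
\<close>

definition motion_density :: "nat \<Rightarrow> real \<Rightarrow> real \<Rightarrow> real \<Rightarrow> real \<Rightarrow> real" where
  "motion_density m c lam x t =
     (if \<bar>x\<bar> < c * t then
        if m = 0 then
          lam * exp (- lam * t) / (2 * c) *
            (\<Sum>k. (lam / (2 * c) * sqrt (c\<^sup>2 * t\<^sup>2 - x\<^sup>2)) powr (real k - 1)
                   * (1 / (Gamma ((real k + 1) / 2))\<^sup>2))
        else
          exp (- lam * t) / (c * sqrt (lam * pi * t ^ 3)) *
            (\<Sum>k. (lam / (c\<^sup>2 * t) * (c\<^sup>2 * t\<^sup>2 - x\<^sup>2)) powr (real k + 1/2)
                   * ((real k + 1) / Gamma (real k + 3/2)))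
      else 0)"

section \<open>Brownian motion and the Bessel process\<close>

definition brownian_motion :: "'a measure \<Rightarrow> (real \<Rightarrow> 'a \<Rightarrow> real) \<Rightarrow> bool" where
  "brownian_motion M B \<longleftrightarrow>
     prob_space M \<and>
     (\<forall>u\<ge>0. B u \<in> borel_measurable M) \<and>
     (AE \<omega> in M. B 0 \<omega> = 0) \<and>
     (\<forall>u v. 0 \<le> u \<and> u < v \<longrightarrow>
        distributed M lborel (\<lambda>\<omega>. B v \<omega> - B u \<omega>) (\<lambda>x. ennreal (normal_density 0 (sqrt (v - u)) x))) \<and>
     (\<forall>n (\<tau> :: nat \<Rightarrow> real). 0 \<le> \<tau> 0 \<and> strict_mono \<tau> \<longrightarrow>
        prob_space.indep_vars M (\<lambda>_. borel) (\<lambda>i \<omega>. B (\<tau> (Suc i)) \<omega> - B (\<tau> i) \<omega>) {..<n}) \<and>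
     (AE \<omega> in M. continuous_on {0..} (\<lambda>u. B u \<omega>))"

definition independent_brownian_motions ::
  "'a measure \<Rightarrow> nat \<Rightarrow> (nat \<Rightarrow> real \<Rightarrow> 'a \<Rightarrow> real) \<Rightarrow> bool" where
  "independent_brownian_motions M d B \<longleftrightarrow>
     (\<forall>i\<in>{1..d}. brownian_motion M (B i)) \<and>
     prob_space.indep_vars M (\<lambda>_. Pi\<^sub>M {0 :: real..} (\<lambda>_. borel)) (\<lambda>i \<omega>. \<lambda>u\<in>{0..}. B i u \<omega>) {1..d}"

definition bessel_process :: "nat \<Rightarrow> (nat \<Rightarrow> real \<Rightarrow> 'a \<Rightarrow> real) \<Rightarrow> real \<Rightarrow> 'a \<Rightarrow> real" where
  "bessel_process d B u \<omega> = sqrt (\<Sum>i=1..d. (B i u \<omega>)\<^sup>2)"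

text \<open>
  The sigma-algebra generated by the process \<open>R\<close> on \<open>[0, \<infinity>)\<close> is independent of the one generated by
  the waiting times and angles (\<open>indep_var\<close> does not apply, since the two families have different types).
\<close>

definition independent_of_motion ::
  "'a measure \<Rightarrow> (nat \<Rightarrow> 'a \<Rightarrow> real) \<Rightarrow> (nat \<Rightarrow> 'a \<Rightarrow> real) \<Rightarrow> (real \<Rightarrow> 'a \<Rightarrow> real) \<Rightarrow> bool" where
  "independent_of_motion M W \<Theta> R \<longleftrightarrow>
     prob_space.indep_set M
       (sets (vimage_algebra (space M) (\<lambda>\<omega>. \<lambda>k\<in>{1..} <+> {1..}. case_sum W \<Theta> k \<omega>)
                (Pi\<^sub>M ({1..} <+> {1..}) (\<lambda>_. borel))))
       (sets (vimage_algebra (space M) (\<lambda>\<omega>. \<lambda>u\<in>{0..}. R u \<omega>) (Pi\<^sub>M {0 :: real..} (\<lambda>_. borel))))"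

section \<open>The law of the motion at a random time\<close>

text \<open>
  The number of Poisson events in \<open>P{X(T) \<in> A | N(t) = n}\<close> is the one prescribed for the
  deterministic interval \<open>[0, t]\<close>: by convention this law is the mixture
  \<open>\<integral>\<^sub>0\<^sup>\<infinity> P{X(s) \<in> A | N(s) = n} P{T \<in> ds}\<close>, in which all \<open>n\<close> events fall into the random interval
  \<open>[0, T]\<close>. The unconditional law weights these with the Poisson probabilities of \<open>N(t)\<close>.
  Hence it is in general not the distribution of the map \<open>\<omega> \<mapsto> X (T \<omega>) \<omega>\<close>.
\<close>

definition conditional_law ::
  "'a measure \<Rightarrow> (real \<Rightarrow> 'a \<Rightarrow> nat) \<Rightarrow> (real \<Rightarrow> 'a \<Rightarrow> real) \<Rightarrow> ('a \<Rightarrow> real) \<Rightarrow> nat \<Rightarrow> real measure"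
where
  "conditional_law M N X T n =
     measure_of UNIV (sets borel)
       (\<lambda>A. \<integral>\<^sup>+s\<in>{0<..}. ennreal \<P>(\<omega> in M. X s \<omega> \<in> A \<bar> N s \<omega> = n) \<partial>distr M borel T)"

definition law_at_random_time ::
  "'a measure \<Rightarrow> real \<Rightarrow> real \<Rightarrow> (real \<Rightarrow> 'a \<Rightarrow> nat) \<Rightarrow> (real \<Rightarrow> 'a \<Rightarrow> real) \<Rightarrow> ('a \<Rightarrow> real) \<Rightarrow>
   real measure"
where
  "law_at_random_time M lam t N X T =
     measure_of UNIV (sets borel)
       (\<lambda>A. \<Sum>n. ennreal (exp (- lam * t) * (lam * t) ^ n / fact n)
                 * emeasure (conditional_law M N X T n) A)"

end

theory Submission
  imports Defs
begin

text \<open>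
  Given \<open>N s = n\<close>, the motion at time \<open>s\<close> is \<open>c * s * Y\<close> with \<open>Y\<close> not depending on \<open>s\<close>. The waiting times are
  exponential, so the moments of the motion on the event \<open>N s = n\<close> are Erlang convolutions, and appending a
  step convolves the moment sequences: this is the Vandermonde identity for \<open>m = 0\<close> and an identity between
  powers of the Catalan series for \<open>m = 1\<close>. The bounded variable \<open>Y\<close> therefore has the moments, hence the law,
  with density proportional to \<open>(1 - y\<^sup>2) powr (v - 1/2)\<close>, where \<open>v = n / 2\<close> or \<open>v = n + 1\<close>.

  The law at the random time \<open>T\<close> is that of \<open>c * T * Y\<close>, mixed over \<open>n\<close> with Poisson weights. For \<open>T = \<bar>B t\<bar>\<close> the
  symmetry of \<open>Y\<close> allows to replace \<open>T\<close> by \<open>B t\<close>, and conditioning on \<open>c * t * Y\<close>, which has the law of the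
  motion at time \<open>t\<close>, leaves a normal density. For the two-dimensional Bessel process, \<open>Y\<close> is \<open>sqrt w\<close> times an
  arcsine variable, where \<open>w\<close> has the law Beta(1, v), and a Rayleigh variable times an arcsine variable is
  normal; summing the Beta densities over \<open>n\<close> gives exponential functions.
\<close>

section \<open>Ultraspherical densities\<close>

text \<open>Identifying the density of \<open>Y\<close> directly would need an n-fold convolution at
  each time \<open>s\<close>; its moments reduce to discrete convolutions because of three
  normalisations. Every cosine is shifted to \<open>1 + cos\<close>, so that all integrands are
  nonnegative and Tonelli applies without integrability proofs. Powers are divided by factorials, so
  that the binomial theorem becomes a plain Cauchy product. Finally, \<open>w ^ i / fact i\<close>
  times the exponential density is, up to \<open>lam ^ i\<close>, the Erlang density of index
  \<open>i\<close>: the time variable sees only Erlang convolutions, and the coefficients separate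
  from it. The fixed time \<open>s\<close> enters through the last, incomplete step alone: the tail
  \<open>exp (- lam * r)\<close> is the exponential density up to the factor \<open>lam\<close>, so
  the Erlang convolution is evaluated at the point \<open>s\<close> instead of being
  integrated.\<close>

lemma Gamma_legendre_duplication_real:
  fixes x :: real
  assumes "0 < x"
  shows "Gamma x * Gamma (x + 1/2) = 2 powr (1 - 2 * x) * sqrt pi * Gamma (2 * x)"
proof -
  have ni: "complex_of_real y \<notin> \<int>\<^sub>\<le>\<^sub>0" if "0 < y" for y
    using that by (auto elim!: nonpos_Ints_cases simp: complex_eq_iff)
  have half: "complex_of_real x + 1/2 = complex_of_real (x + 1/2)"
    and two: "2 * complex_of_real x = complex_of_real (2 * x)"
    and ex: "exp ((1 - complex_of_real (2 * x)) * of_real (ln 2)) = complex_of_real (2 powr (1 - 2 * x))"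
    by (simp_all add: powr_def flip: exp_of_real)
  have "complex_of_real (Gamma x) * complex_of_real (Gamma (x + 1/2)) =
      complex_of_real (2 powr (1 - 2 * x)) * complex_of_real (sqrt pi) * complex_of_real (Gamma (2 * x))"
    using Gamma_legendre_duplication[of "complex_of_real x"] assms ni[of x] ni[of "x + 1/2"]
    unfolding half two ex Gamma_complex_of_real by simp
  then show ?thesis
    using of_real_eq_iff of_real_mult by metis
qed

lemma nn_integral_Beta:
  fixes a b :: real
  assumes "0 < a" "0 < b"
  shows "(\<integral>\<^sup>+x\<in>{0<..<1}. ennreal (x powr (a - 1) * (1 - x) powr (b - 1)) \<partial>lborel) = ennreal (Beta a b)"
proof -
  have "((\<lambda>t. t powr (a - 1) * (1 - t) powr (b - 1)) has_integral Beta a b) {0<..<1}"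
    using has_integral_Beta_real[OF assms] by (simp add: has_integral_Icc_iff_Ioo)
  then show ?thesis
    by (intro nn_integral_has_integral_lebesgue') auto
qed

text \<open>The Gegenbauer weight: arcsine for \<open>v = 0\<close>, semicircle for
  \<open>v = 1\<close>. By the duplication formula, \<open>c * s\<close> times such a variable has
  the density p_n^m of index \<open>v\<close>; written without Gamma(v)/Gamma(2v), the constant
  needs no convention at \<open>v = 0\<close>.\<close>

definition ultraspherical :: "real \<Rightarrow> real \<Rightarrow> real" where
  "ultraspherical v y =
     (if \<bar>y\<bar> < 1 then Gamma (v + 1) / (sqrt pi * Gamma (v + 1/2)) * (1 - y\<^sup>2) powr (v - 1/2) else 0)"

lemma ultraspherical_measurable [measurable]: "ultraspherical v \<in> borel_measurable borel"
  unfolding ultraspherical_def[abs_def] by measurable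

lemma ultraspherical_nonneg [simp]: "0 \<le> v \<Longrightarrow> 0 \<le> ultraspherical v y"
  by (simp add: ultraspherical_def Gamma_real_nonneg)

lemma ultraspherical_minus [simp]: "ultraspherical v (- y) = ultraspherical v y"
  by (simp add: ultraspherical_def)

text \<open>If \<open>Y\<close> has density \<open>ultraspherical v\<close>, then
  \<open>(1 + Y) / 2\<close> has the law Beta(v + 1/2, v + 1/2); this is \<open>2 ^ k\<close> times
  its k-th moment.\<close>

definition shifted_moment :: "real \<Rightarrow> nat \<Rightarrow> real" where
  "shifted_moment v k = 2 ^ k * pochhammer (v + 1/2) k / pochhammer (2 * v + 1) k"

lemma shifted_moment_nonneg [simp]: "0 \<le> v \<Longrightarrow> 0 \<le> shifted_moment v k"
  by (simp add: shifted_moment_def pochhammer_nonneg)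

text \<open>The shift by 1 makes the powers nonnegative, and it turns all moments into plain Beta integrals.\<close>

lemma nn_integral_ultraspherical_shifted_moment:
  assumes v: "0 \<le> v"
  shows "(\<integral>\<^sup>+y. ennreal ((1 + y) ^ k) * ennreal (ultraspherical v y) \<partial>lborel) = ennreal (shifted_moment v k)"
proof -
  define C where "C = Gamma (v + 1) / (sqrt pi * Gamma (v + 1/2))"
  have C: "0 \<le> C" using v by (simp add: C_def Gamma_real_nonneg)
  have pw: "(2 * w) ^ k * (C * (4 * w * (1 - w)) powr (v - 1/2)) =
      (2 ^ k * C * 4 powr (v - 1/2)) * (w powr ((v + 1/2 + k) - 1) * (1 - w) powr ((v + 1/2) - 1))"
    if "0 < w" "w < 1" for w :: real
  proof -
    have "w powr ((v + 1/2 + k) - 1) = w powr (v - 1/2) * w ^ k"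
    proof -
      have "(v + 1/2 + k) - 1 = (v - 1/2) + k" by simp
      then show ?thesis using that by (simp only: powr_add powr_realpow)
    qed
    then show ?thesis
      using that by (simp add: powr_mult power_mult_distrib)
  qed
  \<comment> \<open>The substitution \<open>y = 2 * w - 1\<close> maps the support to (0, 1) and
    turns \<open>1 - y^2\<close> into \<open>4 * w * (1 - w)\<close>.\<close>
  have "(\<integral>\<^sup>+y. ennreal ((1 + y) ^ k) * ennreal (ultraspherical v y) \<partial>lborel) =
      2 * (\<integral>\<^sup>+w. ennreal ((1 + (-1 + 2 * w)) ^ k) * ennreal (ultraspherical v (-1 + 2 * w)) \<partial>lborel)"
    by (subst nn_integral_real_affine[where c = 2 and t = "-1"]) auto
  also have "(\<integral>\<^sup>+w. ennreal ((1 + (-1 + 2 * w)) ^ k) * ennreal (ultraspherical v (-1 + 2 * w)) \<partial>lborel) =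
      (\<integral>\<^sup>+w. ennreal (2 ^ k * C * 4 powr (v - 1/2)) *
        (ennreal (w powr ((v + 1/2 + k) - 1) * (1 - w) powr ((v + 1/2) - 1)) * indicator {0<..<1} w) \<partial>lborel)"
  proof (intro nn_integral_cong)
    fix w :: real
    have sq: "1 - (-1 + 2 * w)\<^sup>2 = 4 * w * (1 - w)"
      by (simp add: power2_eq_square algebra_simps)
    show "ennreal ((1 + (-1 + 2 * w)) ^ k) * ennreal (ultraspherical v (-1 + 2 * w)) =
        ennreal (2 ^ k * C * 4 powr (v - 1/2)) *
        (ennreal (w powr ((v + 1/2 + k) - 1) * (1 - w) powr ((v + 1/2) - 1)) * indicator {0<..<1} w)"
    proof (cases "0 < w \<and> w < 1")
      case True
      then have "\<bar>-1 + 2 * w\<bar> < 1" by auto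
      then have "(1 + (-1 + 2 * w)) ^ k * ultraspherical v (-1 + 2 * w) =
          (2 ^ k * C * 4 powr (v - 1/2)) * (w powr ((v + 1/2 + k) - 1) * (1 - w) powr ((v + 1/2) - 1))"
        unfolding ultraspherical_def sq C_def[symmetric] pw[OF conjunct1[OF True] conjunct2[OF True], symmetric]
        by simp
      then show ?thesis
        using True v C by (simp add: ennreal_mult[symmetric])
    next
      case False
      then have "\<not> \<bar>-1 + 2 * w\<bar> < 1" by auto
      then show ?thesis using False by (simp add: ultraspherical_def)
    qed
  qed
  also have "2 * \<dots> = 2 * (ennreal (2 ^ k * C * 4 powr (v - 1/2)) * ennreal (Beta (v + 1/2 + k) (v + 1/2)))"
    using v by (subst nn_integral_cmult, simp, subst nn_integral_Beta) auto
  also have "\<dots> = ennreal (2 * (2 ^ k * C * 4 powr (v - 1/2) * Beta (v + 1/2 + k) (v + 1/2)))"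
  proof -
    have "0 \<le> Beta (v + 1/2 + k) (v + 1/2)" "0 \<le> 2 ^ k * C * 4 powr (v - 1/2)"
      using v C by (auto simp: Beta_def Gamma_real_nonneg)
    then show ?thesis
      by (simp only: ennreal_mult mult_nonneg_nonneg zero_le_numeral ennreal_numeral)
  qed
  \<comment> \<open>Duplication at \<open>v + 1/2\<close> trades the \<open>Gamma (v + 1)\<close> in
    \<open>C\<close> for \<open>Gamma (2 * v + 1)\<close>, which is what the pochhammer in the
    denominator lacks.\<close>
  also have "2 * (2 ^ k * C * 4 powr (v - 1/2) * Beta (v + 1/2 + k) (v + 1/2)) = shifted_moment v k"
  proof -
    have p1: "pochhammer (v + 1/2) k = Gamma (v + 1/2 + k) / Gamma (v + 1/2)"
      using v by (intro pochhammer_Gamma) (auto elim!: nonpos_Ints_cases)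
    have p2: "pochhammer (2 * v + 1) k = Gamma (2 * v + 1 + k) / Gamma (2 * v + 1)"
      using v by (intro pochhammer_Gamma) (auto elim!: nonpos_Ints_cases)
    have leg: "Gamma (v + 1/2) * Gamma (v + 1) = 2 powr (- 2 * v) * sqrt pi * Gamma (2 * v + 1)"
      using Gamma_legendre_duplication_real[of "v + 1/2"] v by (simp add: algebra_simps)
    have four: "4 powr (v - 1/2) = 2 powr (2 * v) / (2 :: real)"
    proof -
      have "(4::real) powr (v - 1/2) = (2 powr 2) powr (v - 1/2)" by simp
      also have "\<dots> = 2 powr (2 * v - 1)" by (simp only: powr_powr) (simp add: algebra_simps)
      finally show ?thesis by (simp add: powr_diff)
    qed
    have pos: "0 < Gamma (v + 1/2)" "0 < Gamma (2 * v + 1)" "0 < Gamma (2 * v + 1 + k)" "0 < Gamma (v + 1)"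
      using v by (auto intro!: Gamma_real_pos)
    have B: "Beta (v + 1/2 + k) (v + 1/2) = Gamma (v + 1/2 + k) * Gamma (v + 1/2) / Gamma (2 * v + 1 + k)"
      by (simp add: Beta_def algebra_simps)
    have C': "C = 2 powr (- 2 * v) * Gamma (2 * v + 1) / (Gamma (v + 1/2))\<^sup>2"
      using leg pos by (simp add: C_def field_simps power2_eq_square)
    have "2 powr (- 2 * v) * 2 powr (2 * v) = (1::real)"
      by (simp flip: powr_add)
    then show ?thesis
      unfolding shifted_moment_def p1 p2 B C' four using pos
      by (simp add: field_simps power2_eq_square)
  qed
  finally show ?thesis .
qed

lemma nn_integral_ultraspherical [simp]:
  "0 \<le> v \<Longrightarrow> (\<integral>\<^sup>+y. ennreal (ultraspherical v y) \<partial>lborel) = 1"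
  using nn_integral_ultraspherical_shifted_moment[of v 0] by (simp add: shifted_moment_def)

text \<open>The density at \<open>y\<close> of \<open>sqrt w\<close> times an arcsine variable,
  averaged over \<open>w\<close> with law Beta(1, v). Only \<open>w > y^2\<close> contributes; the
  affine coordinate \<open>w = y^2 + (1 - y^2) * z\<close> gives \<open>1 - w = a * (1 - z)\<close>
  and \<open>1 - y^2 / w = a * z / w\<close> with \<open>a = 1 - y^2\<close>, so a Beta(1/2, v)
  integral remains.\<close>

lemma ultraspherical_mixture:
  assumes v: "0 < v"
  shows "(\<integral>\<^sup>+w\<in>{0<..<1}. ennreal (v * (1 - w) powr (v - 1)) * ennreal (ultraspherical 0 (y / sqrt w) / sqrt w) \<partial>lborel) =
    ennreal (ultraspherical v y)"
proof (cases "\<bar>y\<bar> < 1")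
  case False
  have "indicator {0<..<1} w * ultraspherical 0 (y / sqrt w) = 0" for w
  proof (cases "0 < w \<and> w < 1")
    case True
    then have "sqrt w * 1 \<le> 1 * \<bar>y\<bar>" using False by (intro mult_mono) auto
    then have "1 \<le> \<bar>y / sqrt w\<bar>" using True by (simp add: le_divide_eq)
    then show ?thesis by (simp add: ultraspherical_def)
  qed auto
  then have *: "w \<in> {0<..<1} \<Longrightarrow> ultraspherical 0 (y / sqrt w) = 0" for w
    by (metis indicator_simps(1) mult_1)
  have "(\<integral>\<^sup>+w\<in>{0<..<1}. ennreal (v * (1 - w) powr (v - 1)) * ennreal (ultraspherical 0 (y / sqrt w) / sqrt w) \<partial>lborel) =
    (\<integral>\<^sup>+w. 0 \<partial>(lborel :: real measure))"
    by (intro nn_integral_cong) (auto simp: * split: split_indicator)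
  then show ?thesis using False by (simp add: ultraspherical_def)
next
  case True
  define a where "a = 1 - y\<^sup>2"
  have a: "0 < a" using True by (simp add: a_def abs_square_less_1)
  define h where "h w = ennreal (v * (1 - w) powr (v - 1)) * ennreal (ultraspherical 0 (y / sqrt w) / sqrt w) * indicator {0<..<1} w" for w
  have h [measurable]: "h \<in> borel_measurable borel"
    unfolding h_def[abs_def] by measurable
  have "(\<integral>\<^sup>+w. h w \<partial>lborel) = ennreal a * (\<integral>\<^sup>+z. h (y\<^sup>2 + a * z) \<partial>lborel)"
    using a by (subst nn_integral_real_affine[where c = a and t = "y\<^sup>2"]) auto
  also have "(\<integral>\<^sup>+z. h (y\<^sup>2 + a * z) \<partial>lborel) =
    (\<integral>\<^sup>+z. ennreal (v * a powr (v - 1) / (pi * sqrt a)) * (ennreal (z powr (1/2 - 1) * (1 - z) powr (v - 1)) * indicator {0<..<1} z) \<partial>lborel)"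
  proof (intro nn_integral_cong_AE)
    have "AE z in lborel. z \<noteq> (0::real)" by (rule AE_lborel_singleton)
    then show "AE z in lborel. h (y\<^sup>2 + a * z) = ennreal (v * a powr (v - 1) / (pi * sqrt a)) *
        (ennreal (z powr (1/2 - 1) * (1 - z) powr (v - 1)) * indicator {0<..<1} z)"
    proof eventually_elim
      case (elim z)
      define w where "w = y\<^sup>2 + a * z"
      have w1: "1 - w = a * (1 - z)" by (simp add: w_def a_def algebra_simps)
      show ?case
      proof (cases "0 < z \<and> z < 1")
        case True
        have w0: "y\<^sup>2 < w" using True a by (simp add: w_def)
        then have wpos: "0 < w" using zero_le_power2[of y] by linarith
        have "0 < 1 - w" unfolding w1 using True a by simp
        then have wi: "w \<in> {0<..<1}" using wpos by simp
        have "\<bar>y\<bar> < sqrt w"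
          using real_sqrt_less_mono[OF w0] by simp
        then have ysq: "\<bar>y / sqrt w\<bar> < 1"
          using wpos by (simp add: divide_less_eq)
        have e: "1 - (y / sqrt w)\<^sup>2 = a * z / w"
          using wpos by (simp add: power_divide field_simps) (simp add: w_def)
        have "ultraspherical 0 (y / sqrt w) / sqrt w = 1 / (pi * sqrt (a * z))"
        proof -
          have "(a * z / w) powr (- (1/2)) = sqrt w / sqrt (a * z)"
            using wpos a True by (simp add: powr_minus powr_half_sqrt real_sqrt_divide field_simps)
          then show ?thesis
            using wpos ysq by (simp add: ultraspherical_def e Gamma_one_half_real)
        qed
        moreover have "(1 - w) powr (v - 1) = a powr (v - 1) * (1 - z) powr (v - 1)"
          unfolding w1 using a True by (simp add: powr_mult)
        moreover have "z powr (1/2 - 1) = 1 / sqrt z"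
          using True by (simp add: powr_minus powr_half_sqrt field_simps)
        ultimately have "v * (1 - w) powr (v - 1) * (ultraspherical 0 (y / sqrt w) / sqrt w) =
          v * a powr (v - 1) / (pi * sqrt a) * (z powr (1/2 - 1) * (1 - z) powr (v - 1))"
          by (simp add: real_sqrt_mult)
        then show ?thesis
          unfolding w_def[symmetric] h_def using True wi v a
          by (simp add: ennreal_mult[symmetric])
      next
        case False
        have "h w = 0"
        proof (cases "0 < w \<and> w < 1")
          case wi: True
          have "1 \<le> z \<or> z < 0" using False elim by auto
          then show ?thesis
          proof
            assume "1 \<le> z"
            then have "1 - w \<le> 0" unfolding w1 using a by (simp add: mult_nonneg_nonpos)
            then show ?thesis using wi by simp
          next
            assume "z < 0"
            then have "w < y\<^sup>2" using a by (simp add: w_def mult_pos_neg)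
            then have "sqrt w < \<bar>y\<bar>" using real_sqrt_less_mono[of w "y\<^sup>2"] by simp
            then have "1 \<le> \<bar>y / sqrt w\<bar>" using wi by (simp add: le_divide_eq)
            then show ?thesis by (simp add: h_def ultraspherical_def)
          qed
        qed (auto simp: h_def)
        then show ?thesis using False by (simp add: w_def[symmetric])
      qed
    qed
  qed
  also have "\<dots> = ennreal (v * a powr (v - 1) / (pi * sqrt a)) * ennreal (Beta (1/2) v)"
    using v by (subst nn_integral_cmult, simp, subst nn_integral_Beta) auto
  also have "ennreal a * \<dots> = ennreal (a * (v * a powr (v - 1) / (pi * sqrt a) * Beta (1/2) v))"
    using a v by (simp add: ennreal_mult[symmetric] Beta_def Gamma_real_nonneg)
  also have "a * (v * a powr (v - 1) / (pi * sqrt a) * Beta (1/2) v) = ultraspherical v y"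
  proof -
    have "a powr (v - 1/2) = a * a powr (v - 1) / sqrt a"
      using a by (simp add: powr_diff powr_half_sqrt)
    moreover have "Gamma (v + 1) = v * Gamma v"
      using v by (intro Gamma_plus1) (auto elim!: nonpos_Ints_cases)
    moreover have "a * (v * a powr (v - 1) / (pi * sqrt a) * Beta (1/2) v) =
        (v * Gamma v * (a * a powr (v - 1)) / (sqrt a * Gamma (v + 1/2))) * (sqrt pi / pi)"
      by (simp add: Beta_def Gamma_one_half_real add.commute mult_ac)
    moreover have "sqrt pi / pi = 1 / sqrt pi"
      by (simp add: real_div_sqrt field_simps)
    ultimately show ?thesis using True
      by (simp add: ultraspherical_def a_def[symmetric])
  qed
  finally show ?thesis by (simp add: h_def)
qed

section \<open>Indices of the conditional laws and the law of the cosine of an angle\<close>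

definition shape :: "nat \<Rightarrow> nat \<Rightarrow> real" where
  "shape m n = (if m = 0 then real n / 2 else real n + 1)"

lemma shape_nonneg [simp]: "0 \<le> shape m n"
  by (simp add: shape_def)

lemma angle_density_measurable [measurable]: "angle_density m \<in> borel_measurable borel"
  unfolding angle_density_def[abs_def] by measurable

lemma angle_density_nonneg [simp]: "0 \<le> angle_density m \<theta>"
  by (simp add: angle_density_def Gamma_real_nonneg sin_ge_zero)

text \<open>With \<open>x = cos \<theta>\<close>, the weight sin^(2m) d\<theta> becomes (1 - x^2)^(m
  - 1/2) dx, so the cosine of one angle is ultraspherical of index \<open>m\<close>.\<close>

lemma nn_integral_cos_angle:
  fixes h :: "real \<Rightarrow> real"
  assumes [measurable]: "h \<in> borel_measurable borel" and h: "\<And>x. 0 \<le> h x"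
  shows "(\<integral>\<^sup>+\<theta>. ennreal (h (cos \<theta>)) * ennreal (angle_density m \<theta>) \<partial>lborel) =
    (\<integral>\<^sup>+x. ennreal (h x) * ennreal (ultraspherical m x) \<partial>lborel)"
proof -
  \<comment> \<open>Cosine is decreasing on [0, pi], while the substitution rule wants a nonnegative
    derivative; hence \<open>- cos\<close> and a reflected integrand.\<close>
  define f where "f x = h (- x) * ultraspherical m (- x)" for x :: real
  have [measurable]: "f \<in> borel_measurable borel"
    unfolding f_def[abs_def] by measurable
  have AE: "AE \<theta> in lborel. \<theta> \<noteq> (0::real) \<and> \<theta> \<noteq> pi"
    by (auto intro!: AE_conjI AE_lborel_singleton)
  have "(\<integral>\<^sup>+x. ennreal (h x) * ennreal (ultraspherical m x) \<partial>lborel) =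
      (\<integral>\<^sup>+x. ennreal (h (0 + -1 * x)) * ennreal (ultraspherical m (0 + -1 * x)) \<partial>lborel)"
    by (subst nn_integral_real_affine[where c = "-1" and t = 0]) auto
  also have "\<dots> = (\<integral>\<^sup>+x. f x * indicator {- cos 0..- cos pi} x \<partial>lborel)"
    by (intro nn_integral_cong)
       (auto simp: f_def h ennreal_mult ultraspherical_def split: split_indicator)
  also have "\<dots> = (\<integral>\<^sup>+\<theta>. f (- cos \<theta>) * sin \<theta> * indicator {0..pi} \<theta> \<partial>lborel)"
    by (rule nn_integral_substitution)
       (auto intro!: derivative_eq_intros continuous_intros sin_ge_zero simp: set_borel_measurable_def)
  also have "\<dots> = (\<integral>\<^sup>+\<theta>. ennreal (h (cos \<theta>)) * ennreal (angle_density m \<theta>) \<partial>lborel)"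
  proof (rule nn_integral_cong_AE, use AE in eventually_elim)
    fix \<theta> :: real
    assume \<theta>: "\<theta> \<noteq> 0 \<and> \<theta> \<noteq> pi"
    show "ennreal (f (- cos \<theta>) * sin \<theta> * indicator {0..pi} \<theta>) =
        ennreal (h (cos \<theta>)) * ennreal (angle_density m \<theta>)"
    proof (cases "0 < \<theta> \<and> \<theta> < pi")
      case True
      then have s: "0 < sin \<theta>" by (simp add: sin_gt_zero)
      have "1 - (cos \<theta>)\<^sup>2 = (sin \<theta>)\<^sup>2" by (simp add: sin_squared_eq)
      moreover have "\<bar>cos \<theta>\<bar> < 1"
        using calculation s by (metis abs_square_less_1 diff_gt_0_iff_gt zero_less_power)
      moreover have "((sin \<theta>)\<^sup>2) powr (m - 1/2) * sin \<theta> = sin \<theta> ^ (2 * m)"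
      proof -
        have "((sin \<theta>)\<^sup>2) powr (m - 1/2) * sin \<theta> = (sin \<theta> powr 2) powr (m - 1/2) * sin \<theta> powr 1"
          using s by simp
        also have "\<dots> = sin \<theta> powr (2 * (m - 1/2) + 1)"
          by (simp only: powr_powr powr_add)
        also have "\<dots> = sin \<theta> powr (real (2 * m))"
          by simp
        also have "\<dots> = sin \<theta> ^ (2 * m)"
          using s by (simp only: powr_realpow)
        finally show ?thesis .
      qed
      ultimately have "f (- cos \<theta>) * sin \<theta> = h (cos \<theta>) * angle_density m \<theta>"
        using True by (simp add: f_def ultraspherical_def angle_density_def mult.assoc)
      then show ?thesis
        using True h by (simp add: ennreal_mult'[symmetric])
    next
      case False
      then show ?thesis using \<theta> by (auto simp: angle_density_def)
    qed
  qed
  finally show ?thesis ..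
qed

lemma nn_integral_angle_shifted_moment:
  "(\<integral>\<^sup>+\<theta>. ennreal ((1 + cos \<theta>) ^ k) * ennreal (angle_density m \<theta>) \<partial>lborel) = ennreal (shifted_moment m k)"
proof -
  \<comment> \<open>\<open>nn_integral_cos_angle\<close> asks for a function nonnegative on the
    whole line; \<open>max 0\<close> changes nothing on the support.\<close>
  have c: "max 0 (1 + cos \<theta>) = 1 + cos \<theta>" for \<theta> :: real
    by (intro max_absorb2) (use cos_ge_minus_one[of \<theta>] in linarith)
  have "(\<integral>\<^sup>+\<theta>. ennreal ((1 + cos \<theta>) ^ k) * ennreal (angle_density m \<theta>) \<partial>lborel) =
    (\<integral>\<^sup>+\<theta>. ennreal (max 0 (1 + cos \<theta>) ^ k) * ennreal (angle_density m \<theta>) \<partial>lborel)"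
    by (simp only: c)
  also have "\<dots> = (\<integral>\<^sup>+x. ennreal (max 0 (1 + x) ^ k) * ennreal (ultraspherical m x) \<partial>lborel)"
    by (rule nn_integral_cos_angle) auto
  also have "\<dots> = (\<integral>\<^sup>+x. ennreal ((1 + x) ^ k) * ennreal (ultraspherical m x) \<partial>lborel)"
    by (intro nn_integral_cong) (auto simp: ultraspherical_def max_def)
  also have "\<dots> = ennreal (shifted_moment m k)"
    by (rule nn_integral_ultraspherical_shifted_moment) simp
  finally show ?thesis .
qed

section \<open>Convolution of the moment sequences\<close>

text \<open>The factor \<open>pochhammer (n + 1) k / fact k\<close> is (n + k)! / (n! k!). It
  converts the Poisson weight of \<open>n\<close> times \<open>s ^ k / fact k\<close> into the
  Erlang density of index \<open>n + k\<close>, which makes these sequences multiply under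
  convolution.\<close>

definition walk_coeff :: "nat \<Rightarrow> nat \<Rightarrow> nat \<Rightarrow> real" where
  "walk_coeff m n k = pochhammer (n + 1) k / fact k * shifted_moment (shape m n) k"

lemma walk_coeff_nonneg [simp]: "0 \<le> walk_coeff m n k"
  by (simp add: walk_coeff_def pochhammer_nonneg)

text \<open>For \<open>m = 0\<close> the generating function of \<open>walk_coeff 0 n\<close> is \<open>(1 - 2z) powr -((n+1)/2)\<close>.\<close>

lemma walk_coeff_0: "walk_coeff 0 n k = 2 ^ k * pochhammer ((real n + 1) / 2) k / fact k"
proof -
  have "pochhammer (real n + 1) k \<noteq> 0"
    using pochhammer_pos[of "real n + 1" k] by linarith
  then show ?thesis
    by (simp add: walk_coeff_def shifted_moment_def shape_def add_divide_distrib)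
qed

text \<open>
  For \<open>m = 1\<close> it is the \<open>2(n+1)\<close>-st power of the Catalan series \<open>C = 1 + x C\<^sup>2\<close> at \<open>x = z/2\<close>. The numbers
  \<open>ballot r k = r / (2k + r) * (2k + r choose k)\<close> are the coefficients of \<open>C ^ r\<close>; they are determined by
  \<open>C ^ (r + 1) = C ^ r + x * C ^ (r + 2)\<close>.
\<close>

definition ballot :: "nat \<Rightarrow> nat \<Rightarrow> real" where
  "ballot r k = (if k = 0 then 1 else real r * pochhammer (real r + real k + 1) (k - 1) / fact k)"

lemma ballot_Suc: "ballot (Suc r) (Suc k) = ballot r (Suc k) + ballot (Suc (Suc r)) k"
proof (cases k)
  case 0
  then show ?thesis by (simp add: ballot_def)
next
  case (Suc j)
  \<comment> \<open>With this \<open>a\<close> all three terms share the factor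
    \<open>pochhammer (a + 1) j\<close>, and the claim reduces to a polynomial identity in
    \<open>r\<close> and \<open>j\<close>.\<close>
  define a where "a = real r + real j + 3"
  have p1: "pochhammer a (Suc j) = a * pochhammer (a + 1) j"
    by (rule pochhammer_rec)
  have p2: "pochhammer (a + 1) (Suc j) = (a + 1 + j) * pochhammer (a + 1) j"
    by (simp add: pochhammer_Suc mult.commute)
  have e: "real r + (2 + (real j + 1)) = a" by (simp add: a_def)
  have b1: "ballot (Suc r) (Suc k) = (real r + 1) * ((a + 1 + j) * pochhammer (a + 1) j) / ((real j + 2) * ((real j + 1) * fact j))"
    and b2: "ballot r (Suc k) = real r * (a * pochhammer (a + 1) j) / ((real j + 2) * ((real j + 1) * fact j))"
    and b3: "ballot (Suc (Suc r)) k = (real r + 2) * pochhammer (a + 1) j / ((real j + 1) * fact j)"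
    unfolding p1[symmetric] p2[symmetric] by (simp_all add: ballot_def Suc a_def algebra_simps)
  have "(real r + 1) * (a + 1 + j) = real r * a + (real r + 2) * (real j + 2)"
    by (simp add: a_def algebra_simps)
  then have "(real r + 1) * ((a + 1 + j) * pochhammer (a + 1) j) =
      real r * (a * pochhammer (a + 1) j) + (real r + 2) * (real j + 2) * pochhammer (a + 1) j"
    by (metis (no_types) distrib_right mult.assoc)
  moreover have "(real r + 2) * pochhammer (a + 1) j / ((real j + 1) * fact j) =
      ((real r + 2) * (real j + 2) * pochhammer (a + 1) j) / ((real j + 2) * ((real j + 1) * fact j))"
    unfolding mult.left_commute[of _ "real j + 2"] mult.assoc[of _ "real j + 2"]
    by (rule mult_divide_mult_cancel_left[symmetric]) simp
  ultimately show ?thesis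
    unfolding b1 b2 b3 by (simp only: add_divide_distrib)
qed

text \<open>The coefficients of C^r C^s = C^(r+s). The recursion \<open>ballot_Suc\<close> lowers
  \<open>r\<close> at the same \<open>k\<close> but also produces a larger \<open>r\<close> at a
  smaller \<open>k\<close>; hence the outer induction on \<open>k\<close> for all \<open>r\<close>
  and \<open>s\<close>, with an inner one on \<open>r\<close>.\<close>

lemma ballot_convolution: "(\<Sum>i\<le>k. ballot r i * ballot s (k - i)) = ballot (r + s) k"
proof (induction k arbitrary: r s)
  case 0
  then show ?case by (simp add: ballot_def)
next
  case (Suc k)
  note IH = Suc.IH
  show ?case
  proof (induction r)
    case 0
    have "(\<Sum>i\<le>Suc k. ballot 0 i * ballot s (Suc k - i)) = (\<Sum>i\<le>Suc k. if i = 0 then ballot s (Suc k) else 0)"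
      by (intro sum.cong) (auto simp: ballot_def)
    then show ?case by simp
  next
    case (Suc r)
    have "(\<Sum>i\<le>Suc k. ballot (Suc r) i * ballot s (Suc k - i)) =
        ballot s (Suc k) + (\<Sum>i\<le>k. ballot (Suc r) (Suc i) * ballot s (k - i))"
      by (subst sum.atMost_Suc_shift) (simp add: ballot_def)
    also have "\<dots> = (ballot s (Suc k) + (\<Sum>i\<le>k. ballot r (Suc i) * ballot s (k - i))) +
        (\<Sum>i\<le>k. ballot (Suc (Suc r)) i * ballot s (k - i))"
      by (simp add: ballot_Suc distrib_right sum.distrib)
    also have "ballot s (Suc k) + (\<Sum>i\<le>k. ballot r (Suc i) * ballot s (k - i)) =
        (\<Sum>i\<le>Suc k. ballot r i * ballot s (Suc k - i))"
      by (subst sum.atMost_Suc_shift) (simp add: ballot_def)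
    also have "\<dots> + (\<Sum>i\<le>k. ballot (Suc (Suc r)) i * ballot s (k - i)) = ballot (Suc r + s) (Suc k)"
      by (simp only: Suc.IH IH ballot_Suc add_Suc)
    finally show ?case .
  qed
qed

text \<open>With \<open>x = n + 1\<close>, pochhammer duplication merges
  \<open>pochhammer x k\<close> and \<open>pochhammer (x + 1/2) k\<close> into
  \<open>pochhammer (2 * x) (2 * k)\<close>. Splitting this after \<open>k + 1\<close> factors
  cancels the denominator and leaves the \<open>k - 1\<close> factors that occur in
  \<open>ballot\<close>.\<close>

lemma walk_coeff_1: "walk_coeff 1 n k = ballot (2 * (n + 1)) k / 2 ^ k"
proof (cases k)
  case 0
  then show ?thesis by (simp add: walk_coeff_def shifted_moment_def ballot_def)
next
  case (Suc j)
  have dup: "pochhammer (2 * x) (2 * k) = 4 ^ k * pochhammer x k * pochhammer (x + 1/2) k" for x :: real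
    using pochhammer_double[of x k] by (simp add: power_mult)
  define x where "x = real n + 1"
  have x: "0 < x" by (simp add: x_def)
  have d: "pochhammer (2 * x) (2 * k) = 2 * x * pochhammer (2 * x + 1) k * pochhammer (2 * x + real k + 1) (k - 1)"
  proof -
    have "pochhammer (2 * x) (2 * k) = pochhammer (2 * x) (Suc k + (k - 1))"
      using Suc by (intro arg_cong2[where f = pochhammer]) auto
    also have "\<dots> = pochhammer (2 * x) (Suc k) * pochhammer (2 * x + real (Suc k)) (k - 1)"
      by (subst pochhammer_product') simp
    also have "pochhammer (2 * x) (Suc k) = 2 * x * pochhammer (2 * x + 1) k"
      by (rule pochhammer_rec)
    finally show ?thesis by (simp add: add_ac)
  qed
  have nz: "pochhammer (2 * x + 1) k \<noteq> 0"
    using pochhammer_pos[of "2 * x + 1" k] x by linarith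
  have "4 ^ k * (pochhammer x k * pochhammer (x + 1/2) k / pochhammer (2 * x + 1) k) =
      2 * x * pochhammer (2 * x + real k + 1) (k - 1)"
    using dup[of x] d nz by (simp add: field_simps)
  then have "2 ^ k * (2 ^ k * (pochhammer x k * pochhammer (x + 1/2) k / pochhammer (2 * x + 1) k)) =
      2 * x * pochhammer (2 * x + real k + 1) (k - 1)"
    by (simp add: power_mult_distrib[symmetric] mult.assoc[symmetric])
  moreover have "ballot (2 * (n + 1)) k = 2 * x * pochhammer (2 * x + real k + 1) (k - 1) / fact k"
    using Suc by (simp add: ballot_def x_def algebra_simps)
  moreover have "walk_coeff 1 n k = 2 ^ k * (pochhammer x k * pochhammer (x + 1/2) k / pochhammer (2 * x + 1) k) / fact k"
    by (simp add: walk_coeff_def shifted_moment_def shape_def x_def add_ac mult_ac)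
  moreover have "w = b / 2 ^ k" if "2 ^ k * (2 ^ k * q) = p" "b = p / fact k" "w = 2 ^ k * q / fact k" for w b p q :: real
    by (simp add: that(2,3) that(1)[symmetric])
  ultimately show ?thesis
    by blast
qed

text \<open>A single step is the case of no event, because \<open>shape m 0 = m\<close> for these
  two values of \<open>m\<close>.\<close>

lemma shifted_moment_eq_walk_coeff: "m \<in> {0, 1} \<Longrightarrow> shifted_moment m k = walk_coeff m 0 k"
  by (auto simp: walk_coeff_def shape_def pochhammer_fact[symmetric])

text \<open>In both cases the generating function of \<open>walk_coeff m n\<close> is the (n+1)-st
  power of the one for \<open>n = 0\<close>, that is, of the one-step moments.\<close>

lemma walk_coeff_convolution:
  assumes "m \<in> {0, 1}"
  shows "(\<Sum>i\<le>k. shifted_moment m i * walk_coeff m n (k - i)) = walk_coeff m (Suc n) k"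
proof -
  note sm = shifted_moment_eq_walk_coeff[OF assms]
  consider "m = 0" | "m = 1" using assms by auto
  then show ?thesis
  proof cases
    case 1
    have "(\<Sum>i\<le>k. shifted_moment m i * walk_coeff m n (k - i)) =
      (\<Sum>i\<le>k. 2 ^ k / fact k * (of_nat (k choose i) * pochhammer (1/2) i * pochhammer ((real n + 1) / 2) (k - i)))"
    proof (intro sum.cong refl)
      fix i assume "i \<in> {..k}"
      then have i: "i \<le> k" by simp
      have "(2::real) ^ k = 2 ^ i * 2 ^ (k - i)" using i by (simp flip: power_add)
      then show "shifted_moment m i * walk_coeff m n (k - i) =
        2 ^ k / fact k * (of_nat (k choose i) * pochhammer (1/2) i * pochhammer ((real n + 1) / 2) (k - i))"
        unfolding sm unfolding 1 walk_coeff_0 binomial_fact[OF i] by (simp add: field_simps)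
    qed
    also have "\<dots> = 2 ^ k / fact k * pochhammer (1/2 + (real n + 1) / 2) k"
      by (simp add: pochhammer_binomial_sum sum_distrib_left)
    finally show ?thesis unfolding 1 walk_coeff_0 by (simp add: field_simps)
  next
    case 2
    have "(\<Sum>i\<le>k. shifted_moment m i * walk_coeff m n (k - i)) =
      (\<Sum>i\<le>k. ballot 2 i * ballot (2 * (n + 1)) (k - i)) / 2 ^ k"
      unfolding sum_divide_distrib
    proof (intro sum.cong refl)
      fix i assume "i \<in> {..k}"
      then have "(2::real) ^ k = 2 ^ i * 2 ^ (k - i)" by (simp flip: power_add)
      then show "shifted_moment m i * walk_coeff m n (k - i) = ballot 2 i * ballot (2 * (n + 1)) (k - i) / 2 ^ k"
        unfolding sm unfolding 2 walk_coeff_1 by simp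
    qed
    also have "\<dots> = walk_coeff m (Suc n) k"
      unfolding ballot_convolution 2 walk_coeff_1 by (simp add: algebra_simps)
    finally show ?thesis .
  qed
qed

section \<open>Moments of the motion\<close>

text \<open>The sum of two independent Erlang variables, tested against \<open>f\<close>.
  \<open>erlang_density p\<close> has shape parameter \<open>p + 1\<close>, whence the extra
  \<open>Suc\<close> in the index of the sum.\<close>

lemma nn_integral_erlang_convolution:
  assumes l: "0 < l" and [measurable]: "f \<in> borel_measurable borel"
  shows "(\<integral>\<^sup>+u. ennreal (erlang_density p l u) * (\<integral>\<^sup>+w. ennreal (erlang_density i l w) * f (u + w) \<partial>lborel) \<partial>lborel) =
    (\<integral>\<^sup>+x. ennreal (erlang_density (Suc (p + i)) l x) * f x \<partial>lborel)"
proof -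
  have "(\<integral>\<^sup>+u. ennreal (erlang_density p l u) * (\<integral>\<^sup>+w. ennreal (erlang_density i l w) * f (u + w) \<partial>lborel) \<partial>lborel) =
      (\<integral>\<^sup>+u. (\<integral>\<^sup>+w. ennreal (erlang_density p l u) * (ennreal (erlang_density i l w) * f (u + w)) \<partial>lborel) \<partial>lborel)"
    by (simp add: nn_integral_cmult)
  also have "\<dots> = (\<integral>\<^sup>+w. (\<integral>\<^sup>+u. ennreal (erlang_density p l u) * (ennreal (erlang_density i l w) * f (u + w)) \<partial>lborel) \<partial>lborel)"
    by (rule lborel_pair.Fubini') simp
  also have "\<dots> = (\<integral>\<^sup>+w. (\<integral>\<^sup>+x. ennreal (erlang_density p l (x - w)) * (ennreal (erlang_density i l w) * f x) \<partial>lborel) \<partial>lborel)"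
  proof (rule nn_integral_cong)
    fix w :: real
    show "(\<integral>\<^sup>+u. ennreal (erlang_density p l u) * (ennreal (erlang_density i l w) * f (u + w)) \<partial>lborel) =
        (\<integral>\<^sup>+x. ennreal (erlang_density p l (x - w)) * (ennreal (erlang_density i l w) * f x) \<partial>lborel)"
      by (subst nn_integral_real_affine[where c = 1 and t = "- w"]) auto
  qed
  also have "\<dots> = (\<integral>\<^sup>+x. (\<integral>\<^sup>+w. ennreal (erlang_density p l (x - w)) * (ennreal (erlang_density i l w) * f x) \<partial>lborel) \<partial>lborel)"
    by (rule lborel_pair.Fubini') simp
  also have "\<dots> = (\<integral>\<^sup>+x. (\<integral>\<^sup>+w. ennreal (erlang_density p l (x - w)) * ennreal (erlang_density i l w) \<partial>lborel) * f x \<partial>lborel)"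
    by (simp add: nn_integral_multc mult.assoc[symmetric])
  also have "\<dots> = (\<integral>\<^sup>+x. ennreal (erlang_density (Suc (p + i)) l x) * f x \<partial>lborel)"
    using fun_cong[OF convolution_erlang_density[OF l, of p i]] by simp
  finally show ?thesis .
qed

text \<open>For divided powers the binomial theorem has no binomial coefficients, so averaging over
  one angle produces a convolution in the exponent.\<close>

lemma nn_integral_angle_binomial:
  assumes "0 \<le> z" "0 \<le> w"
  shows "(\<integral>\<^sup>+\<theta>. ennreal ((z + w * (1 + cos \<theta>)) ^ k / fact k) * ennreal (angle_density m \<theta>) \<partial>lborel) =
    (\<Sum>i\<le>k. ennreal (z ^ (k - i) / fact (k - i)) * (ennreal (w ^ i / fact i) * ennreal (shifted_moment m i)))"
proof -
  have v: "0 \<le> 1 + cos \<theta>" for \<theta> :: real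
    using cos_ge_minus_one[of \<theta>] by linarith
  have bin: "(z + y) ^ k / fact k = (\<Sum>i\<le>k. z ^ (k - i) / fact (k - i) * (y ^ i / fact i))" for y :: real
  proof -
    have "(z + y) ^ k / fact k = (\<Sum>i\<le>k. of_nat (k choose i) * y ^ i * z ^ (k - i)) / fact k"
      by (subst add.commute, subst binomial_ring) simp
    also have "\<dots> = (\<Sum>i\<le>k. z ^ (k - i) / fact (k - i) * (y ^ i / fact i))"
      unfolding sum_divide_distrib by (intro sum.cong) (auto simp: binomial_fact mult_ac)
    finally show ?thesis .
  qed
  have "ennreal ((z + w * (1 + cos \<theta>)) ^ k / fact k) * ennreal (angle_density m \<theta>) =
      (\<Sum>i\<le>k. ennreal (z ^ (k - i) / fact (k - i)) * (ennreal (w ^ i / fact i) * (ennreal ((1 + cos \<theta>) ^ i) * ennreal (angle_density m \<theta>))))" for \<theta>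
  proof -
    have "ennreal ((z + w * (1 + cos \<theta>)) ^ k / fact k) * ennreal (angle_density m \<theta>) =
        ennreal (\<Sum>i\<le>k. z ^ (k - i) / fact (k - i) * (w ^ i / fact i * ((1 + cos \<theta>) ^ i * angle_density m \<theta>)))"
      unfolding bin using assms v[of \<theta>]
      by (subst ennreal_mult[symmetric]) (auto simp: sum_distrib_left power_mult_distrib mult_ac intro!: sum_nonneg)
    also have "\<dots> = (\<Sum>i\<le>k. ennreal (z ^ (k - i) / fact (k - i) * (w ^ i / fact i * ((1 + cos \<theta>) ^ i * angle_density m \<theta>))))"
      using assms v[of \<theta>] by (subst sum_ennreal) auto
    also have "\<dots> = (\<Sum>i\<le>k. ennreal (z ^ (k - i) / fact (k - i)) * (ennreal (w ^ i / fact i) * (ennreal ((1 + cos \<theta>) ^ i) * ennreal (angle_density m \<theta>))))"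
      using assms v[of \<theta>] by (intro sum.cong refl) (simp only: ennreal_mult mult_nonneg_nonneg zero_le_power divide_nonneg_nonneg fact_ge_zero angle_density_nonneg)
    finally show ?thesis .
  qed
  then show ?thesis
    by (simp add: nn_integral_sum nn_integral_cmult nn_integral_angle_shifted_moment)
qed

section \<open>The steps of the motion and the joint moments of position and event time\<close>

locale random_motion = prob_space M for M :: "'a measure" +
  fixes c lam :: real and m :: nat and W \<Theta> :: "nat \<Rightarrow> 'a \<Rightarrow> real"
  assumes c: "0 < c" and lam: "0 < lam" and m: "m \<in> {0, 1}" and data: "motion_data M lam m W \<Theta>"
begin

lemma W_distributed: "1 \<le> j \<Longrightarrow> distributed M lborel (W j) (\<lambda>x. ennreal (exponential_density lam x))"
  and \<Theta>_distributed: "1 \<le> j \<Longrightarrow> distributed M lborel (\<Theta> j) (\<lambda>x. ennreal (angle_density m x))"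
  and indep: "indep_vars (\<lambda>_. borel) (case_sum W \<Theta>) ({1..} <+> {1..})"
  using data by (auto simp: motion_data_def)

lemma W_measurable [measurable]: "1 \<le> j \<Longrightarrow> W j \<in> borel_measurable M"
  and \<Theta>_measurable [measurable]: "1 \<le> j \<Longrightarrow> \<Theta> j \<in> borel_measurable M"
  using distributed_measurable[OF W_distributed] distributed_measurable[OF \<Theta>_distributed] by auto

lemma event_time_measurable [measurable]: "event_time W j \<in> borel_measurable M"
  unfolding event_time_def[abs_def] by (intro borel_measurable_sum) auto

lemma event_time_Suc: "event_time W (Suc j) \<omega> = event_time W j \<omega> + W (Suc j) \<omega>"
  by (simp add: event_time_def)

lemma distr_W: "1 \<le> j \<Longrightarrow> distr M borel (W j) = density lborel (\<lambda>x. ennreal (exponential_density lam x))"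
  using distributed_distr_eq_density[OF W_distributed, of j] by (simp cong: distr_cong)

lemma distr_\<Theta>: "1 \<le> j \<Longrightarrow> distr M borel (\<Theta> j) = density lborel (\<lambda>x. ennreal (angle_density m x))"
  using distributed_distr_eq_density[OF \<Theta>_distributed, of j] by (simp cong: distr_cong)

text \<open>The displacement after \<open>n\<close> complete steps at unit speed plus the elapsed
  time \<open>event_time W n\<close>; adding the time makes it nonnegative and matches the shift in
  \<open>shifted_moment\<close>.\<close>

definition position :: "nat \<Rightarrow> 'a \<Rightarrow> real" where
  "position n \<omega> = (\<Sum>j=1..n. W j \<omega> * (1 + cos (\<Theta> j \<omega>)))"

lemma position_measurable [measurable]: "position n \<in> borel_measurable M"
  unfolding position_def[abs_def] by (intro borel_measurable_sum borel_measurable_times) auto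

lemma position_Suc: "position (Suc n) \<omega> = position n \<omega> + W (Suc n) \<omega> * (1 + cos (\<Theta> (Suc n) \<omega>))"
  by (simp add: position_def)

lemma AE_W_pos: "AE \<omega> in M. \<forall>j\<ge>1. 0 < W j \<omega>"
proof -
  have "AE \<omega> in M. 0 < W j \<omega>" if j: "1 \<le> j" for j
  proof -
    have "AE x in lborel. x \<noteq> (0::real)" by (rule AE_lborel_singleton)
    then have "AE x in lborel. 0 < ennreal (exponential_density lam x) \<longrightarrow> 0 < x"
      by eventually_elim (auto simp: exponential_density_def split: if_splits)
    then have "AE x in distr M borel (W j). 0 < x"
      unfolding distr_W[OF j] by (subst AE_density) auto
    then show ?thesis using j by (subst (asm) AE_distr_iff) auto
  qed
  then show ?thesis
    by (subst AE_all_countable) (auto intro: AE_impI)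
qed

lemma position_nonneg: "(\<And>j. 1 \<le> j \<Longrightarrow> 0 < W j \<omega>) \<Longrightarrow> 0 \<le> position n \<omega>"
  unfolding position_def
  by (intro sum_nonneg mult_nonneg_nonneg) (auto simp: less_imp_le intro: order_trans[OF _ add_left_mono[OF cos_ge_minus_one]])

text \<open>Past and next step are functions of disjoint blocks of the independent family, so their
  joint law is a product; the step itself is again a product of an exponential law and an angle law,
  and Tonelli separates all of them.\<close>

lemma nn_integral_next_step:
  fixes g :: "real \<Rightarrow> real \<Rightarrow> real \<Rightarrow> real \<Rightarrow> ennreal"
  assumes [measurable]: "(\<lambda>x. g (fst (fst x)) (snd (fst x)) (fst (snd x)) (snd (snd x))) \<in> borel_measurable ((borel \<Otimes>\<^sub>M borel) \<Otimes>\<^sub>M (borel \<Otimes>\<^sub>M borel))"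
  shows "(\<integral>\<^sup>+\<omega>. g (event_time W n \<omega>) (position n \<omega>) (W (Suc n) \<omega>) (\<Theta> (Suc n) \<omega>) \<partial>M) =
    (\<integral>\<^sup>+\<omega>. (\<integral>\<^sup>+w. ennreal (exponential_density lam w) *
      (\<integral>\<^sup>+\<theta>. g (event_time W n \<omega>) (position n \<omega>) w \<theta> * ennreal (angle_density m \<theta>) \<partial>lborel) \<partial>lborel) \<partial>M)"
proof -
  let ?P = "borel \<Otimes>\<^sub>M borel :: (real \<times> real) measure"
  let ?past = "\<lambda>\<omega>. (event_time W n \<omega>, position n \<omega>)"
  let ?step = "\<lambda>\<omega>. (W (Suc n) \<omega>, \<Theta> (Suc n) \<omega>)"
  let ?X = "case_sum W \<Theta>"
  define A :: "(nat + nat) set" where "A = {1..n} <+> {1..n}"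
  define B :: "(nat + nat) set" where "B = {Suc n} <+> {Suc n}"
  have AB: "A \<inter> B = {}" "A \<subseteq> {1..} <+> {1..}" "B \<subseteq> {1..} <+> {1..}"
    by (auto simp: A_def B_def)
  have iv1: "indep_var ?P ?past ?P ?step"
  proof -
    let ?f = "\<lambda>f :: nat + nat \<Rightarrow> real. (\<Sum>i=1..n. f (Inl i), \<Sum>i=1..n. f (Inl i) * (1 + cos (f (Inr i))))"
    let ?g = "\<lambda>f :: nat + nat \<Rightarrow> real. (f (Inl (Suc n)), f (Inr (Suc n)))"
    have "indep_var ?P (?f \<circ> (\<lambda>\<omega>. restrict (\<lambda>i. ?X i \<omega>) A)) ?P (?g \<circ> (\<lambda>\<omega>. restrict (\<lambda>i. ?X i \<omega>) B))"
    proof (rule indep_var_compose[OF indep_var_restrict[OF indep AB]])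
      have [measurable]: "i \<in> {1..n} \<Longrightarrow> (\<lambda>f. f (Inl i)) \<in> borel_measurable (Pi\<^sub>M A (\<lambda>_. borel :: real measure))"
        "i \<in> {1..n} \<Longrightarrow> (\<lambda>f. f (Inr i)) \<in> borel_measurable (Pi\<^sub>M A (\<lambda>_. borel :: real measure))" for i
        by (auto simp: A_def intro!: measurable_component_singleton)
      show "?f \<in> measurable (Pi\<^sub>M A (\<lambda>_. borel)) ?P"
        by measurable
      have [measurable]: "(\<lambda>f. f (Inl (Suc n))) \<in> borel_measurable (Pi\<^sub>M B (\<lambda>_. borel :: real measure))"
        "(\<lambda>f. f (Inr (Suc n))) \<in> borel_measurable (Pi\<^sub>M B (\<lambda>_. borel :: real measure))"
        by (auto simp: B_def intro!: measurable_component_singleton)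
      show "?g \<in> measurable (Pi\<^sub>M B (\<lambda>_. borel)) ?P"
        by measurable
    qed
    also have "?f \<circ> (\<lambda>\<omega>. restrict (\<lambda>i. ?X i \<omega>) A) = ?past"
      by (auto simp: fun_eq_iff A_def event_time_def position_def intro!: sum.cong)
    also have "?g \<circ> (\<lambda>\<omega>. restrict (\<lambda>i. ?X i \<omega>) B) = ?step"
      by (auto simp: fun_eq_iff B_def)
    finally show ?thesis .
  qed
  have iv2: "indep_var borel (W (Suc n)) borel (\<Theta> (Suc n))"
  proof -
    let ?f = "\<lambda>f :: nat + nat \<Rightarrow> real. f (Inl (Suc n))"
    let ?g = "\<lambda>f :: nat + nat \<Rightarrow> real. f (Inr (Suc n))"
    have "indep_var borel (?f \<circ> (\<lambda>\<omega>. restrict (\<lambda>i. ?X i \<omega>) {Inl (Suc n)})) borel (?g \<circ> (\<lambda>\<omega>. restrict (\<lambda>i. ?X i \<omega>) {Inr (Suc n)}))"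
      by (rule indep_var_compose[OF indep_var_restrict[OF indep]]) (auto intro!: measurable_component_singleton)
    also have "?f \<circ> (\<lambda>\<omega>. restrict (\<lambda>i. ?X i \<omega>) {Inl (Suc n)}) = W (Suc n)"
      by (auto simp: fun_eq_iff)
    also have "?g \<circ> (\<lambda>\<omega>. restrict (\<lambda>i. ?X i \<omega>) {Inr (Suc n)}) = \<Theta> (Suc n)"
      by (auto simp: fun_eq_iff)
    finally show ?thesis .
  qed
  let ?E = "density lborel (\<lambda>x. ennreal (exponential_density lam x))"
  let ?D = "density lborel (\<lambda>x. ennreal (angle_density m x))"
  have step: "distr M ?P ?step = ?E \<Otimes>\<^sub>M ?D"
    using iv2 unfolding indep_var_distribution_eq by (simp add: distr_W distr_\<Theta>)
  have ED: "sets (?E \<Otimes>\<^sub>M ?D) = sets ?P"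
    by (rule sets_pair_measure_cong) auto
  interpret D: prob_space ?D
    unfolding distr_\<Theta>[of 1, simplified, symmetric] by (rule prob_space_distr) simp
  interpret S: prob_space "distr M ?P ?step"
    by (rule prob_space_distr) measurable
  let ?G = "\<lambda>x. g (fst (fst x)) (snd (fst x)) (fst (snd x)) (snd (snd x))"
  have "(\<integral>\<^sup>+\<omega>. g (event_time W n \<omega>) (position n \<omega>) (W (Suc n) \<omega>) (\<Theta> (Suc n) \<omega>) \<partial>M) =
      (\<integral>\<^sup>+x. ?G x \<partial>distr M (?P \<Otimes>\<^sub>M ?P) (\<lambda>\<omega>. (?past \<omega>, ?step \<omega>)))"
    by (subst nn_integral_distr) auto
  also have "\<dots> = (\<integral>\<^sup>+x. ?G x \<partial>(distr M ?P ?past \<Otimes>\<^sub>M distr M ?P ?step))"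
    using iv1 unfolding indep_var_distribution_eq by simp
  also have "\<dots> = (\<integral>\<^sup>+x. \<integral>\<^sup>+y. ?G (x, y) \<partial>distr M ?P ?step \<partial>distr M ?P ?past)"
    by (rule S.nn_integral_fst[symmetric]) measurable
  also have "\<dots> = (\<integral>\<^sup>+\<omega>. \<integral>\<^sup>+y. ?G (?past \<omega>, y) \<partial>distr M ?P ?step \<partial>M)"
    by (subst nn_integral_distr) auto
  also have "\<dots> = (\<integral>\<^sup>+\<omega>. (\<integral>\<^sup>+w. ennreal (exponential_density lam w) *
      (\<integral>\<^sup>+\<theta>. g (event_time W n \<omega>) (position n \<omega>) w \<theta> * ennreal (angle_density m \<theta>) \<partial>lborel) \<partial>lborel) \<partial>M)"
  proof (rule nn_integral_cong)
    fix \<omega>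
    define h where "h y = ?G (?past \<omega>, y)" for y
    have h [measurable]: "h \<in> borel_measurable ?P"
      unfolding h_def[abs_def] by measurable
    have "(\<integral>\<^sup>+y. h y \<partial>distr M ?P ?step) = (\<integral>\<^sup>+w. \<integral>\<^sup>+\<theta>. h (w, \<theta>) \<partial>?D \<partial>?E)"
      unfolding step by (rule D.nn_integral_fst[symmetric]) (simp add: measurable_cong_sets[OF ED refl] h)
    also have "\<dots> = (\<integral>\<^sup>+w. ennreal (exponential_density lam w) * (\<integral>\<^sup>+\<theta>. h (w, \<theta>) \<partial>?D) \<partial>lborel)"
      by (rule nn_integral_density) measurable
    also have "\<dots> = (\<integral>\<^sup>+w. ennreal (exponential_density lam w) * (\<integral>\<^sup>+\<theta>. h (w, \<theta>) * ennreal (angle_density m \<theta>) \<partial>lborel) \<partial>lborel)"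
      by (simp add: nn_integral_density mult.commute)
    finally show "(\<integral>\<^sup>+y. ?G (?past \<omega>, y) \<partial>distr M ?P ?step) = (\<integral>\<^sup>+w. ennreal (exponential_density lam w) *
      (\<integral>\<^sup>+\<theta>. g (event_time W n \<omega>) (position n \<omega>) w \<theta> * ennreal (angle_density m \<theta>) \<partial>lborel) \<partial>lborel)"
      by (simp add: h_def)
  qed
  finally show ?thesis .
qed

end

text \<open>Lets an identity between nonnegative reals act inside a product with the possibly
  infinite factors \<open>F\<close> and \<open>P\<close>.\<close>

lemma ennreal_rearrange:
  fixes a b c d e :: real and F P :: ennreal
  assumes eq: "a * b * c = d * e" and nonneg: "0 \<le> a" "0 \<le> b" "0 \<le> c" "0 \<le> d" "0 \<le> e"
  shows "ennreal a * (F * (P * (ennreal b * ennreal c))) = ennreal d * (P * (ennreal e * F))"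
proof -
  have "ennreal a * (F * (P * (ennreal b * ennreal c))) = (ennreal a * ennreal b * ennreal c) * (P * F)"
    by (simp only: mult_ac)
  also have "ennreal a * ennreal b * ennreal c = ennreal (a * b * c)"
    using nonneg by (simp only: ennreal_mult mult_nonneg_nonneg)
  also have "\<dots> = ennreal d * ennreal e"
    unfolding eq using nonneg by (simp only: ennreal_mult)
  also have "\<dots> * (P * F) = ennreal d * (P * (ennreal e * F))"
    by (simp only: mult_ac)
  finally show ?thesis .
qed

context random_motion
begin

text \<open>The identity that lets a divided power of the waiting time be absorbed into its
  density.\<close>

lemma exponential_eq_erlang:
  "0 \<le> w \<Longrightarrow> exponential_density lam w * (w ^ i / fact i) = erlang_density i lam w / lam ^ i"
  using lam by (simp add: erlang_density_def)

text \<open>The k-th divided moment of the position tilts the law of the event time from Erlang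
  index \<open>n\<close> to \<open>n + k\<close>. The test function \<open>f\<close> carries the
  event time through the induction. The count starts at \<open>Suc n\<close> because
  \<open>event_time W 0\<close> is constantly 0 and has no density.\<close>

lemma position_moment:
  assumes [measurable]: "f \<in> borel_measurable borel"
  shows "(\<integral>\<^sup>+\<omega>. ennreal (position (Suc n) \<omega> ^ k / fact k) * f (event_time W (Suc n) \<omega>) \<partial>M) =
    ennreal (walk_coeff m n k / lam ^ k) * (\<integral>\<^sup>+u. ennreal (erlang_density (n + k) lam u) * f u \<partial>lborel)"
  using assms
proof (induction n arbitrary: k f)
  case (0 k f)
  note [measurable] = 0
  have "(\<integral>\<^sup>+\<omega>. ennreal (position (Suc 0) \<omega> ^ k / fact k) * f (event_time W (Suc 0) \<omega>) \<partial>M) =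
      (\<integral>\<^sup>+\<omega>. ennreal ((position 0 \<omega> + W (Suc 0) \<omega> * (1 + cos (\<Theta> (Suc 0) \<omega>))) ^ k / fact k) *
         f (event_time W 0 \<omega> + W (Suc 0) \<omega>) \<partial>M)"
    by (simp only: position_Suc event_time_Suc)
  also have "\<dots> = (\<integral>\<^sup>+\<omega>. (\<integral>\<^sup>+w. ennreal (exponential_density lam w) *
      (\<integral>\<^sup>+\<theta>. ennreal ((position 0 \<omega> + w * (1 + cos \<theta>)) ^ k / fact k) * f (event_time W 0 \<omega> + w) * ennreal (angle_density m \<theta>) \<partial>lborel) \<partial>lborel) \<partial>M)"
    by (rule nn_integral_next_step[where g = "\<lambda>u z w \<theta>. ennreal ((z + w * (1 + cos \<theta>)) ^ k / fact k) * f (u + w)"]) measurable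
  also have "\<dots> = (\<integral>\<^sup>+w. ennreal (exponential_density lam w) *
      (\<integral>\<^sup>+\<theta>. f w * (ennreal ((0 + w * (1 + cos \<theta>)) ^ k / fact k) * ennreal (angle_density m \<theta>)) \<partial>lborel) \<partial>lborel)"
    by (simp add: position_def event_time_def emeasure_space_1 mult_ac)
  also have "\<dots> = (\<integral>\<^sup>+w. ennreal (walk_coeff m 0 k / lam ^ k) * (ennreal (erlang_density k lam w) * f w) \<partial>lborel)"
  proof (rule nn_integral_cong)
    fix w :: real
    note sm = shifted_moment_eq_walk_coeff[OF m]
    show "ennreal (exponential_density lam w) *
      (\<integral>\<^sup>+\<theta>. f w * (ennreal ((0 + w * (1 + cos \<theta>)) ^ k / fact k) * ennreal (angle_density m \<theta>)) \<partial>lborel) =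
      ennreal (walk_coeff m 0 k / lam ^ k) * (ennreal (erlang_density k lam w) * f w)"
    proof (cases "0 \<le> w")
      case True
      have "(\<Sum>i\<le>k. ennreal (0 ^ (k - i) / fact (k - i)) * (ennreal (w ^ i / fact i) * ennreal (shifted_moment m i))) =
          (\<Sum>i\<le>k. if i = k then ennreal (w ^ k / fact k) * ennreal (shifted_moment m k) else 0)"
        by (intro sum.cong) auto
      then have I: "(\<integral>\<^sup>+\<theta>. ennreal ((0 + w * (1 + cos \<theta>)) ^ k / fact k) * ennreal (angle_density m \<theta>) \<partial>lborel) =
          ennreal (w ^ k / fact k) * ennreal (shifted_moment m k)"
        using nn_integral_angle_binomial[of 0 w k m] True by simp
      then have "ennreal (exponential_density lam w) *
        (\<integral>\<^sup>+\<theta>. f w * (ennreal ((0 + w * (1 + cos \<theta>)) ^ k / fact k) * ennreal (angle_density m \<theta>)) \<partial>lborel) =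
        ennreal (exponential_density lam w * (w ^ k / fact k)) * ennreal (walk_coeff m 0 k) * f w"
      proof -
        have "ennreal (exponential_density lam w * (w ^ k / fact k)) = ennreal (exponential_density lam w) * ennreal (w ^ k / fact k)"
          using lam True by (intro ennreal_mult) auto
        moreover have "(\<integral>\<^sup>+\<theta>. f w * (ennreal ((0 + w * (1 + cos \<theta>)) ^ k / fact k) * ennreal (angle_density m \<theta>)) \<partial>lborel) =
            f w * (ennreal (w ^ k / fact k) * ennreal (walk_coeff m 0 k))"
          unfolding I[unfolded sm, symmetric] by (rule nn_integral_cmult) measurable
        ultimately show ?thesis
          by (simp only: mult_ac)
      qed
      also have "ennreal (exponential_density lam w * (w ^ k / fact k)) * ennreal (walk_coeff m 0 k) =
          ennreal (walk_coeff m 0 k / lam ^ k) * ennreal (erlang_density k lam w)"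
        unfolding exponential_eq_erlang[OF True] using lam by (simp add: ennreal_mult[symmetric] mult.commute)
      finally show ?thesis by (simp add: mult.assoc)
    qed (simp add: erlang_density_def exponential_density_def)
  qed
  also have "\<dots> = ennreal (walk_coeff m 0 k / lam ^ k) * (\<integral>\<^sup>+u. ennreal (erlang_density (0 + k) lam u) * f u \<partial>lborel)"
    by (simp add: nn_integral_cmult)
  finally show ?case .
next
  case (Suc n k f)
  note [measurable] = Suc.prems
  let ?Z = "position (Suc n)" and ?S = "event_time W (Suc n)"
  \<comment> \<open>The test function seen by the first \<open>Suc n\<close> steps: \<open>f\<close>
    averaged over the new waiting time after tilting by its i-th power.\<close>
  define F where "F i u = (\<integral>\<^sup>+w. ennreal (erlang_density i lam w) * f (u + w) \<partial>lborel)" for i u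
  have F [measurable]: "F i \<in> borel_measurable borel" for i
    unfolding F_def[abs_def] by measurable
  have "(\<integral>\<^sup>+\<omega>. ennreal (position (Suc (Suc n)) \<omega> ^ k / fact k) * f (event_time W (Suc (Suc n)) \<omega>) \<partial>M) =
      (\<integral>\<^sup>+\<omega>. ennreal ((?Z \<omega> + W (Suc (Suc n)) \<omega> * (1 + cos (\<Theta> (Suc (Suc n)) \<omega>))) ^ k / fact k) *
         f (?S \<omega> + W (Suc (Suc n)) \<omega>) \<partial>M)"
    by (subst position_Suc, subst event_time_Suc) simp
  also have "\<dots> = (\<integral>\<^sup>+\<omega>. (\<integral>\<^sup>+w. ennreal (exponential_density lam w) *
      (\<integral>\<^sup>+\<theta>. ennreal ((?Z \<omega> + w * (1 + cos \<theta>)) ^ k / fact k) * f (?S \<omega> + w) * ennreal (angle_density m \<theta>) \<partial>lborel) \<partial>lborel) \<partial>M)"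
    by (rule nn_integral_next_step[where g = "\<lambda>u z w \<theta>. ennreal ((z + w * (1 + cos \<theta>)) ^ k / fact k) * f (u + w)"]) measurable
  also have "\<dots> = (\<integral>\<^sup>+\<omega>. (\<Sum>i\<le>k. ennreal (shifted_moment m i / lam ^ i) *
      (ennreal (?Z \<omega> ^ (k - i) / fact (k - i)) * F i (?S \<omega>))) \<partial>M)"
  proof (rule nn_integral_cong_AE, use AE_W_pos in eventually_elim)
    fix \<omega> assume "\<forall>j\<ge>1. 0 < W j \<omega>"
    then have Z: "0 \<le> ?Z \<omega>" by (intro position_nonneg) auto
    have "ennreal (exponential_density lam w) *
      (\<integral>\<^sup>+\<theta>. ennreal ((?Z \<omega> + w * (1 + cos \<theta>)) ^ k / fact k) * f (?S \<omega> + w) * ennreal (angle_density m \<theta>) \<partial>lborel) =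
      (\<Sum>i\<le>k. ennreal (shifted_moment m i / lam ^ i) * (ennreal (?Z \<omega> ^ (k - i) / fact (k - i)) * (ennreal (erlang_density i lam w) * f (?S \<omega> + w))))" for w
    proof (cases "0 \<le> w")
      case True
      have pull: "(\<integral>\<^sup>+\<theta>. ennreal ((?Z \<omega> + w * (1 + cos \<theta>)) ^ k / fact k) * f (?S \<omega> + w) * ennreal (angle_density m \<theta>) \<partial>lborel) =
          f (?S \<omega> + w) * (\<integral>\<^sup>+\<theta>. ennreal ((?Z \<omega> + w * (1 + cos \<theta>)) ^ k / fact k) * ennreal (angle_density m \<theta>) \<partial>lborel)"
        by (subst nn_integral_cmult[symmetric]) (auto simp: mult_ac)
      have "ennreal (exponential_density lam w) *
        (\<integral>\<^sup>+\<theta>. ennreal ((?Z \<omega> + w * (1 + cos \<theta>)) ^ k / fact k) * f (?S \<omega> + w) * ennreal (angle_density m \<theta>) \<partial>lborel) =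
          (\<Sum>i\<le>k. ennreal (exponential_density lam w) * (f (?S \<omega> + w) *
            (ennreal (?Z \<omega> ^ (k - i) / fact (k - i)) * (ennreal (w ^ i / fact i) * ennreal (shifted_moment m i)))))"
        unfolding pull nn_integral_angle_binomial[OF Z True] by (simp add: sum_distrib_left)
      also have "\<dots> = (\<Sum>i\<le>k. ennreal (shifted_moment m i / lam ^ i) * (ennreal (?Z \<omega> ^ (k - i) / fact (k - i)) * (ennreal (erlang_density i lam w) * f (?S \<omega> + w))))"
      proof (intro sum.cong refl)
        fix i
        have eq: "exponential_density lam w * (w ^ i / fact i) * shifted_moment m i =
            shifted_moment m i / lam ^ i * erlang_density i lam w"
          unfolding exponential_eq_erlang[OF True] by (simp only: times_divide_eq_left times_divide_eq_right mult.commute)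
        show "ennreal (exponential_density lam w) * (f (?S \<omega> + w) *
            (ennreal (?Z \<omega> ^ (k - i) / fact (k - i)) * (ennreal (w ^ i / fact i) * ennreal (shifted_moment m i)))) =
            ennreal (shifted_moment m i / lam ^ i) * (ennreal (?Z \<omega> ^ (k - i) / fact (k - i)) * (ennreal (erlang_density i lam w) * f (?S \<omega> + w)))"
          by (rule ennreal_rearrange[OF eq]) (use lam True in \<open>simp_all\<close>)
      qed
      finally show ?thesis .
    qed (simp add: erlang_density_def exponential_density_def)
    then show "(\<integral>\<^sup>+w. ennreal (exponential_density lam w) *
      (\<integral>\<^sup>+\<theta>. ennreal ((?Z \<omega> + w * (1 + cos \<theta>)) ^ k / fact k) * f (?S \<omega> + w) * ennreal (angle_density m \<theta>) \<partial>lborel) \<partial>lborel) =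
      (\<Sum>i\<le>k. ennreal (shifted_moment m i / lam ^ i) * (ennreal (?Z \<omega> ^ (k - i) / fact (k - i)) * F i (?S \<omega>)))"
      by (simp add: F_def nn_integral_sum nn_integral_cmult)
  qed
  also have "\<dots> = (\<Sum>i\<le>k. ennreal (shifted_moment m i / lam ^ i) *
      (\<integral>\<^sup>+\<omega>. ennreal (?Z \<omega> ^ (k - i) / fact (k - i)) * F i (?S \<omega>) \<partial>M))"
    by (simp add: nn_integral_sum nn_integral_cmult)
  also have "\<dots> = (\<Sum>i\<le>k. ennreal (shifted_moment m i / lam ^ i) * (ennreal (walk_coeff m n (k - i) / lam ^ (k - i)) *
      (\<integral>\<^sup>+u. ennreal (erlang_density (Suc n + k) lam u) * f u \<partial>lborel)))"
  \<comment> \<open>The earlier steps contribute Erlang index \<open>n + (k - i)\<close> and the new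
    one index \<open>i\<close>; their convolution has index \<open>Suc n + k\<close> for every
    \<open>i\<close>, so the time integral factors out of the sum.\<close>
  proof (intro sum.cong refl)
    fix i assume "i \<in> {..k}"
    then have i: "Suc (n + (k - i) + i) = Suc n + k" by simp
    show "ennreal (shifted_moment m i / lam ^ i) *
      (\<integral>\<^sup>+\<omega>. ennreal (?Z \<omega> ^ (k - i) / fact (k - i)) * F i (?S \<omega>) \<partial>M) =
      ennreal (shifted_moment m i / lam ^ i) * (ennreal (walk_coeff m n (k - i) / lam ^ (k - i)) *
      (\<integral>\<^sup>+u. ennreal (erlang_density (Suc n + k) lam u) * f u \<partial>lborel))"
      unfolding Suc.IH[OF F] unfolding F_def nn_integral_erlang_convolution[OF lam Suc.prems] i ..
  qed
  also have "\<dots> = ennreal (walk_coeff m (Suc n) k / lam ^ k) * (\<integral>\<^sup>+u. ennreal (erlang_density (Suc n + k) lam u) * f u \<partial>lborel)"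
  proof -
    have "(\<Sum>i\<le>k. ennreal (shifted_moment m i / lam ^ i) * ennreal (walk_coeff m n (k - i) / lam ^ (k - i))) =
        (\<Sum>i\<le>k. ennreal (shifted_moment m i * walk_coeff m n (k - i) / lam ^ k))"
    proof (intro sum.cong refl)
      fix i assume "i \<in> {..k}"
      then have "lam ^ k = lam ^ i * lam ^ (k - i)" by (simp flip: power_add)
      then show "ennreal (shifted_moment m i / lam ^ i) * ennreal (walk_coeff m n (k - i) / lam ^ (k - i)) =
          ennreal (shifted_moment m i * walk_coeff m n (k - i) / lam ^ k)"
        using lam by (simp add: ennreal_mult[symmetric])
    qed
    also have "\<dots> = ennreal (walk_coeff m (Suc n) k / lam ^ k)"
      using lam by (simp add: sum_ennreal walk_coeff_convolution[OF m, symmetric] sum_divide_distrib)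
    finally show ?thesis
      by (simp add: mult.assoc[symmetric] sum_distrib_right[symmetric])
  qed
  finally show ?case .
qed

lemma exponential_tail:
  assumes "0 \<le> a"
  shows "(\<integral>\<^sup>+w. ennreal (exponential_density lam w) * indicator {a<..} w \<partial>lborel) = ennreal (exp (- lam * a))"
proof -
  have "(\<integral>\<^sup>+w. ennreal (exponential_density lam w) * indicator {a<..} w \<partial>lborel) = emeasure (distr M borel (W 1)) {a<..}"
    by (simp add: distr_W emeasure_density)
  also have "\<dots> = emeasure M {\<omega> \<in> space M. a < W 1 \<omega>}"
    by (subst emeasure_distr) (auto intro!: arg_cong[where f = "emeasure M"])
  also have "\<dots> = ennreal (exp (- lam * a))"
    using exponential_distributedD_gt[OF W_distributed[of 1] assms lam] by (simp add: emeasure_eq_measure mult.commute)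
  finally show ?thesis .
qed

text \<open>On the event of exactly \<open>n\<close> events up to \<open>s\<close>, the last step
  has length \<open>s - event_time W n\<close>, and its waiting time only has to exceed this length.
  The tail probability combines with the divided power to an Erlang density at the remaining time,
  so convolution with the law of the event time yields the density at \<open>s\<close>.\<close>

lemma stopped_moment:
  assumes s: "0 < s"
  shows "(\<integral>\<^sup>+\<omega>. ennreal ((position n \<omega> + (s - event_time W n \<omega>) * (1 + cos (\<Theta> (Suc n) \<omega>))) ^ k / fact k) *
      indicator {\<omega>. event_time W n \<omega> \<le> s \<and> s < event_time W (Suc n) \<omega>} \<omega> \<partial>M) =
    ennreal (walk_coeff m n k * erlang_density (n + k) lam s / lam ^ Suc k)"
proof -
  let ?Z = "position n" and ?S = "event_time W n"
  have "(\<integral>\<^sup>+\<omega>. ennreal ((?Z \<omega> + (s - ?S \<omega>) * (1 + cos (\<Theta> (Suc n) \<omega>))) ^ k / fact k) *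
      indicator {\<omega>. ?S \<omega> \<le> s \<and> s < event_time W (Suc n) \<omega>} \<omega> \<partial>M) =
    (\<integral>\<^sup>+\<omega>. ennreal ((?Z \<omega> + (s - ?S \<omega>) * (1 + cos (\<Theta> (Suc n) \<omega>))) ^ k / fact k) *
      (indicator {..s} (?S \<omega>) * indicator {s - ?S \<omega><..} (W (Suc n) \<omega>)) \<partial>M)"
    by (intro nn_integral_cong) (auto simp: event_time_Suc split: split_indicator)
  also have "\<dots> = (\<integral>\<^sup>+\<omega>. (\<integral>\<^sup>+w. ennreal (exponential_density lam w) *
      (\<integral>\<^sup>+\<theta>. ennreal ((?Z \<omega> + (s - ?S \<omega>) * (1 + cos \<theta>)) ^ k / fact k) *
        (indicator {..s} (?S \<omega>) * indicator {s - ?S \<omega><..} w) * ennreal (angle_density m \<theta>) \<partial>lborel) \<partial>lborel) \<partial>M)"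
  proof (rule nn_integral_next_step[where g = "\<lambda>u z w \<theta>. ennreal ((z + (s - u) * (1 + cos \<theta>)) ^ k / fact k) *
        (indicator {..s} u * indicator {s - u<..} w)"])
    \<comment> \<open>The second indicator has an interval depending on the variable; as a
      conditional on an inequality it is accepted by the measurability prover.\<close>
    have "(\<lambda>x. ennreal ((snd (fst x) + (s - fst (fst x)) * (1 + cos (snd (snd x)))) ^ k / fact k) * (indicator {..s} (fst (fst x)) * indicator {s - fst (fst x)<..} (fst (snd x)))) =
        (\<lambda>x. ennreal ((snd (fst x) + (s - fst (fst x)) * (1 + cos (snd (snd x)))) ^ k / fact k) * (indicator {..s} (fst (fst x)) * (if s - fst (fst x) < fst (snd x) then 1 else 0)))"
      by (auto simp: fun_eq_iff split: split_indicator)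
    also have "\<dots> \<in> borel_measurable ((borel \<Otimes>\<^sub>M borel) \<Otimes>\<^sub>M (borel \<Otimes>\<^sub>M borel))"
      by measurable
    finally show "(\<lambda>x. ennreal ((snd (fst x) + (s - fst (fst x)) * (1 + cos (snd (snd x)))) ^ k / fact k) * (indicator {..s} (fst (fst x)) * indicator {s - fst (fst x)<..} (fst (snd x)))) \<in>
        borel_measurable ((borel \<Otimes>\<^sub>M borel) \<Otimes>\<^sub>M (borel \<Otimes>\<^sub>M borel))" .
  qed
  also have "\<dots> = (\<integral>\<^sup>+\<omega>. (\<Sum>i\<le>k. ennreal (shifted_moment m i / lam ^ Suc i) *
      (ennreal (?Z \<omega> ^ (k - i) / fact (k - i)) * ennreal (erlang_density i lam (s - ?S \<omega>)))) \<partial>M)"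
  proof (rule nn_integral_cong_AE, use AE_W_pos in eventually_elim)
    fix \<omega> assume "\<forall>j\<ge>1. 0 < W j \<omega>"
    then have Z: "0 \<le> ?Z \<omega>" by (intro position_nonneg) auto
    show "(\<integral>\<^sup>+w. ennreal (exponential_density lam w) *
      (\<integral>\<^sup>+\<theta>. ennreal ((?Z \<omega> + (s - ?S \<omega>) * (1 + cos \<theta>)) ^ k / fact k) *
        (indicator {..s} (?S \<omega>) * indicator {s - ?S \<omega><..} w) * ennreal (angle_density m \<theta>) \<partial>lborel) \<partial>lborel) =
      (\<Sum>i\<le>k. ennreal (shifted_moment m i / lam ^ Suc i) *
      (ennreal (?Z \<omega> ^ (k - i) / fact (k - i)) * ennreal (erlang_density i lam (s - ?S \<omega>))))"
    proof (cases "?S \<omega> \<le> s")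
      case True
      let ?r = "s - ?S \<omega>"
      have r: "0 \<le> ?r" using True by simp
      let ?I = "\<integral>\<^sup>+\<theta>. ennreal ((?Z \<omega> + ?r * (1 + cos \<theta>)) ^ k / fact k) * ennreal (angle_density m \<theta>) \<partial>lborel"
      have "(\<integral>\<^sup>+\<theta>. ennreal ((?Z \<omega> + ?r * (1 + cos \<theta>)) ^ k / fact k) *
        (indicator {..s} (?S \<omega>) * indicator {?r<..} w) * ennreal (angle_density m \<theta>) \<partial>lborel) =
        (\<integral>\<^sup>+\<theta>. indicator {?r<..} w * (ennreal ((?Z \<omega> + ?r * (1 + cos \<theta>)) ^ k / fact k) * ennreal (angle_density m \<theta>)) \<partial>lborel)" for w
        using True by (intro nn_integral_cong) (simp add: mult_ac)
      then have "(\<integral>\<^sup>+w. ennreal (exponential_density lam w) *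
        (\<integral>\<^sup>+\<theta>. ennreal ((?Z \<omega> + ?r * (1 + cos \<theta>)) ^ k / fact k) *
        (indicator {..s} (?S \<omega>) * indicator {?r<..} w) * ennreal (angle_density m \<theta>) \<partial>lborel) \<partial>lborel) =
        (\<integral>\<^sup>+w. ennreal (exponential_density lam w) * indicator {?r<..} w * ?I \<partial>lborel)"
        by (simp add: nn_integral_cmult mult.assoc)
      also have "\<dots> = ennreal (exp (- lam * ?r)) * ?I"
        by (subst nn_integral_multc) (simp_all only: exponential_tail[OF r], simp)
      also have "\<dots> = (\<Sum>i\<le>k. ennreal (exp (- lam * ?r)) *
            (ennreal (?Z \<omega> ^ (k - i) / fact (k - i)) * (ennreal (?r ^ i / fact i) * ennreal (shifted_moment m i))))"
        unfolding nn_integral_angle_binomial[OF Z r] by (simp add: sum_distrib_left)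
      also have "\<dots> = (\<Sum>i\<le>k. ennreal (shifted_moment m i / lam ^ Suc i) *
        (ennreal (?Z \<omega> ^ (k - i) / fact (k - i)) * ennreal (erlang_density i lam ?r)))"
      proof (intro sum.cong refl)
        fix i
        \<comment> \<open>The exponent is \<open>Suc i\<close> because the tail is the exponential
          density divided by one further \<open>lam\<close>.\<close>
        have eq: "exp (- lam * ?r) * (?r ^ i / fact i) * shifted_moment m i =
            shifted_moment m i / lam ^ Suc i * erlang_density i lam ?r"
          using lam r by (simp add: erlang_density_def)
        show "ennreal (exp (- lam * ?r)) *
            (ennreal (?Z \<omega> ^ (k - i) / fact (k - i)) * (ennreal (?r ^ i / fact i) * ennreal (shifted_moment m i))) =
            ennreal (shifted_moment m i / lam ^ Suc i) * (ennreal (?Z \<omega> ^ (k - i) / fact (k - i)) * ennreal (erlang_density i lam ?r))"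
          using ennreal_rearrange[where F = 1, OF eq, of "ennreal (?Z \<omega> ^ (k - i) / fact (k - i))"] lam r
          by (simp del: power_Suc)
      qed
      finally show ?thesis .
    qed (simp add: erlang_density_def)
  qed
  also have "\<dots> = (\<Sum>i\<le>k. ennreal (shifted_moment m i / lam ^ Suc i) *
      (\<integral>\<^sup>+\<omega>. ennreal (?Z \<omega> ^ (k - i) / fact (k - i)) * ennreal (erlang_density i lam (s - ?S \<omega>)) \<partial>M))"
    by (simp add: nn_integral_sum nn_integral_cmult)
  also have "\<dots> = ennreal (walk_coeff m n k * erlang_density (n + k) lam s / lam ^ Suc k)"
  \<comment> \<open>Without a completed step \<open>position_moment\<close> does not apply; position
    and event time are 0, and \<open>0 ^ (k - i)\<close> leaves only the term
    \<open>i = k\<close>.\<close>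
  proof (cases n)
    case 0
    have "(\<Sum>i\<le>k. ennreal (shifted_moment m i / lam ^ Suc i) *
      (\<integral>\<^sup>+\<omega>. ennreal (?Z \<omega> ^ (k - i) / fact (k - i)) * ennreal (erlang_density i lam (s - ?S \<omega>)) \<partial>M)) =
      (\<Sum>i\<le>k. if i = k then ennreal (shifted_moment m k / lam ^ Suc k) * ennreal (erlang_density k lam s) else 0)"
      by (intro sum.cong) (auto simp: 0 position_def event_time_def emeasure_space_1)
    then show ?thesis
      using lam by (simp add: 0 ennreal_mult[symmetric] shifted_moment_eq_walk_coeff[OF m])
  next
    case (Suc j)
    have "(\<Sum>i\<le>k. ennreal (shifted_moment m i / lam ^ Suc i) *
      (\<integral>\<^sup>+\<omega>. ennreal (?Z \<omega> ^ (k - i) / fact (k - i)) * ennreal (erlang_density i lam (s - ?S \<omega>)) \<partial>M)) =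
      (\<Sum>i\<le>k. ennreal (shifted_moment m i * walk_coeff m j (k - i) / lam ^ Suc k) * ennreal (erlang_density (n + k) lam s))"
    proof (intro sum.cong refl)
      fix i assume "i \<in> {..k}"
      then have i: "i \<le> k" by simp
      have e: "Suc i + Suc (j + (k - i)) - 1 = n + k" using i Suc by simp
      have "(\<integral>\<^sup>+\<omega>. ennreal (?Z \<omega> ^ (k - i) / fact (k - i)) * ennreal (erlang_density i lam (s - ?S \<omega>)) \<partial>M) =
          ennreal (walk_coeff m j (k - i) / lam ^ (k - i)) *
          (\<integral>\<^sup>+u. ennreal (erlang_density (j + (k - i)) lam u) * ennreal (erlang_density i lam (s - u)) \<partial>lborel)"
        unfolding Suc by (rule position_moment) measurable
      also have "(\<integral>\<^sup>+u. ennreal (erlang_density (j + (k - i)) lam u) * ennreal (erlang_density i lam (s - u)) \<partial>lborel) =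
          ennreal (erlang_density (n + k) lam s)"
        using fun_cong[OF convolution_erlang_density[OF lam, of i "j + (k - i)"], of s] unfolding e
        by (simp add: mult.commute)
      finally have *: "(\<integral>\<^sup>+\<omega>. ennreal (?Z \<omega> ^ (k - i) / fact (k - i)) * ennreal (erlang_density i lam (s - ?S \<omega>)) \<partial>M) =
         ennreal (walk_coeff m j (k - i) / lam ^ (k - i)) * ennreal (erlang_density (n + k) lam s)" .
      have "lam ^ Suc k = lam ^ Suc i * lam ^ (k - i)" using i by (simp flip: power_add)
      then show "ennreal (shifted_moment m i / lam ^ Suc i) *
        (\<integral>\<^sup>+\<omega>. ennreal (?Z \<omega> ^ (k - i) / fact (k - i)) * ennreal (erlang_density i lam (s - ?S \<omega>)) \<partial>M) =
        ennreal (shifted_moment m i * walk_coeff m j (k - i) / lam ^ Suc k) * ennreal (erlang_density (n + k) lam s)"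
        unfolding * mult.assoc[symmetric] using lam by (simp add: ennreal_mult[symmetric] del: power_Suc)
    qed
    also have "\<dots> = ennreal (walk_coeff m n k / lam ^ Suc k) * ennreal (erlang_density (n + k) lam s)"
      using lam by (simp add: sum_distrib_right[symmetric] sum_ennreal Suc walk_coeff_convolution[OF m, symmetric] sum_divide_distrib)
    finally show ?thesis
      using lam by (simp add: ennreal_mult[symmetric])
  qed
  finally show ?thesis .
qed

end

section \<open>The conditional law\<close>

text \<open>On a bounded support the k-th term of the exponential series is at most (|t| |b|)^k /
  k!, which is summable, so the series may be integrated term by term. The moments appear as
  nonnegative integrals, the form in which they are computed.\<close>

lemma char_eq_moment_series:
  assumes \<mu>: "real_distribution \<mu>" and b: "AE x in \<mu>. 0 \<le> x \<and> x \<le> b"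
  shows "char \<mu> t = (\<Sum>k. (\<i> * complex_of_real t) ^ k /\<^sub>R fact k * complex_of_real (enn2real (\<integral>\<^sup>+x. ennreal (x ^ k) \<partial>\<mu>)))"
proof -
  interpret \<mu>: real_distribution \<mu> by fact
  define f where "f k x = (\<i> * complex_of_real (t * x)) ^ k /\<^sub>R fact k" for k :: nat and x :: real
  have f_eq: "f k x = (\<i> * complex_of_real t) ^ k /\<^sub>R fact k * complex_of_real (x ^ k)" for k x
    by (simp add: f_def power_mult_distrib)
  have [measurable]: "f k \<in> borel_measurable borel" for k
    unfolding f_def[abs_def] by measurable
  have bnd: "AE x in \<mu>. norm (f k x) \<le> (\<bar>t\<bar> * \<bar>b\<bar>) ^ k /\<^sub>R fact k" for k
    using b
  proof eventually_elim
    case (elim x)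
    then have "\<bar>x\<bar> \<le> \<bar>b\<bar>" by auto
    then have "\<bar>t * x\<bar> ^ k \<le> (\<bar>t\<bar> * \<bar>b\<bar>) ^ k"
      unfolding abs_mult by (intro power_mono mult_left_mono) auto
    then show ?case
      by (simp add: f_def norm_power norm_mult abs_mult divide_right_mono field_simps)
  qed
  have int: "integrable \<mu> (f k)" for k
    by (rule \<mu>.integrable_const_bound[OF bnd]) simp
  have xint: "integrable \<mu> (\<lambda>x. x ^ k)" for k
  proof (rule \<mu>.integrable_const_bound)
    show "AE x in \<mu>. norm (x ^ k) \<le> \<bar>b\<bar> ^ k"
      using b by eventually_elim (auto simp: power_abs intro!: power_mono)
  qed simp
  have "(\<lambda>k. integral\<^sup>L \<mu> (f k)) sums (\<integral>x. (\<Sum>k. f k x) \<partial>\<mu>)"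
  proof (rule sums_integral[OF int])
    show "AE x in \<mu>. summable (\<lambda>k. norm (f k x))"
      unfolding f_def by (intro AE_I2 summable_norm_exp)
    show "summable (\<lambda>k. \<integral>x. norm (f k x) \<partial>\<mu>)"
    proof (rule summable_comparison_test')
      show "summable (\<lambda>k. (\<bar>t\<bar> * \<bar>b\<bar>) ^ k /\<^sub>R fact k)"
        by (rule summable_exp_generic)
      fix k :: nat
      have "(\<integral>x. norm (f k x) \<partial>\<mu>) \<le> (\<integral>x. (\<bar>t\<bar> * \<bar>b\<bar>) ^ k /\<^sub>R fact k \<partial>\<mu>)"
        using int bnd by (intro integral_mono_AE) auto
      then show "norm (\<integral>x. norm (f k x) \<partial>\<mu>) \<le> (\<bar>t\<bar> * \<bar>b\<bar>) ^ k /\<^sub>R fact k"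
        by (simp add: \<mu>.prob_space del: \<mu>.space_eq_univ)
    qed
  qed
  moreover have "(\<Sum>k. f k x) = iexp (t * x)" for x
    unfolding f_def exp_def ..
  moreover have "integral\<^sup>L \<mu> (f k) = (\<i> * complex_of_real t) ^ k /\<^sub>R fact k * complex_of_real (enn2real (\<integral>\<^sup>+x. ennreal (x ^ k) \<partial>\<mu>))" for k
  proof -
    have "(\<integral>x. x ^ k \<partial>\<mu>) = enn2real (\<integral>\<^sup>+x. ennreal (x ^ k) \<partial>\<mu>)"
      using b by (intro integral_eq_nn_integral) auto
    then show ?thesis
      unfolding f_eq using xint[of k] by (simp del: of_real_power)
  qed
  ultimately show ?thesis
    unfolding char_def by (simp add: sums_iff)
qed

text \<open>Equal moments give equal characteristic functions, and these determine the law.\<close>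

lemma real_distribution_eq_moments:
  assumes "real_distribution \<mu>" "AE x in \<mu>. 0 \<le> x \<and> x \<le> b"
    and "real_distribution \<nu>" "AE x in \<nu>. 0 \<le> x \<and> x \<le> b"
    and "\<And>k. (\<integral>\<^sup>+x. ennreal (x ^ k) \<partial>\<mu>) = (\<integral>\<^sup>+x. ennreal (x ^ k) \<partial>\<nu>)"
  shows "\<mu> = \<nu>"
  using assms by (intro Levy_uniqueness) (auto simp: fun_eq_iff char_eq_moment_series)

section \<open>Poisson weights and the event of exactly n events up to a fixed time\<close>

lemma poisson_sums: "(\<lambda>n. exp (- l * t) * (l * t) ^ n / fact n) sums (1 :: real)"
proof -
  have "(\<lambda>n. exp (- l * t) * ((l * t) ^ n /\<^sub>R fact n)) sums (exp (- l * t) * exp (l * t))"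
    by (intro sums_mult exp_converges)
  then show ?thesis
    by (simp add: field_simps flip: exp_add)
qed

lemma poisson_suminf_ennreal:
  fixes l t :: real
  assumes "0 \<le> l" "0 \<le> t"
  shows "(\<Sum>n. ennreal (exp (- l * t) * (l * t) ^ n / fact n)) = 1"
proof -
  have "(\<Sum>n. ennreal (exp (- l * t) * (l * t) ^ n / fact n)) = ennreal 1"
    by (rule suminf_ennreal_eq[OF _ poisson_sums]) (use assms in simp)
  then show ?thesis by (simp only: ennreal_1)
qed

context random_motion
begin

text \<open>A form of \<open>event_count W s \<omega> = n\<close> without \<open>card\<close>, on
  which the moments are known; \<open>AE_event_count\<close> shows that the two agree almost
  surely.\<close>

definition in_step :: "real \<Rightarrow> nat \<Rightarrow> 'a \<Rightarrow> bool" where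
  "in_step s n \<omega> \<longleftrightarrow> event_time W n \<omega> \<le> s \<and> s < event_time W (Suc n) \<omega>"

lemma in_step_measurable [measurable]: "Measurable.pred M (in_step s n)"
  unfolding in_step_def[abs_def] by measurable

text \<open>The Poisson weight is the zeroth stopped moment.\<close>

lemma emeasure_in_step:
  assumes s: "0 < s"
  shows "emeasure M {\<omega> \<in> space M. in_step s n \<omega>} = ennreal (exp (- lam * s) * (lam * s) ^ n / fact n)"
proof -
  have "emeasure M {\<omega> \<in> space M. in_step s n \<omega>} = (\<integral>\<^sup>+\<omega>. indicator {\<omega> \<in> space M. in_step s n \<omega>} \<omega> \<partial>M)"
    by simp
  also have "\<dots> = (\<integral>\<^sup>+\<omega>. ennreal ((position n \<omega> + (s - event_time W n \<omega>) * (1 + cos (\<Theta> (Suc n) \<omega>))) ^ 0 / fact 0) *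
      indicator {\<omega>. event_time W n \<omega> \<le> s \<and> s < event_time W (Suc n) \<omega>} \<omega> \<partial>M)"
    by (intro nn_integral_cong) (auto simp: in_step_def split: split_indicator)
  also have "\<dots> = ennreal (walk_coeff m n 0 * erlang_density (n + 0) lam s / lam ^ Suc 0)"
    by (rule stopped_moment[OF s])
  also have "walk_coeff m n 0 * erlang_density (n + 0) lam s / lam ^ Suc 0 = exp (- lam * s) * (lam * s) ^ n / fact n"
    using lam s by (simp add: walk_coeff_def shifted_moment_def erlang_density_def power_mult_distrib)
  finally show ?thesis .
qed

text \<open>Without this the set in \<open>event_count\<close> could be infinite, and \<open>card\<close> would be 0.\<close>

lemma AE_some_step:
  assumes s: "0 < s"
  shows "AE \<omega> in M. \<exists>j. s < event_time W j \<omega>"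
proof -
  \<comment> \<open>The events \<open>in_step s n\<close> are disjoint only where waiting times are
    positive; requiring all earlier event times to be at most \<open>s\<close> makes the sets
    disjoint everywhere.\<close>
  define E where "E n = {\<omega> \<in> space M. (\<forall>j\<le>n. event_time W j \<omega> \<le> s) \<and> s < event_time W (Suc n) \<omega>}" for n
  have [measurable]: "E n \<in> sets M" for n
    unfolding E_def by measurable
  have "disjoint_family E"
    unfolding disjoint_family_on_def
  proof safe
    fix n n' \<omega> assume "n \<noteq> n'" and E: "\<omega> \<in> E n" "\<omega> \<in> E n'"
    have "False" if "i < j" "\<omega> \<in> E i" "\<omega> \<in> E j" for i j
    proof -
      have "event_time W (Suc i) \<omega> \<le> s" using that by (simp add: E_def)
      moreover have "s < event_time W (Suc i) \<omega>" using that by (simp add: E_def)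
      ultimately show False by simp
    qed
    then show "\<omega> \<in> {}"
      using E \<open>n \<noteq> n'\<close> by (meson nat_neq_iff)
  qed
  then have "(\<lambda>n. prob (E n)) sums prob (\<Union>n. E n)"
    by (intro finite_measure_UNION) auto
  moreover have "prob (E n) = exp (- lam * s) * (lam * s) ^ n / fact n" for n
  proof -
    have "AE \<omega> in M. \<omega> \<in> E n \<longleftrightarrow> \<omega> \<in> {\<omega> \<in> space M. in_step s n \<omega>}"
      using AE_W_pos
    proof eventually_elim
      case (elim \<omega>)
      have "event_time W j \<omega> \<le> event_time W n \<omega>" if "j \<le> n" for j
        unfolding event_time_def using that elim by (intro sum_mono2) (auto simp: less_imp_le)
      then show ?case
        by (force simp: E_def in_step_def)
    qed
    then have "emeasure M (E n) = emeasure M {\<omega> \<in> space M. in_step s n \<omega>}"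
      by (intro emeasure_eq_AE) auto
    then show ?thesis
      unfolding emeasure_in_step[OF s] using lam s by (simp add: measure_def)
  qed
  \<comment> \<open>The Poisson weights exhaust the total mass, so almost surely some event time
    exceeds \<open>s\<close>.\<close>
  ultimately have "prob (\<Union>n. E n) = 1"
    using sums_unique2[OF _ poisson_sums[of lam s]] by simp
  then have "AE \<omega> in M. \<omega> \<in> (\<Union>n. E n)"
    by (subst (asm) prob_eq_1) auto
  then show ?thesis
    by eventually_elim (auto simp: E_def)
qed

lemma event_count_eqI:
  assumes pos: "\<And>j. 1 \<le> j \<Longrightarrow> 0 < W j \<omega>" and st: "in_step s n \<omega>"
  shows "event_count W s \<omega> = n"
proof -
  have mono: "event_time W i \<omega> \<le> event_time W j \<omega>" if "i \<le> j" for i j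
    unfolding event_time_def using that pos by (intro sum_mono2) (auto simp: less_imp_le)
  have le_iff: "event_time W j \<omega> \<le> s \<longleftrightarrow> j \<le> n" for j
  proof
    assume "event_time W j \<omega> \<le> s"
    then have "event_time W j \<omega> < event_time W (Suc n) \<omega>"
      using st by (simp add: in_step_def)
    then show "j \<le> n"
      using mono[of "Suc n" j] by (meson leD not_less_eq_eq)
  next
    assume "j \<le> n"
    then show "event_time W j \<omega> \<le> s"
      using mono[of j n] st by (simp add: in_step_def)
  qed
  have "{j. 1 \<le> j \<and> event_time W j \<omega> \<le> s} = {1..n}"
    unfolding le_iff by auto
  then show ?thesis by (simp add: event_count_def)
qed

lemma AE_event_count:
  assumes s: "0 < s"
  shows "AE \<omega> in M. event_count W s \<omega> = n \<longleftrightarrow> in_step s n \<omega>"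
  using AE_W_pos AE_some_step[OF s]
proof eventually_elim
  case (elim \<omega>)
  obtain N where N: "s < event_time W N \<omega>" and least: "\<forall>j<N. \<not> s < event_time W j \<omega>"
    using elim(2) exists_least_iff[of "\<lambda>j. s < event_time W j \<omega>"] by blast
  have "N \<noteq> 0"
    using N s by (metis event_time_def less_asym' sum.empty atLeastatMost_empty zero_less_one)
  then obtain k where "N = Suc k" by (cases N) auto
  then have "in_step s k \<omega>"
    using N least by (auto simp: in_step_def not_less)
  then have "event_count W s \<omega> = k"
    using elim by (intro event_count_eqI) auto
  then show ?case
    using \<open>in_step s k \<omega>\<close> event_count_eqI[of \<omega> s n] elim by auto
qed

text \<open>On the event of \<open>n\<close> events this is \<open>1 + X s / (c * s)\<close>, a
  variable in [0, 2] whose conditional law turns out not to depend on \<open>s\<close>.\<close>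

definition shifted_motion :: "real \<Rightarrow> nat \<Rightarrow> 'a \<Rightarrow> real" where
  "shifted_motion s n \<omega> = (position n \<omega> + (s - event_time W n \<omega>) * (1 + cos (\<Theta> (Suc n) \<omega>))) / s"

lemma shifted_motion_measurable [measurable]: "shifted_motion s n \<in> borel_measurable M"
  unfolding shifted_motion_def[abs_def] by measurable

lemma motion_eq:
  assumes "0 < s" and n: "event_count W s \<omega> = n"
  shows "motion c W \<Theta> s \<omega> = c * s * (shifted_motion s n \<omega> - 1)"
proof -
  define \<tau> where "\<tau> j = (if j = n + 1 then s else event_time W j \<omega>)" for j
  have "motion c W \<Theta> s \<omega> = c * (\<Sum>j=1..Suc n. (\<tau> j - \<tau> (j - 1)) * cos (\<Theta> j \<omega>))"
    by (simp add: motion_def n \<tau>_def[abs_def] Let_def)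
  also have "(\<Sum>j=1..Suc n. (\<tau> j - \<tau> (j - 1)) * cos (\<Theta> j \<omega>)) =
      (\<Sum>j=1..n. (\<tau> j - \<tau> (j - 1)) * cos (\<Theta> j \<omega>)) + (s - event_time W n \<omega>) * cos (\<Theta> (Suc n) \<omega>)"
    by (simp add: \<tau>_def)
  also have "(\<Sum>j=1..n. (\<tau> j - \<tau> (j - 1)) * cos (\<Theta> j \<omega>)) = (\<Sum>j=1..n. W j \<omega> * cos (\<Theta> j \<omega>))"
  proof (intro sum.cong refl)
    fix j assume j: "j \<in> {1..n}"
    then obtain i where "j = Suc i" by (cases j) auto
    then show "(\<tau> j - \<tau> (j - 1)) * cos (\<Theta> j \<omega>) = W j \<omega> * cos (\<Theta> j \<omega>)"
      using j by (simp add: \<tau>_def event_time_Suc)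
  qed
  also have "(\<Sum>j=1..n. W j \<omega> * cos (\<Theta> j \<omega>)) = position n \<omega> - event_time W n \<omega>"
    by (simp add: position_def event_time_def algebra_simps sum.distrib)
  also have "position n \<omega> - event_time W n \<omega> + (s - event_time W n \<omega>) * cos (\<Theta> (Suc n) \<omega>) = s * (shifted_motion s n \<omega> - 1)"
    using assms by (simp add: shifted_motion_def field_simps)
  finally show ?thesis by simp
qed

lemma event_count_measurable [measurable]: "event_count W s \<in> measurable M (count_space UNIV)"
  unfolding event_count_def[abs_def] by (rule measurable_card) measurable

lemma motion_measurable [measurable]: "motion c W \<Theta> s \<in> borel_measurable M"
proof -
  have "(\<lambda>\<omega>. (\<lambda>n \<omega>. c * (\<Sum>j=1..n+1. ((if j = n + 1 then s else event_time W j \<omega>) -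
      (if j - 1 = n + 1 then s else event_time W (j - 1) \<omega>)) * cos (\<Theta> j \<omega>))) (event_count W s \<omega>) \<omega>) \<in> borel_measurable M"
    by (rule measurable_compose_countable[OF _ event_count_measurable])
       (intro borel_measurable_times borel_measurable_sum; measurable; auto)
  then show ?thesis
    by (simp add: motion_def[abs_def] Let_def)
qed

text \<open>Conditioning is realised by the uniform measure on \<open>in_step s n\<close>. There
  \<open>shifted_motion\<close> has the same moments as \<open>1 + y\<close> under the
  ultraspherical density; both live in [0, 2], so the laws coincide.\<close>

lemma conditional_probability:
  assumes s: "0 < s" and [measurable]: "A \<in> sets borel"
  shows "ennreal \<P>(\<omega> in M. motion c W \<Theta> s \<omega> \<in> A \<bar> event_count W s \<omega> = n) =
    (\<integral>\<^sup>+y. indicator A (c * s * y) * ennreal (ultraspherical (shape m n) y) \<partial>lborel)"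
proof -
  let ?v = "shape m n"
  let ?U = "uniform_measure M {\<omega> \<in> space M. in_step s n \<omega>}"
  let ?V = "density lborel (\<lambda>y. ennreal (ultraspherical ?v y))"
  let ?p = "exp (- lam * s) * (lam * s) ^ n / fact n"
  have p: "0 < ?p" using lam s by simp
  interpret U: prob_space ?U
    using lam s by (intro prob_space_uniform_measure) (auto simp: emeasure_in_step[OF s])
  interpret V: prob_space ?V
    by (rule prob_spaceI) (simp add: emeasure_density)
  have eq: "distr ?U borel (shifted_motion s n) = distr ?V borel (\<lambda>y. 1 + y)"
  proof (rule real_distribution_eq_moments[where b = 2])
    show "real_distribution (distr ?U borel (shifted_motion s n))"
      by (rule U.real_distribution_distr) simp
    show "real_distribution (distr ?V borel (\<lambda>y. 1 + y))"
      by (rule V.real_distribution_distr) simp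
    have "AE \<omega> in ?U. 0 \<le> shifted_motion s n \<omega> \<and> shifted_motion s n \<omega> \<le> 2"
    proof (rule AE_uniform_measureI)
      show "AE \<omega> in M. \<omega> \<in> {\<omega> \<in> space M. in_step s n \<omega>} \<longrightarrow> 0 \<le> shifted_motion s n \<omega> \<and> shifted_motion s n \<omega> \<le> 2"
        using AE_W_pos
      proof (eventually_elim, safe)
        fix \<omega> assume W: "\<forall>j\<ge>1. 0 < W j \<omega>" and "in_step s n \<omega>"
        then have r: "0 \<le> s - event_time W n \<omega>" by (simp add: in_step_def)
        have cb: "0 \<le> 1 + cos \<theta>" "1 + cos \<theta> \<le> 2" for \<theta> :: real
          using cos_ge_minus_one[of \<theta>] cos_le_one[of \<theta>] by linarith+
        have z: "0 \<le> position n \<omega>" using W by (intro position_nonneg) auto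
        have "position n \<omega> \<le> (\<Sum>j=1..n. W j \<omega> * 2)"
          unfolding position_def using W cb by (intro sum_mono mult_left_mono) (auto simp: less_imp_le)
        also have "\<dots> = 2 * event_time W n \<omega>"
          by (simp add: event_time_def sum_distrib_left mult.commute)
        finally have "position n \<omega> + (s - event_time W n \<omega>) * (1 + cos (\<Theta> (Suc n) \<omega>)) \<le>
            2 * event_time W n \<omega> + (s - event_time W n \<omega>) * 2"
          using mult_left_mono[OF cb(2) r] by (intro add_mono) auto
        then show "shifted_motion s n \<omega> \<le> 2"
          using s by (simp add: shifted_motion_def divide_le_eq algebra_simps)
        show "0 \<le> shifted_motion s n \<omega>"
          using s z r cb(1) by (simp add: shifted_motion_def)
      qed
    qed simp
    then show "AE x in distr ?U borel (shifted_motion s n). 0 \<le> x \<and> x \<le> 2"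
      by (subst AE_distr_iff) auto
    have "AE y in ?V. 0 \<le> 1 + y \<and> 1 + y \<le> 2"
      by (subst AE_density) (auto simp: ultraspherical_def intro!: AE_I2)
    then show "AE x in distr ?V borel (\<lambda>y. 1 + y). 0 \<le> x \<and> x \<le> 2"
      by (subst AE_distr_iff) auto
    fix k
    have "(\<integral>\<^sup>+x. ennreal (x ^ k) \<partial>distr ?U borel (shifted_motion s n)) =
        (\<integral>\<^sup>+\<omega>. ennreal (shifted_motion s n \<omega> ^ k) * indicator {\<omega> \<in> space M. in_step s n \<omega>} \<omega> \<partial>M) / ennreal ?p"
      by (simp add: nn_integral_distr nn_integral_uniform_measure emeasure_in_step[OF s])
    also have "(\<integral>\<^sup>+\<omega>. ennreal (shifted_motion s n \<omega> ^ k) * indicator {\<omega> \<in> space M. in_step s n \<omega>} \<omega> \<partial>M) =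
        (\<integral>\<^sup>+\<omega>. ennreal (fact k / s ^ k) * (ennreal ((position n \<omega> + (s - event_time W n \<omega>) * (1 + cos (\<Theta> (Suc n) \<omega>))) ^ k / fact k) *
          indicator {\<omega>. event_time W n \<omega> \<le> s \<and> s < event_time W (Suc n) \<omega>} \<omega>) \<partial>M)"
      using s by (intro nn_integral_cong)
        (auto simp: in_step_def shifted_motion_def power_divide ennreal_mult'[symmetric] split: split_indicator)
    also have "\<dots> = ennreal (fact k / s ^ k) * (\<integral>\<^sup>+\<omega>. ennreal ((position n \<omega> + (s - event_time W n \<omega>) * (1 + cos (\<Theta> (Suc n) \<omega>))) ^ k / fact k) *
          indicator {\<omega>. event_time W n \<omega> \<le> s \<and> s < event_time W (Suc n) \<omega>} \<omega> \<partial>M)"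
    proof (rule nn_integral_cmult)
      have "(\<lambda>\<omega>. ennreal ((position n \<omega> + (s - event_time W n \<omega>) * (1 + cos (\<Theta> (Suc n) \<omega>))) ^ k / fact k) *
          (if in_step s n \<omega> then 1 else 0)) \<in> borel_measurable M"
        by measurable
      also have "(\<lambda>\<omega>. ennreal ((position n \<omega> + (s - event_time W n \<omega>) * (1 + cos (\<Theta> (Suc n) \<omega>))) ^ k / fact k) *
          (if in_step s n \<omega> then 1 else 0)) = (\<lambda>\<omega>. ennreal ((position n \<omega> + (s - event_time W n \<omega>) * (1 + cos (\<Theta> (Suc n) \<omega>))) ^ k / fact k) *
          indicator {\<omega>. event_time W n \<omega> \<le> s \<and> s < event_time W (Suc n) \<omega>} \<omega>)"
        by (auto simp: in_step_def fun_eq_iff split: split_indicator)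
      finally show "(\<lambda>\<omega>. ennreal ((position n \<omega> + (s - event_time W n \<omega>) * (1 + cos (\<Theta> (Suc n) \<omega>))) ^ k / fact k) *
          indicator {\<omega>. event_time W n \<omega> \<le> s \<and> s < event_time W (Suc n) \<omega>} \<omega>) \<in> borel_measurable M" .
    qed
    also have "\<dots> / ennreal ?p = ennreal (fact k / s ^ k * (walk_coeff m n k * erlang_density (n + k) lam s / lam ^ Suc k) / ?p)"
      unfolding stopped_moment[OF s] using lam s p
      by (subst ennreal_mult'[symmetric]) (auto simp: divide_ennreal)
    \<comment> \<open>Dividing by the Poisson weight leaves n! k! / (n + k)!, the inverse of the
      prefactor of \<open>walk_coeff\<close>; all powers of \<open>lam\<close> and \<open>s\<close>
      cancel.\<close>
    also have "fact k / s ^ k * (walk_coeff m n k * erlang_density (n + k) lam s / lam ^ Suc k) / ?p = shifted_moment ?v k"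
    proof -
      have "fact (n + k) = fact n * pochhammer (real n + 1) k"
        using pochhammer_product'[of "1 :: real" n k] unfolding pochhammer_fact by (simp only: add.commute)
      then have "fact n * pochhammer (1 + real n) k = (fact (k + n) :: real)"
        by (simp only: add.commute)
      then show ?thesis
        using lam s by (simp add: walk_coeff_def erlang_density_def power_add power_mult_distrib field_simps)
    qed
    also have "ennreal (shifted_moment ?v k) = (\<integral>\<^sup>+x. ennreal (x ^ k) \<partial>distr ?V borel (\<lambda>y. 1 + y))"
      using nn_integral_ultraspherical_shifted_moment[of ?v k]
      by (simp add: nn_integral_distr nn_integral_density mult.commute)
    finally show "(\<integral>\<^sup>+x. ennreal (x ^ k) \<partial>distr ?U borel (shifted_motion s n)) = (\<integral>\<^sup>+x. ennreal (x ^ k) \<partial>distr ?V borel (\<lambda>y. 1 + y))" .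
  qed
  have "\<P>(\<omega> in M. motion c W \<Theta> s \<omega> \<in> A \<bar> event_count W s \<omega> = n) =
      \<P>(\<omega> in M. c * s * (shifted_motion s n \<omega> - 1) \<in> A \<bar> in_step s n \<omega>)"
  proof (rule cond_prob_eq_AE)
    show "AE \<omega> in M. event_count W s \<omega> = n \<longrightarrow> (motion c W \<Theta> s \<omega> \<in> A) = (c * s * (shifted_motion s n \<omega> - 1) \<in> A)"
      using s by (intro AE_I2) (simp add: motion_eq)
  qed (use AE_event_count[OF s] in \<open>auto\<close>)
  also have "\<dots> = \<P>(\<omega> in ?U. c * s * (shifted_motion s n \<omega> - 1) \<in> A)"
    by (rule measure_uniform_measure_eq_cond_prob[symmetric]) auto
  finally have "ennreal \<P>(\<omega> in M. motion c W \<Theta> s \<omega> \<in> A \<bar> event_count W s \<omega> = n) =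
      emeasure ?U {\<omega> \<in> space M. c * s * (shifted_motion s n \<omega> - 1) \<in> A}"
    by (simp add: U.emeasure_eq_measure)
  also have "\<dots> = emeasure (distr ?U borel (shifted_motion s n)) {x. c * s * (x - 1) \<in> A}"
  proof -
    have "{\<omega> \<in> space M. c * s * (shifted_motion s n \<omega> - 1) \<in> A} = shifted_motion s n -` {x. c * s * (x - 1) \<in> A} \<inter> space ?U"
      by auto
    moreover have "{x. c * s * (x - 1) \<in> A} \<in> sets borel" by measurable
    ultimately show ?thesis
      by (simp only:) (rule emeasure_distr[symmetric]; simp)
  qed
  also have "\<dots> = emeasure ?V {y. c * s * y \<in> A}"
    unfolding eq by (subst emeasure_distr) (auto intro!: arg_cong[where f = "emeasure ?V"])
  also have "\<dots> = (\<integral>\<^sup>+y. indicator A (c * s * y) * ennreal (ultraspherical ?v y) \<partial>lborel)"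
  proof -
    have "{y. c * s * y \<in> A} \<in> sets borel" by measurable
    then show ?thesis
      by (subst emeasure_density) (auto intro!: nn_integral_cong split: split_indicator)
  qed
  finally show ?thesis .
qed

end

section \<open>Random times\<close>

text \<open>\<open>measure_of\<close> yields the zero measure for a set function that is not
  countably additive; exhibiting a measure \<open>D\<close> with the given values rules this
  out.\<close>

lemma measure_of_borel_eq:
  assumes "sets D = sets (borel :: real measure)" and "\<And>A. A \<in> sets borel \<Longrightarrow> \<mu> A = emeasure D A"
  shows "measure_of UNIV (sets borel) \<mu> = D"
proof -
  have sp: "space D = UNIV"
    using sets_eq_imp_space_eq[OF assms(1)] by simp
  have "measure_of UNIV (sets borel) \<mu> = measure_of UNIV (sets borel) (emeasure D)"
    by (rule measure_of_eq) (auto simp: assms(2) sets.sigma_sets_eq[of "borel :: real measure", simplified])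
  also have "\<dots> = D"
    using measure_of_of_measure[of D] by (simp add: sp assms(1))
  finally show ?thesis .
qed

context random_motion
begin

text \<open>The set function is the image of a genuine measure, the law of \<open>T\<close>
  restricted to positive times times the ultraspherical law, under the map sending \<open>s\<close>
  and \<open>y\<close> to \<open>c * s * y\<close>.\<close>

lemma emeasure_conditional_law:
  assumes [measurable]: "T \<in> borel_measurable M" and A: "A \<in> sets borel"
  shows "emeasure (conditional_law M (event_count W) (motion c W \<Theta>) T n) A =
    (\<integral>\<^sup>+s\<in>{0<..}. (\<integral>\<^sup>+y. indicator A (c * s * y) * ennreal (ultraspherical (shape m n) y) \<partial>lborel) \<partial>distr M borel T)"
proof -
  let ?V = "density lborel (\<lambda>y. ennreal (ultraspherical (shape m n) y))"
  let ?Q = "density (distr M borel T) (indicator {0<..})"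
  define D where "D = distr (?Q \<Otimes>\<^sub>M ?V) borel (\<lambda>x. c * fst x * snd x)"
  interpret V: prob_space ?V
    by (rule prob_spaceI) (simp add: emeasure_density)
  have D: "emeasure D A = (\<integral>\<^sup>+s\<in>{0<..}. (\<integral>\<^sup>+y. indicator A (c * s * y) * ennreal (ultraspherical (shape m n) y) \<partial>lborel) \<partial>distr M borel T)"
    if [measurable]: "A \<in> sets borel" for A
  proof -
    have "emeasure D A = (\<integral>\<^sup>+x. indicator A x \<partial>D)"
      using that by (simp add: D_def)
    also have "\<dots> = (\<integral>\<^sup>+x. indicator A (c * fst x * snd x) \<partial>(?Q \<Otimes>\<^sub>M ?V))"
      unfolding D_def by (rule nn_integral_distr) measurable
    also have "\<dots> = (\<integral>\<^sup>+s. \<integral>\<^sup>+y. indicator A (c * s * y) \<partial>?V \<partial>?Q)"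
      by (subst V.nn_integral_fst[symmetric]) auto
    also have "\<dots> = (\<integral>\<^sup>+s. \<integral>\<^sup>+y. ennreal (ultraspherical (shape m n) y) * indicator A (c * s * y) \<partial>lborel \<partial>?Q)"
      by (intro nn_integral_cong nn_integral_density) measurable
    also have "\<dots> = (\<integral>\<^sup>+s. indicator {0<..} s * (\<integral>\<^sup>+y. ennreal (ultraspherical (shape m n) y) * indicator A (c * s * y) \<partial>lborel) \<partial>distr M borel T)"
      by (rule nn_integral_density) measurable
    finally show ?thesis
      by (simp add: mult.commute)
  qed
  have "conditional_law M (event_count W) (motion c W \<Theta>) T n = D"
    unfolding conditional_law_def
  proof (rule measure_of_borel_eq)
    fix A :: "real set" assume A: "A \<in> sets borel"
    show "(\<integral>\<^sup>+s\<in>{0<..}. ennreal \<P>(\<omega> in M. motion c W \<Theta> s \<omega> \<in> A \<bar> event_count W s \<omega> = n) \<partial>distr M borel T) = emeasure D A"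
      unfolding D[OF A] by (intro nn_integral_cong) (auto simp: conditional_probability[OF _ A] split: split_indicator)
  qed (simp add: D_def)
  then show ?thesis
    using D[OF A] by simp
qed

text \<open>Summation over \<open>n\<close> produces an \<open>ennreal\<close> density
  \<open>G\<close>, while the claims speak of real integrals \<open>g\<close>, which default to 0
  where they diverge. The total mass of \<open>G\<close> is at most 1, so \<open>G\<close> is
  finite, and equal to \<open>g\<close>, almost everywhere.\<close>

lemma law_at_random_time_eq_density:
  assumes [measurable]: "T \<in> borel_measurable M" and [measurable]: "G \<in> borel_measurable borel"
    and G: "\<And>A. A \<in> sets borel \<Longrightarrow>
      (\<Sum>n. ennreal (exp (- lam * t) * (lam * t) ^ n / fact n) *
        (\<integral>\<^sup>+s\<in>{0<..}. (\<integral>\<^sup>+y. indicator A (c * s * y) * ennreal (ultraspherical (shape m n) y) \<partial>lborel) \<partial>distr M borel T)) =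
      (\<integral>\<^sup>+x\<in>A. G x \<partial>lborel)"
    and [measurable]: "g \<in> borel_measurable borel" and g: "\<And>x. G x \<noteq> \<infinity> \<Longrightarrow> ennreal (g x) = G x"
    and t: "0 < t"
  shows "law_at_random_time M lam t (event_count W) (motion c W \<Theta>) T = density lborel (\<lambda>x. ennreal (g x))"
proof -
  have "law_at_random_time M lam t (event_count W) (motion c W \<Theta>) T = density lborel G"
    unfolding law_at_random_time_def
  proof (rule measure_of_borel_eq)
    fix A :: "real set" assume A: "A \<in> sets borel"
    show "(\<Sum>n. ennreal (exp (- lam * t) * (lam * t) ^ n / fact n) *
        emeasure (conditional_law M (event_count W) (motion c W \<Theta>) T n) A) = emeasure (density lborel G) A"
      using A by (simp only: emeasure_conditional_law[OF assms(1) A] G[OF A]) (simp add: emeasure_density)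
  qed simp
  also have "\<dots> = density lborel (\<lambda>x. ennreal (g x))"
  proof (rule density_cong)
    interpret T: prob_space "distr M borel T" by (rule prob_space_distr) simp
    have "(\<integral>\<^sup>+x. G x \<partial>lborel) =
      (\<Sum>n. ennreal (exp (- lam * t) * (lam * t) ^ n / fact n) * (\<integral>\<^sup>+s\<in>{0<..}. 1 \<partial>distr M borel T))"
      using G[of UNIV] by simp
    also have "\<dots> \<le> (\<Sum>n. ennreal (exp (- lam * t) * (lam * t) ^ n / fact n) * 1)"
      by (intro suminf_le mult_left_mono) (auto simp: T.measure_le_1 T.emeasure_le_1 simp del: ennreal_suminf_multc)
    finally have "(\<integral>\<^sup>+x. G x \<partial>lborel) \<noteq> \<infinity>"
      unfolding mult_1_right poisson_suminf_ennreal[OF less_imp_le[OF lam] less_imp_le[OF t]] by (auto simp: top_unique)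
    then have "AE x in lborel. G x \<noteq> \<infinity>"
      by (intro nn_integral_PInf_AE) auto
    then show "AE x in lborel. G x = ennreal (g x)"
      by eventually_elim (simp add: g)
  qed auto
  finally show ?thesis .
qed

end

section \<open>The laws of Brownian motion and of the two-dimensional Bessel process at a fixed
  time\<close>

lemma (in prob_space) distr_brownian_motion:
  assumes B: "brownian_motion M B" and t: "0 < t"
  shows "distr M borel (B t) = density lborel (\<lambda>x. ennreal (normal_density 0 (sqrt t) x))"
proof -
  have D: "distributed M lborel (\<lambda>\<omega>. B t \<omega> - B 0 \<omega>) (\<lambda>x. ennreal (normal_density 0 (sqrt (t - 0)) x))"
    and [measurable]: "B t \<in> borel_measurable M" "B 0 \<in> borel_measurable M" and B0: "AE \<omega> in M. B 0 \<omega> = 0"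
    using B t unfolding brownian_motion_def by (blast intro: less_imp_le order_refl)+
  have "distr M borel (B t) = distr M borel (\<lambda>\<omega>. B t \<omega> - B 0 \<omega>)"
    by (rule distr_cong_AE) (use B0 in auto)
  also have "\<dots> = distr M lborel (\<lambda>\<omega>. B t \<omega> - B 0 \<omega>)"
    by (rule distr_cong) auto
  also have "\<dots> = density lborel (\<lambda>x. ennreal (normal_density 0 (sqrt t) x))"
    using distributed_distr_eq_density[OF D] by simp
  finally show ?thesis .
qed

lemma brownian_motion_measurable:
  "brownian_motion M B \<Longrightarrow> 0 \<le> t \<Longrightarrow> B t \<in> borel_measurable M"
  unfolding brownian_motion_def by blast

lemma nn_integral_even:
  fixes F :: "real \<Rightarrow> ennreal"
  assumes [measurable]: "F \<in> borel_measurable borel" and even: "\<And>x. F (- x) = F x"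
  shows "(\<integral>\<^sup>+x. F x \<partial>lborel) = 2 * (\<integral>\<^sup>+x\<in>{0..}. F x \<partial>lborel)"
proof -
  have "(\<integral>\<^sup>+x\<in>{..<0}. F x \<partial>lborel) = (\<integral>\<^sup>+x. F (0 + -1 * x) * indicator {..<0} (0 + -1 * x) \<partial>lborel)"
    by (subst nn_integral_real_affine[where c = "-1" and t = 0]) auto
  also have "\<dots> = (\<integral>\<^sup>+x\<in>{0..}. F x \<partial>lborel)"
  proof (rule nn_integral_cong_AE)
    have "AE x in lborel. x \<noteq> (0::real)" by (rule AE_lborel_singleton)
    then show "AE x in lborel. F (0 + -1 * x) * indicator {..<0} (0 + -1 * x) = F x * indicator {0..} x"
      by eventually_elim (auto simp: even split: split_indicator)
  qed
  finally have neg: "(\<integral>\<^sup>+x\<in>{..<0}. F x \<partial>lborel) = (\<integral>\<^sup>+x\<in>{0..}. F x \<partial>lborel)" .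
  have "(\<integral>\<^sup>+x. F x \<partial>lborel) = (\<integral>\<^sup>+x. F x * indicator {0..} x + F x * indicator {..<0} x \<partial>lborel)"
    by (intro nn_integral_cong) (auto split: split_indicator)
  also have "\<dots> = (\<integral>\<^sup>+x\<in>{0..}. F x \<partial>lborel) + (\<integral>\<^sup>+x\<in>{..<0}. F x \<partial>lborel)"
    by (rule nn_integral_add) measurable
  finally show ?thesis
    by (simp add: neg mult_2)
qed

text \<open>The substitution \<open>r = sqrt (x\<^sup>2 + y\<^sup>2)\<close>; its Jacobian \<open>r / sqrt (r\<^sup>2 - x\<^sup>2)\<close> is an arcsine density in \<open>x / r\<close>.\<close>

lemma nn_integral_hypotenuse:
  fixes H :: "real \<Rightarrow> ennreal"
  assumes [measurable]: "H \<in> borel_measurable borel" and x: "x \<noteq> 0"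
  shows "(\<integral>\<^sup>+y. H (sqrt (x\<^sup>2 + y\<^sup>2)) \<partial>lborel) =
    2 * (\<integral>\<^sup>+r\<in>{0<..}. H r * ennreal (pi * ultraspherical 0 (x / r)) \<partial>lborel)"
proof -
  define g where "g y = sqrt (x\<^sup>2 + y\<^sup>2)" for y
  define f where "f r = H r * ennreal (pi * ultraspherical 0 (x / r))" for r
  have [measurable]: "f \<in> borel_measurable borel" "g \<in> borel_measurable borel"
    unfolding f_def[abs_def] g_def[abs_def] by measurable
  have pos: "0 < x\<^sup>2 + y\<^sup>2" for y using x by (simp add: add_pos_nonneg)
  have g0: "g 0 = \<bar>x\<bar>" by (simp add: g_def)
  have gmono: "g y \<le> g z" if "0 \<le> y" "y \<le> z" for y z
    unfolding g_def using that by (intro real_sqrt_le_mono add_left_mono power_mono) auto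
  have fg: "f (g y) * ennreal (y / g y) = H (g y)" if y: "0 < y" for y
  proof -
    have gp: "0 < g y" and xg: "\<bar>x\<bar> < g y"
      using pos[of y] y real_sqrt_less_mono[of "x\<^sup>2" "x\<^sup>2 + y\<^sup>2"] by (simp_all add: g_def)
    have "1 - a / (a + b) = b / (a + b)" if "0 < a + b" for a b :: real
      using less_imp_neq[OF that] by (simp add: field_simps)
    from this[OF pos] have "1 - (x / g y)\<^sup>2 = (y / g y)\<^sup>2"
      using pos[of y] by (simp add: g_def power_divide)
    moreover have "((y / g y)\<^sup>2) powr (- (1/2)) = g y / y"
      using gp y by (simp add: powr_minus powr_half_sqrt real_sqrt_divide field_simps)
    moreover have "\<bar>x / g y\<bar> < 1" using gp xg by (simp add: divide_less_eq)
    ultimately have "pi * ultraspherical 0 (x / g y) = g y / y"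
      by (simp add: ultraspherical_def Gamma_one_half_real)
    then have "f (g y) * ennreal (y / g y) = H (g y) * (ennreal (g y / y) * ennreal (y / g y))"
      by (simp add: f_def mult.assoc)
    also have "ennreal (g y / y) * ennreal (y / g y) = 1"
      using gp y by (simp add: ennreal_mult[symmetric])
    finally show ?thesis by simp
  qed
  have sub: "(\<integral>\<^sup>+r\<in>{\<bar>x\<bar>..g n}. f r \<partial>lborel) = (\<integral>\<^sup>+y\<in>{0..n}. H (g y) \<partial>lborel)" if n: "0 < n" for n
  proof -
    have "(\<integral>\<^sup>+r. f r * indicator {g 0..g n} r \<partial>lborel) = (\<integral>\<^sup>+y. f (g y) * ennreal (y / g y) * indicator {0..n} y \<partial>lborel)"
    proof (rule nn_integral_substitution_aux)
      fix y assume "y \<in> {0..n}"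
      show "(g has_real_derivative y / g y) (at y)"
        unfolding g_def[abs_def] using pos[of y]
        by (auto intro!: derivative_eq_intros simp: field_simps)
      show "0 \<le> y / g y" using \<open>y \<in> {0..n}\<close> by (simp add: g_def)
    next
      show "continuous_on {0..n} (\<lambda>y. y / g y)"
        unfolding g_def using pos by (intro continuous_intros) (auto simp: less_le)
    qed (use n in auto)
    also have "\<dots> = (\<integral>\<^sup>+y\<in>{0..n}. H (g y) \<partial>lborel)"
    proof (rule nn_integral_cong_AE)
      have "AE y in lborel. y \<noteq> (0::real)" by (rule AE_lborel_singleton)
      then show "AE y in lborel. f (g y) * ennreal (y / g y) * indicator {0..n} y = H (g y) * indicator {0..n} y"
        by eventually_elim (use fg in \<open>auto split: split_indicator\<close>)
    qed
    finally show ?thesis by (simp add: g0)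
  qed
  \<comment> \<open>The substitution was carried out on compact intervals; increasing unions extend
    it to half lines.\<close>
  let ?L = "density lborel f" and ?R = "density lborel (\<lambda>y. H (g y))"
  have "(SUP n. emeasure ?L {\<bar>x\<bar>..g (Suc n)}) = emeasure ?L (\<Union>n. {\<bar>x\<bar>..g (Suc n)})"
    by (rule SUP_emeasure_incseq) (auto simp: incseq_def intro: order_trans gmono)
  also have "(\<Union>n. {\<bar>x\<bar>..g (Suc n)}) = {\<bar>x\<bar>..}"
  proof (intro equalityI subsetI)
    fix r assume "r \<in> {\<bar>x\<bar>..}"
    obtain n where "\<bar>r\<bar> \<le> real n" using real_arch_simple by blast
    then have "\<bar>r\<bar> \<le> real (Suc n)" by simp
    also have "\<dots> \<le> g (Suc n)" unfolding g_def by (rule real_le_rsqrt) simp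
    finally show "r \<in> (\<Union>n. {\<bar>x\<bar>..g (Suc n)})"
      using \<open>r \<in> {\<bar>x\<bar>..}\<close> by auto
  qed auto
  finally have L: "(SUP n. emeasure ?L {\<bar>x\<bar>..g (Suc n)}) = emeasure ?L {\<bar>x\<bar>..}" .
  have "(SUP n. emeasure ?R {0..real (Suc n)}) = emeasure ?R (\<Union>n. {0..real (Suc n)})"
    by (rule SUP_emeasure_incseq) (auto simp: incseq_def)
  also have "(\<Union>n. {0..real (Suc n)}) = {0..}"
  proof (intro equalityI subsetI)
    fix r :: real assume "r \<in> {0..}"
    obtain n where "r \<le> real n" using real_arch_simple by blast
    then show "r \<in> (\<Union>n. {0..real (Suc n)})"
      using \<open>r \<in> {0..}\<close> by (auto intro!: exI[of _ n])
  qed auto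
  finally have "emeasure ?L {\<bar>x\<bar>..} = emeasure ?R {0..}"
    unfolding L[symmetric] using sub by (simp add: emeasure_density)
  then have *: "(\<integral>\<^sup>+y\<in>{0..}. H (g y) \<partial>lborel) = (\<integral>\<^sup>+r\<in>{\<bar>x\<bar>..}. f r \<partial>lborel)"
    by (simp add: emeasure_density)
  have "(\<integral>\<^sup>+y. H (g y) \<partial>lborel) = 2 * (\<integral>\<^sup>+r\<in>{\<bar>x\<bar>..}. f r \<partial>lborel)"
    unfolding *[symmetric] by (rule nn_integral_even) (auto simp: g_def)
  \<comment> \<open>The arcsine density vanishes for \<open>r\<close> up to |x|, so the range may
    start at 0.\<close>
  also have "(\<integral>\<^sup>+r\<in>{\<bar>x\<bar>..}. f r \<partial>lborel) = (\<integral>\<^sup>+r\<in>{0<..}. f r \<partial>lborel)"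
    using x by (intro nn_integral_cong) (auto simp: f_def ultraspherical_def divide_less_eq split: split_indicator)
  finally show ?thesis
    by (simp add: f_def g_def)
qed

lemma nn_integral_normal_density:
  "0 < \<sigma> \<Longrightarrow> (\<integral>\<^sup>+x. ennreal (normal_density \<mu> \<sigma> x) \<partial>lborel) = 1"
  using prob_space.emeasure_space_1[OF prob_space_normal_density, of \<sigma> \<mu>] by (simp add: emeasure_density)

text \<open>The Bessel density for \<open>d = 2\<close>. It is not cut off at 0; every integral
  against it is restricted to positive \<open>r\<close>.\<close>

definition rayleigh_density :: "real \<Rightarrow> real \<Rightarrow> real" where
  "rayleigh_density t r = r / t * exp (- (r\<^sup>2 / (2 * t)))"

lemma rayleigh_density_measurable [measurable]: "rayleigh_density t \<in> borel_measurable borel"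
  unfolding rayleigh_density_def[abs_def] by measurable

text \<open>Polar coordinates by one-dimensional means: for fixed first coordinate \<open>x\<close>
  the second is replaced by the radius through \<open>nn_integral_hypotenuse\<close>, and after
  exchanging the integrals the variable \<open>x\<close> is integrated out at fixed radius.\<close>

lemma nn_integral_bessel_2:
  assumes B: "independent_brownian_motions M 2 B" and M: "prob_space M" and t: "0 < t"
    and [measurable]: "h \<in> borel_measurable borel"
  shows "(\<integral>\<^sup>+s\<in>{0<..}. h s \<partial>distr M borel (bessel_process 2 B t)) =
    (\<integral>\<^sup>+s\<in>{0<..}. h s * ennreal (rayleigh_density t s) \<partial>lborel)"
proof -
  interpret prob_space M by fact
  have BM: "brownian_motion M (B 1)" "brownian_motion M (B 2)"
    using B by (auto simp: independent_brownian_motions_def)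
  have [measurable]: "B 1 t \<in> borel_measurable M" "B 2 t \<in> borel_measurable M"
    using BM t by (auto intro: brownian_motion_measurable)
  let ?N = "density lborel (\<lambda>x. ennreal (normal_density 0 (sqrt t) x))"
  interpret N: prob_space ?N using t by (intro prob_space_normal_density) simp
  have bessel: "bessel_process 2 B t \<omega> = sqrt ((B 1 t \<omega>)\<^sup>2 + (B 2 t \<omega>)\<^sup>2)" for \<omega>
  proof -
    have "{1..2} = {1, 2::nat}" by auto
    then show ?thesis by (simp add: bessel_process_def)
  qed
  have "indep_var borel (B 1 t) borel (B 2 t)"
  proof -
    have ind: "indep_vars (\<lambda>_. Pi\<^sub>M {0 :: real..} (\<lambda>_. borel)) (\<lambda>i \<omega>. \<lambda>u\<in>{0..}. B i u \<omega>) {1..2}"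
      using B by (simp add: independent_brownian_motions_def)
    have "indep_vars (\<lambda>_. borel) (\<lambda>i \<omega>. (\<lambda>u\<in>{0..}. B i u \<omega>) t) {1..2}"
      by (rule indep_vars_compose2[OF ind]) (use t in \<open>auto intro!: measurable_component_singleton\<close>)
    then have ind2: "indep_vars (\<lambda>_. borel) (\<lambda>i. B i t) {1..2}"
      using t by simp
    have "indep_var borel ((\<lambda>f. f 1) \<circ> (\<lambda>\<omega>. restrict (\<lambda>i. B i t \<omega>) {1})) borel ((\<lambda>f. f 2) \<circ> (\<lambda>\<omega>. restrict (\<lambda>i. B i t \<omega>) {2}))"
      by (rule indep_var_compose[OF indep_var_restrict[OF ind2]]) (auto intro!: measurable_component_singleton)
    then show ?thesis by (simp add: comp_def)
  qed
  then have pair: "distr M (borel \<Otimes>\<^sub>M borel) (\<lambda>\<omega>. (B 1 t \<omega>, B 2 t \<omega>)) = ?N \<Otimes>\<^sub>M ?N"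
    unfolding indep_var_distribution_eq by (simp add: distr_brownian_motion[OF BM(1) t] distr_brownian_motion[OF BM(2) t] del: One_nat_def)
  define H where "H r = h r * indicator {0<..} r * ennreal (exp (- (r\<^sup>2 / (2 * t))) / (2 * pi * t))" for r
  have [measurable]: "H \<in> borel_measurable borel"
    unfolding H_def[abs_def] by measurable
  let ?r = "\<lambda>x. sqrt ((fst x)\<^sup>2 + (snd x)\<^sup>2) :: real"
  have "(\<integral>\<^sup>+s\<in>{0<..}. h s \<partial>distr M borel (bessel_process 2 B t)) =
      (\<integral>\<^sup>+\<omega>. (h (?r (B 1 t \<omega>, B 2 t \<omega>)) * indicator {0<..} (?r (B 1 t \<omega>, B 2 t \<omega>))) \<partial>M)"
    unfolding bessel[abs_def] by (subst nn_integral_distr) (auto simp del: One_nat_def)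
  also have "\<dots> = (\<integral>\<^sup>+x. h (?r x) * indicator {0<..} (?r x) \<partial>(?N \<Otimes>\<^sub>M ?N))"
    unfolding pair[symmetric] by (rule nn_integral_distr[symmetric]) measurable
  also have "\<dots> = (\<integral>\<^sup>+x. \<integral>\<^sup>+y. h (?r (x, y)) * indicator {0<..} (?r (x, y)) \<partial>?N \<partial>?N)"
    by (rule N.nn_integral_fst[symmetric]) measurable
  also have "\<dots> = (\<integral>\<^sup>+x. \<integral>\<^sup>+y. H (sqrt (x\<^sup>2 + y\<^sup>2)) \<partial>lborel \<partial>lborel)"
  proof -
    have "ennreal (normal_density 0 (sqrt t) x) * (ennreal (normal_density 0 (sqrt t) y) * (h (sqrt (x\<^sup>2 + y\<^sup>2)) * indicator {0<..} (sqrt (x\<^sup>2 + y\<^sup>2)))) =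
        H (sqrt (x\<^sup>2 + y\<^sup>2))" for x y
    proof -
      have "exp (- x\<^sup>2 / (2 * t)) * exp (- y\<^sup>2 / (2 * t)) = exp (- ((x\<^sup>2 + y\<^sup>2) / (2 * t)))"
        unfolding exp_add[symmetric] by (simp add: add_divide_distrib)
      then have "normal_density 0 (sqrt t) x * normal_density 0 (sqrt t) y = exp (- ((x\<^sup>2 + y\<^sup>2) / (2 * t))) / (2 * pi * t)"
        using t by (simp add: normal_density_def)
      then have "ennreal (normal_density 0 (sqrt t) x) * ennreal (normal_density 0 (sqrt t) y) = ennreal (exp (- ((x\<^sup>2 + y\<^sup>2) / (2 * t))) / (2 * pi * t))"
        by (simp flip: ennreal_mult)
      moreover have "(sqrt (x\<^sup>2 + y\<^sup>2))\<^sup>2 = x\<^sup>2 + y\<^sup>2" by simp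
      ultimately show ?thesis
        by (simp add: H_def mult.assoc[symmetric]) (simp add: mult_ac)
    qed
    then show ?thesis
      by (simp add: nn_integral_density nn_integral_cmult[symmetric])
  qed
  also have "\<dots> = (\<integral>\<^sup>+x. 2 * (\<integral>\<^sup>+r\<in>{0<..}. H r * ennreal (pi * ultraspherical 0 (x / r)) \<partial>lborel) \<partial>lborel)"
  proof (rule nn_integral_cong_AE)
    have "AE x in lborel. x \<noteq> (0::real)" by (rule AE_lborel_singleton)
    then show "AE x in lborel. (\<integral>\<^sup>+y. H (sqrt (x\<^sup>2 + y\<^sup>2)) \<partial>lborel) = 2 * (\<integral>\<^sup>+r\<in>{0<..}. H r * ennreal (pi * ultraspherical 0 (x / r)) \<partial>lborel)"
      by eventually_elim (rule nn_integral_hypotenuse, simp)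
  qed
  also have "\<dots> = 2 * (\<integral>\<^sup>+x. \<integral>\<^sup>+r. H r * ennreal (pi * ultraspherical 0 (x / r)) * indicator {0<..} r \<partial>lborel \<partial>lborel)"
    by (rule nn_integral_cmult) measurable
  also have "(\<integral>\<^sup>+x. \<integral>\<^sup>+r. H r * ennreal (pi * ultraspherical 0 (x / r)) * indicator {0<..} r \<partial>lborel \<partial>lborel) =
      (\<integral>\<^sup>+r. \<integral>\<^sup>+x. H r * ennreal (pi * ultraspherical 0 (x / r)) * indicator {0<..} r \<partial>lborel \<partial>lborel)"
    by (rule lborel_pair.Fubini') measurable
  \<comment> \<open>The arcsine density in \<open>x / r\<close> integrates to \<open>r\<close> over
    \<open>x\<close>; together with the factor 2 in front this gives the circumference 2 pi
    r.\<close>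
  also have "\<dots> = (\<integral>\<^sup>+r\<in>{0<..}. H r * ennreal (pi * r) \<partial>lborel)"
  proof (rule nn_integral_cong)
    fix r :: real
    show "(\<integral>\<^sup>+x. H r * ennreal (pi * ultraspherical 0 (x / r)) * indicator {0<..} r \<partial>lborel) = H r * ennreal (pi * r) * indicator {0<..} r"
    proof (cases "0 < r")
      case True
      have "(\<integral>\<^sup>+x. ennreal (ultraspherical 0 (x / r)) \<partial>lborel) = ennreal r * (\<integral>\<^sup>+x. ennreal (ultraspherical 0 ((0 + r * x) / r)) \<partial>lborel)"
        using True by (subst nn_integral_real_affine[where c = r and t = 0]) auto
      also have "\<dots> = ennreal r"
        using True by simp
      finally have "(\<integral>\<^sup>+x. ennreal (ultraspherical 0 (x / r)) \<partial>lborel) = ennreal r" .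
      then show ?thesis
        using True by (simp add: ennreal_mult nn_integral_cmult)
    qed simp
  qed
  also have "2 * \<dots> = (\<integral>\<^sup>+r\<in>{0<..}. 2 * (H r * ennreal (pi * r)) \<partial>lborel)"
    by (subst nn_integral_cmult[symmetric]) (auto simp: mult_ac)
  also have "\<dots> = (\<integral>\<^sup>+s\<in>{0<..}. h s * ennreal (rayleigh_density t s) \<partial>lborel)"
  proof (rule nn_integral_cong)
    fix r :: real
    show "2 * (H r * ennreal (pi * r)) * indicator {0<..} r = h r * ennreal (rayleigh_density t r) * indicator {0<..} r"
    proof (cases "0 < r")
      case True
      have "rayleigh_density t r = 2 * (exp (- (r\<^sup>2 / (2 * t))) / (2 * pi * t) * (pi * r))"
        using t by (simp add: rayleigh_density_def)
      then have "ennreal (rayleigh_density t r) = 2 * (ennreal (exp (- (r\<^sup>2 / (2 * t))) / (2 * pi * t)) * ennreal (pi * r))"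
        using t True by (simp only: ennreal_mult mult_nonneg_nonneg divide_nonneg_nonneg less_imp_le pi_gt_zero exp_gt_zero zero_le_numeral ennreal_numeral)
      then show ?thesis
        using True by (simp add: H_def mult_ac)
    qed simp
  qed
  finally show ?thesis .
qed

section \<open>Products with Rayleigh and normal variables\<close>

lemma rayleigh_density_nonneg [simp]: "0 < t \<Longrightarrow> 0 \<le> r \<Longrightarrow> 0 \<le> rayleigh_density t r"
  by (simp add: rayleigh_density_def)

text \<open>\<open>nn_integral_hypotenuse\<close> read backwards: the product is one coordinate of a
  planar Gaussian vector, and integrating out the other coordinate leaves its normal
  density.\<close>

lemma nn_integral_rayleigh_arcsine:
  assumes t: "0 < t" and z: "z \<noteq> 0"
  shows "(\<integral>\<^sup>+s\<in>{0<..}. ennreal (ultraspherical 0 (z / s) / s) * ennreal (rayleigh_density t s) \<partial>lborel) =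
    ennreal (normal_density 0 (sqrt t) z)"
proof -
  \<comment> \<open>The factor \<open>r\<close> of the Rayleigh density cancels the
    \<open>1 / r\<close> of the scaled arcsine density; the \<open>pi\<close> is the one in
    \<open>nn_integral_hypotenuse\<close>.\<close>
  define H where "H r = ennreal (exp (- (r\<^sup>2 / (2 * t))) / (pi * t))" for r :: real
  have [measurable]: "H \<in> borel_measurable borel"
    unfolding H_def[abs_def] by measurable
  have "(\<integral>\<^sup>+s\<in>{0<..}. ennreal (ultraspherical 0 (z / s) / s) * ennreal (rayleigh_density t s) \<partial>lborel) =
      (\<integral>\<^sup>+r\<in>{0<..}. H r * ennreal (pi * ultraspherical 0 (z / r)) \<partial>lborel)"
  proof (rule nn_integral_cong)
    fix r :: real
    show "ennreal (ultraspherical 0 (z / r) / r) * ennreal (rayleigh_density t r) * indicator {0<..} r =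
        H r * ennreal (pi * ultraspherical 0 (z / r)) * indicator {0<..} r"
    proof (cases "0 < r")
      case True
      have "ultraspherical 0 (z / r) / r * rayleigh_density t r =
          exp (- (r\<^sup>2 / (2 * t))) / (pi * t) * (pi * ultraspherical 0 (z / r))"
        using True t by (simp add: rayleigh_density_def)
      then show ?thesis
        using True t by (simp add: H_def ennreal_mult[symmetric])
    qed simp
  qed
  then have "2 * (\<integral>\<^sup>+s\<in>{0<..}. ennreal (ultraspherical 0 (z / s) / s) * ennreal (rayleigh_density t s) \<partial>lborel) =
      (\<integral>\<^sup>+y. H (sqrt (z\<^sup>2 + y\<^sup>2)) \<partial>lborel)"
    using z by (simp add: nn_integral_hypotenuse)
  also have "\<dots> = (\<integral>\<^sup>+y. ennreal (2 * normal_density 0 (sqrt t) z) * ennreal (normal_density 0 (sqrt t) y) \<partial>lborel)"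
  proof (rule nn_integral_cong)
    fix y :: real
    have "exp (- z\<^sup>2 / (2 * t)) * exp (- y\<^sup>2 / (2 * t)) = exp (- ((z\<^sup>2 + y\<^sup>2) / (2 * t)))"
      unfolding exp_add[symmetric] by (simp add: add_divide_distrib)
    then have "2 * normal_density 0 (sqrt t) z * normal_density 0 (sqrt t) y = exp (- ((z\<^sup>2 + y\<^sup>2) / (2 * t))) / (pi * t)"
      using t by (simp add: normal_density_def)
    then show "H (sqrt (z\<^sup>2 + y\<^sup>2)) = ennreal (2 * normal_density 0 (sqrt t) z) * ennreal (normal_density 0 (sqrt t) y)"
      by (simp add: H_def ennreal_mult[symmetric])
  qed
  also have "\<dots> = ennreal (2 * normal_density 0 (sqrt t) z)"
    using t by (subst nn_integral_cmult) (auto simp: nn_integral_normal_density)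
  also have "\<dots> = 2 * ennreal (normal_density 0 (sqrt t) z)"
    by (simp add: ennreal_mult)
  finally show ?thesis
    by (simp add: ennreal_mult_cancel_left)
qed

text \<open>Density of a multiple of a random variable. Negative factors are allowed: they serve for
  reflections and for a signed coefficient of a normal variable.\<close>

lemma nn_integral_rescale:
  fixes h :: "real \<Rightarrow> ennreal"
  assumes [measurable]: "h \<in> borel_measurable borel" "f \<in> borel_measurable borel"
    and f: "\<And>y. 0 \<le> f y" and s: "s \<noteq> 0"
  shows "(\<integral>\<^sup>+y. h (s * y) * ennreal (f y) \<partial>lborel) = (\<integral>\<^sup>+z. h z * ennreal (f (z / s) / \<bar>s\<bar>) \<partial>lborel)"
proof -
  have "(\<integral>\<^sup>+z. h z * ennreal (f (z / s) / \<bar>s\<bar>) \<partial>lborel) =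
      ennreal \<bar>s\<bar> * (\<integral>\<^sup>+y. h (0 + s * y) * ennreal (f ((0 + s * y) / s) / \<bar>s\<bar>) \<partial>lborel)"
    using s by (subst nn_integral_real_affine[where c = s and t = 0]) auto
  also have "\<dots> = (\<integral>\<^sup>+y. ennreal \<bar>s\<bar> * (h (s * y) * ennreal (f y / \<bar>s\<bar>)) \<partial>lborel)"
    using s by (subst nn_integral_cmult) auto
  also have "\<dots> = (\<integral>\<^sup>+y. h (s * y) * ennreal (f y) \<partial>lborel)"
  proof (rule nn_integral_cong)
    fix y
    have "ennreal (f y) = ennreal \<bar>s\<bar> * ennreal (f y / \<bar>s\<bar>)"
      using s f[of y] by (subst ennreal_mult[symmetric]) auto
    then show "ennreal \<bar>s\<bar> * (h (s * y) * ennreal (f y / \<bar>s\<bar>)) = h (s * y) * ennreal (f y)"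
      by (simp only: mult_ac)
  qed
  finally show ?thesis ..
qed

lemma nn_integral_rayleigh_arcsine_scaled:
  assumes t: "0 < t" and a: "0 < a" and [measurable]: "A \<in> sets borel"
  shows "(\<integral>\<^sup>+s\<in>{0<..}. (\<integral>\<^sup>+y. indicator A (a * s * y) * ennreal (ultraspherical 0 y) \<partial>lborel) * ennreal (rayleigh_density t s) \<partial>lborel) =
    (\<integral>\<^sup>+x\<in>A. ennreal (normal_density 0 (a * sqrt t) x) \<partial>lborel)"
proof -
  have "(\<integral>\<^sup>+s\<in>{0<..}. (\<integral>\<^sup>+y. indicator A (a * s * y) * ennreal (ultraspherical 0 y) \<partial>lborel) * ennreal (rayleigh_density t s) \<partial>lborel) =
      (\<integral>\<^sup>+s. (\<integral>\<^sup>+z. indicator A (a * z) * ennreal (ultraspherical 0 (z / s) / s) * (ennreal (rayleigh_density t s) * indicator {0<..} s) \<partial>lborel) \<partial>lborel)"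
  proof (rule nn_integral_cong)
    fix s :: real
    show "(\<integral>\<^sup>+y. indicator A (a * s * y) * ennreal (ultraspherical 0 y) \<partial>lborel) * ennreal (rayleigh_density t s) * indicator {0<..} s =
        (\<integral>\<^sup>+z. indicator A (a * z) * ennreal (ultraspherical 0 (z / s) / s) * (ennreal (rayleigh_density t s) * indicator {0<..} s) \<partial>lborel)"
    proof (cases "0 < s")
      case True
      have e: "(\<integral>\<^sup>+y. indicator A (a * s * y) * ennreal (ultraspherical 0 y) \<partial>lborel) =
          (\<integral>\<^sup>+z. indicator A (a * z) * ennreal (ultraspherical 0 (z / s) / s) \<partial>lborel)"
        using nn_integral_rescale[of "\<lambda>z. indicator A (a * z)" "ultraspherical 0" s] True by (simp add: mult.assoc)
      show ?thesis
        unfolding e by (subst nn_integral_multc) (simp_all add: mult.assoc)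
    qed simp
  qed
  also have "\<dots> = (\<integral>\<^sup>+z. (\<integral>\<^sup>+s. indicator A (a * z) * ennreal (ultraspherical 0 (z / s) / s) * (ennreal (rayleigh_density t s) * indicator {0<..} s) \<partial>lborel) \<partial>lborel)"
    by (rule lborel_pair.Fubini') measurable
  also have "\<dots> = (\<integral>\<^sup>+z. indicator A (a * z) * ennreal (normal_density 0 (sqrt t) z) \<partial>lborel)"
  proof (rule nn_integral_cong_AE)
    have "AE z in lborel. z \<noteq> (0::real)" by (rule AE_lborel_singleton)
    then show "AE z in lborel. (\<integral>\<^sup>+s. indicator A (a * z) * ennreal (ultraspherical 0 (z / s) / s) * (ennreal (rayleigh_density t s) * indicator {0<..} s) \<partial>lborel) =
        indicator A (a * z) * ennreal (normal_density 0 (sqrt t) z)"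
    proof eventually_elim
      case (elim z)
      have "(\<integral>\<^sup>+s. indicator A (a * z) * ennreal (ultraspherical 0 (z / s) / s) * (ennreal (rayleigh_density t s) * indicator {0<..} s) \<partial>lborel) =
          indicator A (a * z) * (\<integral>\<^sup>+s\<in>{0<..}. ennreal (ultraspherical 0 (z / s) / s) * ennreal (rayleigh_density t s) \<partial>lborel)"
        by (simp add: nn_integral_cmult[symmetric] mult.assoc)
      then show ?case
        by (simp only: nn_integral_rayleigh_arcsine[OF t elim])
    qed
  qed
  also have "\<dots> = (\<integral>\<^sup>+x. indicator A x * ennreal (normal_density 0 (sqrt t) (x / a) / a) \<partial>lborel)"
    using a nn_integral_rescale[of "indicator A" "normal_density 0 (sqrt t)" a] by simp
  also have "\<dots> = (\<integral>\<^sup>+x\<in>A. ennreal (normal_density 0 (a * sqrt t) x) \<partial>lborel)"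
  proof (rule nn_integral_cong)
    fix x
    have "normal_density 0 (sqrt t) (x / a) / a = normal_density 0 (a * sqrt t) x"
      using a t by (simp add: normal_density_def real_sqrt_mult power_mult_distrib power_divide mult_ac)
    then show "indicator A x * ennreal (normal_density 0 (sqrt t) (x / a) / a) = ennreal (normal_density 0 (a * sqrt t) x) * indicator A x"
      by (simp add: mult.commute)
  qed
  finally show ?thesis .
qed

lemma nn_integral_ultraspherical_mixture:
  assumes v: "0 < v" and [measurable]: "A \<in> sets borel"
  shows "(\<integral>\<^sup>+y. indicator A (b * y) * ennreal (ultraspherical v y) \<partial>lborel) =
    (\<integral>\<^sup>+w\<in>{0<..<1}. ennreal (v * (1 - w) powr (v - 1)) * (\<integral>\<^sup>+y. indicator A (b * sqrt w * y) * ennreal (ultraspherical 0 y) \<partial>lborel) \<partial>lborel)"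
proof -
  have "(\<integral>\<^sup>+y. indicator A (b * y) * ennreal (ultraspherical v y) \<partial>lborel) =
      (\<integral>\<^sup>+y. \<integral>\<^sup>+w. indicator A (b * y) * (ennreal (v * (1 - w) powr (v - 1)) * ennreal (ultraspherical 0 (y / sqrt w) / sqrt w) * indicator {0<..<1} w) \<partial>lborel \<partial>lborel)"
    by (simp add: nn_integral_cmult ultraspherical_mixture[OF v, symmetric])
  also have "\<dots> = (\<integral>\<^sup>+w. \<integral>\<^sup>+y. indicator A (b * y) * (ennreal (v * (1 - w) powr (v - 1)) * ennreal (ultraspherical 0 (y / sqrt w) / sqrt w) * indicator {0<..<1} w) \<partial>lborel \<partial>lborel)"
    by (rule lborel_pair.Fubini') measurable
  also have "\<dots> = (\<integral>\<^sup>+w\<in>{0<..<1}. ennreal (v * (1 - w) powr (v - 1)) * (\<integral>\<^sup>+y. indicator A (b * sqrt w * y) * ennreal (ultraspherical 0 y) \<partial>lborel) \<partial>lborel)"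
  proof (rule nn_integral_cong)
    fix w :: real
    show "(\<integral>\<^sup>+y. indicator A (b * y) * (ennreal (v * (1 - w) powr (v - 1)) * ennreal (ultraspherical 0 (y / sqrt w) / sqrt w) * indicator {0<..<1} w) \<partial>lborel) =
        ennreal (v * (1 - w) powr (v - 1)) * (\<integral>\<^sup>+y. indicator A (b * sqrt w * y) * ennreal (ultraspherical 0 y) \<partial>lborel) * indicator {0<..<1} w"
    proof (cases "0 < w \<and> w < 1")
      case True
      then have "(\<integral>\<^sup>+y. indicator A (b * y) * (ennreal (v * (1 - w) powr (v - 1)) * ennreal (ultraspherical 0 (y / sqrt w) / sqrt w) * indicator {0<..<1} w) \<partial>lborel) =
          (\<integral>\<^sup>+y. ennreal (v * (1 - w) powr (v - 1)) * (indicator A (b * y) * ennreal (ultraspherical 0 (y / sqrt w) / \<bar>sqrt w\<bar>)) \<partial>lborel)"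
        by (intro nn_integral_cong) (simp add: mult_ac)
      also have "\<dots> = ennreal (v * (1 - w) powr (v - 1)) * (\<integral>\<^sup>+y. indicator A (b * y) * ennreal (ultraspherical 0 (y / sqrt w) / \<bar>sqrt w\<bar>) \<partial>lborel)"
        by (rule nn_integral_cmult) measurable
      also have "(\<integral>\<^sup>+y. indicator A (b * y) * ennreal (ultraspherical 0 (y / sqrt w) / \<bar>sqrt w\<bar>) \<partial>lborel) =
          (\<integral>\<^sup>+y. indicator A (b * (sqrt w * y)) * ennreal (ultraspherical 0 y) \<partial>lborel)"
        using True by (intro nn_integral_rescale[symmetric, of "\<lambda>y. indicator A (b * y)"]) auto
      finally show ?thesis
        using True by (simp add: mult.assoc)
    qed auto
  qed
  finally show ?thesis .
qed

text \<open>Given the mixing variable \<open>w\<close>, the factor \<open>sqrt w\<close> is absorbed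
  into the speed, and Rayleigh times arcsine leaves a normal law of variance
  \<open>c^2 * w * t\<close>.\<close>

lemma nn_integral_rayleigh_ultraspherical:
  assumes t: "0 < t" and c: "0 < c" and v: "0 < v" and [measurable]: "A \<in> sets borel"
  shows "(\<integral>\<^sup>+s\<in>{0<..}. (\<integral>\<^sup>+y. indicator A (c * s * y) * ennreal (ultraspherical v y) \<partial>lborel) * ennreal (rayleigh_density t s) \<partial>lborel) =
    (\<integral>\<^sup>+w\<in>{0<..<1}. ennreal (v * (1 - w) powr (v - 1)) * (\<integral>\<^sup>+x\<in>A. ennreal (normal_density 0 (c * sqrt w * sqrt t) x) \<partial>lborel) \<partial>lborel)"
proof -
  define K where "K s = (\<integral>\<^sup>+y. indicator A (c * s * y) * ennreal (ultraspherical 0 y) \<partial>lborel)" for s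
  have [measurable]: "K \<in> borel_measurable borel"
    unfolding K_def[abs_def] by measurable
  have e: "(\<integral>\<^sup>+y. indicator A (c * s * y) * ennreal (ultraspherical v y) \<partial>lborel) =
      (\<integral>\<^sup>+w\<in>{0<..<1}. ennreal (v * (1 - w) powr (v - 1)) * K (s * sqrt w) \<partial>lborel)" for s
    using nn_integral_ultraspherical_mixture[OF v, of A "c * s"] by (simp add: K_def mult.assoc)
  have "(\<integral>\<^sup>+s\<in>{0<..}. (\<integral>\<^sup>+y. indicator A (c * s * y) * ennreal (ultraspherical v y) \<partial>lborel) * ennreal (rayleigh_density t s) \<partial>lborel) =
      (\<integral>\<^sup>+s. \<integral>\<^sup>+w. ennreal (v * (1 - w) powr (v - 1)) * K (s * sqrt w) * indicator {0<..<1} w * (ennreal (rayleigh_density t s) * indicator {0<..} s) \<partial>lborel \<partial>lborel)"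
    unfolding e by (intro nn_integral_cong) (subst nn_integral_multc, simp_all add: mult.assoc)
  also have "\<dots> = (\<integral>\<^sup>+w. \<integral>\<^sup>+s. ennreal (v * (1 - w) powr (v - 1)) * K (s * sqrt w) * indicator {0<..<1} w * (ennreal (rayleigh_density t s) * indicator {0<..} s) \<partial>lborel \<partial>lborel)"
    by (rule lborel_pair.Fubini') measurable
  also have "\<dots> = (\<integral>\<^sup>+w\<in>{0<..<1}. ennreal (v * (1 - w) powr (v - 1)) * (\<integral>\<^sup>+x\<in>A. ennreal (normal_density 0 (c * sqrt w * sqrt t) x) \<partial>lborel) \<partial>lborel)"
  proof (rule nn_integral_cong)
    fix w :: real
    show "(\<integral>\<^sup>+s. ennreal (v * (1 - w) powr (v - 1)) * K (s * sqrt w) * indicator {0<..<1} w * (ennreal (rayleigh_density t s) * indicator {0<..} s) \<partial>lborel) =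
        ennreal (v * (1 - w) powr (v - 1)) * (\<integral>\<^sup>+x\<in>A. ennreal (normal_density 0 (c * sqrt w * sqrt t) x) \<partial>lborel) * indicator {0<..<1} w"
    proof (cases "0 < w \<and> w < 1")
      case True
      then have cw: "0 < c * sqrt w" using c by simp
      have "(\<integral>\<^sup>+s. ennreal (v * (1 - w) powr (v - 1)) * K (s * sqrt w) * indicator {0<..<1} w * (ennreal (rayleigh_density t s) * indicator {0<..} s) \<partial>lborel) =
          (\<integral>\<^sup>+s. ennreal (v * (1 - w) powr (v - 1)) * (K (s * sqrt w) * ennreal (rayleigh_density t s) * indicator {0<..} s) \<partial>lborel)"
        using True by (intro nn_integral_cong) (simp add: mult_ac)
      also have "\<dots> = ennreal (v * (1 - w) powr (v - 1)) * (\<integral>\<^sup>+s\<in>{0<..}. K (s * sqrt w) * ennreal (rayleigh_density t s) \<partial>lborel)"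
        by (rule nn_integral_cmult) measurable
      also have "(\<integral>\<^sup>+s\<in>{0<..}. K (s * sqrt w) * ennreal (rayleigh_density t s) \<partial>lborel) =
          (\<integral>\<^sup>+x\<in>A. ennreal (normal_density 0 (c * sqrt w * sqrt t) x) \<partial>lborel)"
        using nn_integral_rayleigh_arcsine_scaled[OF t cw, of A] by (simp add: K_def mult_ac)
      finally show ?thesis
        using True by simp
    qed auto
  qed
  finally show ?thesis .
qed

text \<open>Common last step for both values of \<open>m\<close>: only the weights
  \<open>a n\<close> depend on \<open>n\<close>, so they are summed inside. The indicator on the
  right is written as in the definition of a set integral, and the endpoints 0 and 1 form a null
  set.\<close>

lemma nn_integral_normal_mixture_suminf:
  fixes a :: "nat \<Rightarrow> real \<Rightarrow> real"
  assumes c: "0 < c" and t: "0 < t" and [measurable]: "A \<in> sets borel"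
    and [measurable]: "\<And>n. a n \<in> borel_measurable borel" "S \<in> borel_measurable borel"
    and a: "\<And>n w. 0 < w \<Longrightarrow> w < 1 \<Longrightarrow> 0 \<le> a n w"
    and S: "\<And>w. 0 < w \<Longrightarrow> w < 1 \<Longrightarrow> (\<lambda>n. a n w) sums S w"
  shows "(\<Sum>n. \<integral>\<^sup>+w\<in>{0<..<1}. ennreal (a n w) * (\<integral>\<^sup>+x\<in>A. ennreal (normal_density 0 (c * sqrt w * sqrt t) x) \<partial>lborel) \<partial>lborel) =
    (\<integral>\<^sup>+x\<in>A. (\<integral>\<^sup>+w. ennreal (indicator {0..1} w *\<^sub>R (S w * (exp (- (x\<^sup>2 / (2 * c\<^sup>2 * t * w))) / (sqrt (2 * pi * t * w) * c)))) \<partial>lborel) \<partial>lborel)"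
proof -
  define N where "N w = (\<integral>\<^sup>+x\<in>A. ennreal (normal_density 0 (c * sqrt w * sqrt t) x) \<partial>lborel)" for w
  have dens: "normal_density 0 (c * sqrt w * sqrt t) x = exp (- (x\<^sup>2 / (2 * c\<^sup>2 * t * w))) / (sqrt (2 * pi * t * w) * c)"
    if "0 < w" for w x
    using c t that by (simp add: normal_density_def real_sqrt_mult power_mult_distrib mult_ac)
  have [measurable]: "N \<in> borel_measurable borel"
    unfolding N_def[abs_def] normal_density_def by measurable
  have "(\<Sum>n. \<integral>\<^sup>+w\<in>{0<..<1}. ennreal (a n w) * N w \<partial>lborel) =
      (\<integral>\<^sup>+w. (\<Sum>n. ennreal (a n w) * N w * indicator {0<..<1} w) \<partial>lborel)"
    by (rule nn_integral_suminf[symmetric]) measurable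
  also have "\<dots> = (\<integral>\<^sup>+w. \<integral>\<^sup>+x. ennreal (S w * (exp (- (x\<^sup>2 / (2 * c\<^sup>2 * t * w))) / (sqrt (2 * pi * t * w) * c))) * indicator {0<..<1} w * indicator A x \<partial>lborel \<partial>lborel)"
  proof (rule nn_integral_cong)
    fix w :: real
    show "(\<Sum>n. ennreal (a n w) * N w * indicator {0<..<1} w) =
        (\<integral>\<^sup>+x. ennreal (S w * (exp (- (x\<^sup>2 / (2 * c\<^sup>2 * t * w))) / (sqrt (2 * pi * t * w) * c))) * indicator {0<..<1} w * indicator A x \<partial>lborel)"
    proof (cases "0 < w \<and> w < 1")
      case True
      then have S0: "0 \<le> S w"
        using sums_le[OF _ sums_zero S[of w]] a by auto
      have "(\<Sum>n. ennreal (a n w)) = ennreal (S w)"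
        using True by (intro suminf_ennreal_eq a S) auto
      then have "(\<Sum>n. ennreal (a n w) * N w * indicator {0<..<1} w) = ennreal (S w) * N w"
        using True by simp
      also have "\<dots> = (\<integral>\<^sup>+x. ennreal (S w) * (ennreal (normal_density 0 (c * sqrt w * sqrt t) x) * indicator A x) \<partial>lborel)"
        unfolding N_def by (rule nn_integral_cmult[symmetric]) measurable
      also have "\<dots> = (\<integral>\<^sup>+x. ennreal (S w * normal_density 0 (c * sqrt w * sqrt t) x) * indicator {0<..<1} w * indicator A x \<partial>lborel)"
        using True S0 by (simp add: ennreal_mult mult.assoc)
      finally show ?thesis
        using True by (simp add: dens)
    qed auto
  qed
  also have "\<dots> = (\<integral>\<^sup>+x. \<integral>\<^sup>+w. ennreal (S w * (exp (- (x\<^sup>2 / (2 * c\<^sup>2 * t * w))) / (sqrt (2 * pi * t * w) * c))) * indicator {0<..<1} w * indicator A x \<partial>lborel \<partial>lborel)"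
    by (rule lborel_pair.Fubini') measurable
  also have "\<dots> = (\<integral>\<^sup>+x\<in>A. (\<integral>\<^sup>+w. ennreal (indicator {0..1} w *\<^sub>R (S w * (exp (- (x\<^sup>2 / (2 * c\<^sup>2 * t * w))) / (sqrt (2 * pi * t * w) * c)))) \<partial>lborel) \<partial>lborel)"
  proof (rule nn_integral_cong)
    fix x :: real
    have ae: "AE w in lborel. w \<noteq> (0::real) \<and> w \<noteq> 1"
      by (auto intro!: AE_conjI AE_lborel_singleton)
    have "(\<integral>\<^sup>+w. ennreal (S w * (exp (- (x\<^sup>2 / (2 * c\<^sup>2 * t * w))) / (sqrt (2 * pi * t * w) * c))) * indicator {0<..<1} w \<partial>lborel) =
        (\<integral>\<^sup>+w. ennreal (indicator {0..1} w *\<^sub>R (S w * (exp (- (x\<^sup>2 / (2 * c\<^sup>2 * t * w))) / (sqrt (2 * pi * t * w) * c)))) \<partial>lborel)"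
      by (rule nn_integral_cong_AE, use ae in eventually_elim) (auto split: split_indicator)
    then show "(\<integral>\<^sup>+w. ennreal (S w * (exp (- (x\<^sup>2 / (2 * c\<^sup>2 * t * w))) / (sqrt (2 * pi * t * w) * c))) * indicator {0<..<1} w * indicator A x \<partial>lborel) =
        (\<integral>\<^sup>+w. ennreal (indicator {0..1} w *\<^sub>R (S w * (exp (- (x\<^sup>2 / (2 * c\<^sup>2 * t * w))) / (sqrt (2 * pi * t * w) * c)))) \<partial>lborel) * indicator A x"
      by (simp add: nn_integral_multc)
  qed
  finally show ?thesis by (simp add: N_def)
qed

section \<open>The motion at the time given by the two-dimensional Bessel process\<close>

context random_motion
begin

lemma bessel_measurable:
  assumes "independent_brownian_motions M 2 B" "0 < t"
  shows "bessel_process 2 B t \<in> borel_measurable M"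
proof -
  have "B i t \<in> borel_measurable M" if "i \<in> {1..2}" for i
    using assms that brownian_motion_measurable[of M "B i" t] by (simp add: independent_brownian_motions_def)
  then show ?thesis
    unfolding bessel_process_def[abs_def]
    by (intro borel_measurable_sqrt[THEN measurable_compose[rotated]] borel_measurable_sum borel_measurable_power)
qed

lemma mixing_kernel_measurable [measurable]:
  assumes [measurable]: "A \<in> sets borel"
  shows "(\<lambda>s. \<integral>\<^sup>+y. indicator A (c * s * y) * ennreal (ultraspherical v y) \<partial>lborel) \<in> borel_measurable borel"
  by measurable

text \<open>Here \<open>v = n + 1\<close>, so the law of \<open>w\<close> has density (n + 1)(1 -
  w)^n, and the Poisson average of these densities is the kernel \<open>S\<close>.\<close>

lemma law_bessel_2_shape_1:
  assumes B: "independent_brownian_motions M 2 B" and t: "0 < t" and m1: "m = 1"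
  shows "law_at_random_time M lam t (event_count W) (motion c W \<Theta>) (bessel_process 2 B t) =
    density lborel (\<lambda>x. ennreal (LINT w:{0..1}|lborel. exp (- lam * t * w) * (1 + lam * t * (1 - w))
      * (exp (- (x\<^sup>2 / (2 * c\<^sup>2 * t * w))) / (sqrt (2 * pi * t * w) * c))))"
proof (rule law_at_random_time_eq_density)
  define S where "S w = exp (- lam * t * w) * (1 + lam * t * (1 - w))" for w
  define G where "G x = (\<integral>\<^sup>+w. ennreal (indicator {0..1} w *\<^sub>R (S w * (exp (- (x\<^sup>2 / (2 * c\<^sup>2 * t * w))) / (sqrt (2 * pi * t * w) * c)))) \<partial>lborel)" for x
  have [measurable]: "S \<in> borel_measurable borel"
    unfolding S_def[abs_def] by measurable
  have S0: "0 \<le> S w" if "w \<le> 1" for w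
    using lam t that by (simp add: S_def)
  show "bessel_process 2 B t \<in> borel_measurable M"
    using B t by (rule bessel_measurable)
  show "G \<in> borel_measurable borel"
    unfolding G_def[abs_def] by measurable
  define a where "a n w = exp (- lam * t) * (lam * t) ^ n / fact n * ((real n + 1) * (1 - w) ^ n)" for n w
  show "(\<Sum>n. ennreal (exp (- lam * t) * (lam * t) ^ n / fact n) *
        (\<integral>\<^sup>+s\<in>{0<..}. (\<integral>\<^sup>+y. indicator A (c * s * y) * ennreal (ultraspherical (shape m n) y) \<partial>lborel) \<partial>distr M borel (bessel_process 2 B t))) =
      (\<integral>\<^sup>+x\<in>A. G x \<partial>lborel)" if [measurable]: "A \<in> sets borel" for A
  proof -
    have "ennreal (exp (- lam * t) * (lam * t) ^ n / fact n) *
        (\<integral>\<^sup>+s\<in>{0<..}. (\<integral>\<^sup>+y. indicator A (c * s * y) * ennreal (ultraspherical (shape m n) y) \<partial>lborel) \<partial>distr M borel (bessel_process 2 B t)) =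
        (\<integral>\<^sup>+w\<in>{0<..<1}. ennreal (a n w) * (\<integral>\<^sup>+x\<in>A. ennreal (normal_density 0 (c * sqrt w * sqrt t) x) \<partial>lborel) \<partial>lborel)" for n
    proof -
      let ?N = "\<lambda>w. \<integral>\<^sup>+x\<in>A. ennreal (normal_density 0 (c * sqrt w * sqrt t) x) \<partial>lborel"
      have v: "0 < real n + 1" by simp
      have e: "(\<integral>\<^sup>+s\<in>{0<..}. (\<integral>\<^sup>+y. indicator A (c * s * y) * ennreal (ultraspherical (shape m n) y) \<partial>lborel) \<partial>distr M borel (bessel_process 2 B t)) =
          (\<integral>\<^sup>+w\<in>{0<..<1}. ennreal ((real n + 1) * (1 - w) powr (real n + 1 - 1)) * ?N w \<partial>lborel)"
        unfolding nn_integral_bessel_2[OF B prob_space_axioms t mixing_kernel_measurable[OF that]]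
        using nn_integral_rayleigh_ultraspherical[OF t c v that] by (simp add: shape_def m1)
      have "ennreal (exp (- lam * t) * (lam * t) ^ n / fact n) *
          (\<integral>\<^sup>+s\<in>{0<..}. (\<integral>\<^sup>+y. indicator A (c * s * y) * ennreal (ultraspherical (shape m n) y) \<partial>lborel) \<partial>distr M borel (bessel_process 2 B t)) =
          (\<integral>\<^sup>+w. ennreal (exp (- lam * t) * (lam * t) ^ n / fact n) * (ennreal ((real n + 1) * (1 - w) powr (real n + 1 - 1)) * ?N w * indicator {0<..<1} w) \<partial>lborel)"
        unfolding e by (rule nn_integral_cmult[symmetric]) (unfold normal_density_def, measurable)
      also have "\<dots> = (\<integral>\<^sup>+w\<in>{0<..<1}. ennreal (a n w) * ?N w \<partial>lborel)"
      proof (rule nn_integral_cong)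
        fix w :: real
        have "ennreal (exp (- lam * t) * (lam * t) ^ n / fact n) * ennreal ((real n + 1) * (1 - w) powr (real n + 1 - 1)) = ennreal (a n w)"
          if "0 < w" "w < 1"
          using that lam t by (subst ennreal_mult[symmetric]) (auto simp: a_def powr_realpow)
        then show "ennreal (exp (- lam * t) * (lam * t) ^ n / fact n) * (ennreal ((real n + 1) * (1 - w) powr (real n + 1 - 1)) * ?N w * indicator {0<..<1} w) =
            ennreal (a n w) * ?N w * indicator {0<..<1} w"
          by (cases "0 < w \<and> w < 1") (simp_all only: mult.assoc[symmetric], auto)
      qed
      finally show ?thesis .
    qed
    moreover have "(\<Sum>n. \<integral>\<^sup>+w\<in>{0<..<1}. ennreal (a n w) * (\<integral>\<^sup>+x\<in>A. ennreal (normal_density 0 (c * sqrt w * sqrt t) x) \<partial>lborel) \<partial>lborel) =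
        (\<integral>\<^sup>+x\<in>A. G x \<partial>lborel)"
      unfolding G_def
    proof (rule nn_integral_normal_mixture_suminf[OF c t that])
      fix n show "a n \<in> borel_measurable borel"
        unfolding a_def[abs_def] by measurable
    next
      fix n w assume "0 < w" "w < (1::real)"
      then show "0 \<le> a n w" using lam t by (simp add: a_def)
    next
      fix w :: real assume "0 < w" "w < 1"
      \<comment> \<open>The sum of (n + 1) z^n / n! is (z + 1) exp z; the part with the factor
        \<open>n\<close> comes from shifting the exponential series by one index.\<close>
      define z where "z = lam * t * (1 - w)"
      have e: "(\<lambda>n. z ^ n /\<^sub>R fact n) sums exp z" by (rule exp_converges)
      have "(\<lambda>n. real (Suc n) * (z ^ Suc n /\<^sub>R fact (Suc n))) = (\<lambda>n. z * (z ^ n /\<^sub>R fact n))"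
        by (auto simp: fun_eq_iff field_simps simp del: of_nat_Suc)
      then have "(\<lambda>n. real (Suc n) * (z ^ Suc n /\<^sub>R fact (Suc n))) sums (z * exp z)"
        using sums_mult[OF e, of z] by simp
      then have "(\<lambda>n. real n * (z ^ n /\<^sub>R fact n)) sums (z * exp z)"
        by (subst (asm) sums_Suc_iff) simp
      from sums_mult[OF sums_add[OF this e], of "exp (- lam * t)"]
      have "(\<lambda>n. exp (- lam * t) * (real n * (z ^ n /\<^sub>R fact n) + z ^ n /\<^sub>R fact n)) sums (exp (- lam * t) * (z * exp z + exp z))" .
      moreover have "exp (- lam * t) * (real n * (z ^ n /\<^sub>R fact n) + z ^ n /\<^sub>R fact n) = a n w" for n
      proof -
        have "z ^ n = (lam * t) ^ n * (1 - w) ^ n"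
          unfolding z_def by (rule power_mult_distrib)
        then show ?thesis
          by (simp add: a_def field_simps)
      qed
      moreover have "exp (- lam * t) * (z * exp z + exp z) = S w"
      proof -
        have "exp (- lam * t) * exp z = exp (- lam * t * w)"
          unfolding exp_add[symmetric] by (simp add: z_def algebra_simps)
        then have "exp (- lam * t) * (z * exp z + exp z) = exp (- lam * t * w) * (1 + z)"
          by (simp add: algebra_simps)
        then show ?thesis by (simp add: S_def z_def)
      qed
      ultimately show "(\<lambda>n. a n w) sums S w" by simp
    qed measurable
    ultimately show ?thesis by simp
  qed
  let ?g = "\<lambda>x. LINT w:{0..1}|lborel. exp (- lam * t * w) * (1 + lam * t * (1 - w))
      * (exp (- (x\<^sup>2 / (2 * c\<^sup>2 * t * w))) / (sqrt (2 * pi * t * w) * c))"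
  have g: "?g x = enn2real (G x)" for x
    unfolding G_def S_def[symmetric] set_lebesgue_integral_def
    by (rule integral_eq_nn_integral) (use c t S0 in \<open>auto intro!: AE_I2 split: split_indicator\<close>)
  show "?g \<in> borel_measurable borel"
    unfolding g using \<open>G \<in> borel_measurable borel\<close> by measurable
  show "ennreal (?g x) = G x" if "G x \<noteq> \<infinity>" for x
    unfolding g using that by (simp add: less_top)
qed (rule t)

text \<open>For \<open>n = 0\<close> the index is \<open>v = 0\<close>, for which
  \<open>nn_integral_rayleigh_ultraspherical\<close> does not apply: \<open>Y\<close> itself is
  arcsine, which corresponds to \<open>w = 1\<close>. This case gives the separate Gaussian term;
  the integral collects the indices \<open>Suc n\<close>.\<close>

lemma law_bessel_2_shape_0:
  assumes B: "independent_brownian_motions M 2 B" and t: "0 < t" and m0: "m = 0"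
  shows "law_at_random_time M lam t (event_count W) (motion c W \<Theta>) (bessel_process 2 B t) =
    density lborel (\<lambda>x. ennreal (exp (- lam * t) * (lam * t / 2 *
      (LINT w:{0..1}|lborel. exp (lam * t * sqrt (1 - w)) / sqrt (1 - w)
        * (exp (- (x\<^sup>2 / (2 * c\<^sup>2 * t * w))) / (sqrt (2 * pi * t * w) * c)))
      + exp (- (x\<^sup>2 / (2 * c\<^sup>2 * t))) / (sqrt (2 * pi * t) * c))))"
proof (rule law_at_random_time_eq_density)
  define S where "S w = exp (lam * t * sqrt (1 - w)) / sqrt (1 - w)" for w
  define J where "J x = (\<integral>\<^sup>+w. ennreal (indicator {0..1} w *\<^sub>R (S w * (exp (- (x\<^sup>2 / (2 * c\<^sup>2 * t * w))) / (sqrt (2 * pi * t * w) * c)))) \<partial>lborel)" for x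
  define K where "K = exp (- lam * t) * (lam * t / 2)"
  define N where "N x = exp (- (x\<^sup>2 / (2 * c\<^sup>2 * t))) / (sqrt (2 * pi * t) * c)" for x
  define G where "G x = ennreal (exp (- lam * t) * N x) + ennreal K * J x" for x
  have K: "0 < K" using lam t by (simp add: K_def)
  have N: "normal_density 0 (c * sqrt t) x = N x" for x
    using c t by (simp add: N_def normal_density_def real_sqrt_mult power_mult_distrib mult_ac)
  have [measurable]: "S \<in> borel_measurable borel" "N \<in> borel_measurable borel"
    unfolding S_def[abs_def] N_def[abs_def] by measurable
  have S0: "0 \<le> S w" if "w \<le> 1" for w
    using that by (simp add: S_def)
  have N0: "0 \<le> N x" for x
    using c t by (simp add: N_def)
  have [measurable]: "J \<in> borel_measurable borel"
    unfolding J_def[abs_def] by measurable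
  show "bessel_process 2 B t \<in> borel_measurable M"
    using B t by (rule bessel_measurable)
  show [measurable]: "G \<in> borel_measurable borel"
    unfolding G_def[abs_def] by measurable
  define a where "a n w = (lam * t) ^ n / fact n * (1 - w) powr (real (Suc n) / 2 - 1)" for n w
  show "(\<Sum>n. ennreal (exp (- lam * t) * (lam * t) ^ n / fact n) *
        (\<integral>\<^sup>+s\<in>{0<..}. (\<integral>\<^sup>+y. indicator A (c * s * y) * ennreal (ultraspherical (shape m n) y) \<partial>lborel) \<partial>distr M borel (bessel_process 2 B t))) =
      (\<integral>\<^sup>+x\<in>A. G x \<partial>lborel)" if [measurable]: "A \<in> sets borel" for A
  proof -
    let ?N = "\<lambda>w. \<integral>\<^sup>+x\<in>A. ennreal (normal_density 0 (c * sqrt w * sqrt t) x) \<partial>lborel"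
    define F where "F n = ennreal (exp (- lam * t) * (lam * t) ^ n / fact n) *
        (\<integral>\<^sup>+s\<in>{0<..}. (\<integral>\<^sup>+y. indicator A (c * s * y) * ennreal (ultraspherical (shape m n) y) \<partial>lborel) \<partial>distr M borel (bessel_process 2 B t))" for n
    have F0: "F 0 = ennreal (exp (- lam * t)) * (\<integral>\<^sup>+x\<in>A. ennreal (N x) \<partial>lborel)"
      unfolding F_def nn_integral_bessel_2[OF B prob_space_axioms t mixing_kernel_measurable[OF that]]
      using nn_integral_rayleigh_arcsine_scaled[OF t c that] by (simp add: shape_def m0 N)
    have FSuc: "F (Suc n) = ennreal K * (\<integral>\<^sup>+w\<in>{0<..<1}. ennreal (a n w) * ?N w \<partial>lborel)" for n
    proof -
      let ?v = "real (Suc n) / 2"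
      have v: "0 < ?v" by simp
      have e: "(\<integral>\<^sup>+s\<in>{0<..}. (\<integral>\<^sup>+y. indicator A (c * s * y) * ennreal (ultraspherical (shape m (Suc n)) y) \<partial>lborel) \<partial>distr M borel (bessel_process 2 B t)) =
          (\<integral>\<^sup>+w\<in>{0<..<1}. ennreal (?v * (1 - w) powr (?v - 1)) * ?N w \<partial>lborel)"
        unfolding nn_integral_bessel_2[OF B prob_space_axioms t mixing_kernel_measurable[OF that]]
        using nn_integral_rayleigh_ultraspherical[OF t c v that] by (simp add: shape_def m0)
      have "F (Suc n) = (\<integral>\<^sup>+w. ennreal (exp (- lam * t) * (lam * t) ^ Suc n / fact (Suc n)) * (ennreal (?v * (1 - w) powr (?v - 1)) * ?N w * indicator {0<..<1} w) \<partial>lborel)"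
        unfolding F_def e by (rule nn_integral_cmult[symmetric]) (unfold normal_density_def, measurable)
      also have "\<dots> = (\<integral>\<^sup>+w. ennreal K * (ennreal (a n w) * ?N w * indicator {0<..<1} w) \<partial>lborel)"
      proof (rule nn_integral_cong)
        fix w :: real
        let ?p = "exp (- lam * t) * (lam * t) ^ Suc n / fact (Suc n)" and ?q = "?v * (1 - w) powr (?v - 1)"
        have "ennreal ?p * ennreal ?q = ennreal (?p * ?q)"
          using lam t by (intro ennreal_mult[symmetric]) auto
        \<comment> \<open>The \<open>n + 1\<close> in \<open>v = (n + 1) / 2\<close> cancels against
          (n + 1)!, and one factor \<open>lam * t\<close> together with 1/2 moves into
          \<open>K\<close>.\<close>
        also have "?p * ?q = K * a n w"
          by (simp add: K_def a_def field_simps del: of_nat_Suc)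
        also have "ennreal (K * a n w) = ennreal K * ennreal (a n w)"
          using lam t K by (intro ennreal_mult) (auto simp: a_def)
        finally have "ennreal ?p * ennreal ?q = ennreal K * ennreal (a n w)" .
        then show "ennreal (exp (- lam * t) * (lam * t) ^ Suc n / fact (Suc n)) * (ennreal (?v * (1 - w) powr (?v - 1)) * ?N w * indicator {0<..<1} w) =
            ennreal K * (ennreal (a n w) * ?N w * indicator {0<..<1} w)"
          by (simp only: mult.assoc[symmetric])
      qed
      also have "\<dots> = ennreal K * (\<integral>\<^sup>+w\<in>{0<..<1}. ennreal (a n w) * ?N w \<partial>lborel)"
        by (rule nn_integral_cmult) (unfold normal_density_def a_def, measurable)
      finally show ?thesis .
    qed
    have "(\<Sum>n. \<integral>\<^sup>+w\<in>{0<..<1}. ennreal (a n w) * ?N w \<partial>lborel) = (\<integral>\<^sup>+x\<in>A. J x \<partial>lborel)"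
      unfolding J_def
    proof (rule nn_integral_normal_mixture_suminf[OF c t that])
      fix n show "a n \<in> borel_measurable borel"
        unfolding a_def[abs_def] by measurable
    next
      fix n w assume "0 < w" "w < (1::real)"
      then show "0 \<le> a n w" using lam t by (simp add: a_def)
    next
      fix w :: real assume w: "0 < w" "w < 1"
      \<comment> \<open>Since (1 - w)^((n + 1)/2 - 1) = sqrt(1 - w)^(n - 1), the weights are an
        exponential series divided by \<open>sqrt (1 - w)\<close>.\<close>
      have "(\<lambda>n. (lam * t * sqrt (1 - w)) ^ n /\<^sub>R fact n / sqrt (1 - w)) sums (exp (lam * t * sqrt (1 - w)) / sqrt (1 - w))"
        by (intro sums_divide exp_converges)
      moreover have "(lam * t * sqrt (1 - w)) ^ n /\<^sub>R fact n / sqrt (1 - w) = a n w" for n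
      proof -
        have "(1 - w) powr (real (Suc n) / 2 - 1) = ((1 - w) powr (1/2)) powr (real n - 1)"
          unfolding powr_powr by (rule arg_cong[where f = "\<lambda>e. (1 - w) powr e"]) (simp add: field_simps)
        also have "\<dots> = sqrt (1 - w) powr (real n - 1)"
          using w by (simp add: powr_half_sqrt)
        also have "\<dots> = sqrt (1 - w) ^ n / sqrt (1 - w)"
          using w by (simp add: powr_diff powr_realpow)
        finally show ?thesis
          by (simp add: a_def power_mult_distrib field_simps)
      qed
      ultimately show "(\<lambda>n. a n w) sums S w"
        by (simp add: S_def)
    qed measurable
    then have sumSuc: "(\<Sum>n. F (Suc n)) = ennreal K * (\<integral>\<^sup>+x\<in>A. J x \<partial>lborel)"
      by (simp add: FSuc)
    have "(\<Sum>n. F n) = F 0 + (\<Sum>n. F (Suc n))"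
      using suminf_offset[of F 1] by simp
    also have "\<dots> = (\<integral>\<^sup>+x. ennreal (exp (- lam * t)) * (ennreal (N x) * indicator A x) \<partial>lborel) + (\<integral>\<^sup>+x. ennreal K * (J x * indicator A x) \<partial>lborel)"
      unfolding F0 sumSuc by (simp add: nn_integral_cmult)
    also have "\<dots> = (\<integral>\<^sup>+x. ennreal (exp (- lam * t)) * (ennreal (N x) * indicator A x) + ennreal K * (J x * indicator A x) \<partial>lborel)"
      by (rule nn_integral_add[symmetric]) measurable
    also have "\<dots> = (\<integral>\<^sup>+x\<in>A. G x \<partial>lborel)"
      by (intro nn_integral_cong) (simp add: G_def ennreal_mult N0 distrib_right mult.assoc)
    finally show ?thesis by (simp add: F_def)
  qed
  let ?I = "\<lambda>x. LINT w:{0..1}|lborel. exp (lam * t * sqrt (1 - w)) / sqrt (1 - w)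
        * (exp (- (x\<^sup>2 / (2 * c\<^sup>2 * t * w))) / (sqrt (2 * pi * t * w) * c))"
  have I: "?I x = enn2real (J x)" for x
    unfolding J_def S_def[symmetric] set_lebesgue_integral_def
    by (rule integral_eq_nn_integral) (use c t S0 in \<open>auto intro!: AE_I2 split: split_indicator\<close>)
  show "(\<lambda>x. exp (- lam * t) * (lam * t / 2 * ?I x + exp (- (x\<^sup>2 / (2 * c\<^sup>2 * t))) / (sqrt (2 * pi * t) * c))) \<in> borel_measurable borel"
    unfolding I N_def[symmetric] by measurable
  show "ennreal (exp (- lam * t) * (lam * t / 2 * ?I x + exp (- (x\<^sup>2 / (2 * c\<^sup>2 * t))) / (sqrt (2 * pi * t) * c))) = G x"
    if "G x \<noteq> \<infinity>" for x
  proof -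
    \<comment> \<open>Finiteness of \<open>G x\<close> passes to \<open>J x\<close> because its
      coefficient \<open>K\<close> is positive.\<close>
    have "J x \<noteq> \<top>"
      using that K by (auto simp: G_def ennreal_mult_top)
    then have J: "ennreal (enn2real (J x)) = J x"
      by (simp add: less_top)
    have "exp (- lam * t) * (lam * t / 2 * enn2real (J x) + N x) = exp (- lam * t) * N x + K * enn2real (J x)"
      by (simp add: K_def algebra_simps)
    then show ?thesis
      unfolding I N_def[symmetric] using K N0[of x]
      by (simp add: G_def ennreal_mult' J)
  qed
qed (rule t)

end

text \<open>The roles of time and shape are exchanged: the product \<open>c * b * y\<close> is read
  as \<open>(z / t) * b\<close> with \<open>z = c * t * y\<close>. Given \<open>z\<close> it is
  normal with standard deviation |z| / sqrt t, which is the kernel of the claim.\<close>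

lemma nn_integral_normal_ultraspherical:
  assumes c: "0 < c" and t: "0 < t" and v: "0 \<le> v" and [measurable]: "A \<in> sets borel"
  shows "(\<integral>\<^sup>+b. (\<integral>\<^sup>+y. indicator A (c * b * y) * ennreal (ultraspherical v y) \<partial>lborel) * ennreal (normal_density 0 (sqrt t) b) \<partial>lborel) =
    (\<integral>\<^sup>+z. ennreal (ultraspherical v (z / (c * t)) / (c * t)) *
      (\<integral>\<^sup>+x\<in>A. ennreal (sqrt t * exp (- (x\<^sup>2 * t / (2 * z\<^sup>2))) / sqrt (2 * pi * z\<^sup>2)) \<partial>lborel) \<partial>lborel)"
proof -
  let ?\<phi> = "normal_density 0 (sqrt t)"
  define Q where "Q y = (\<integral>\<^sup>+b. indicator A (c * b * y) * ennreal (?\<phi> b) \<partial>lborel)" for y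
  have [measurable]: "Q \<in> borel_measurable borel"
    unfolding Q_def[abs_def] by measurable
  have "(\<integral>\<^sup>+b. (\<integral>\<^sup>+y. indicator A (c * b * y) * ennreal (ultraspherical v y) \<partial>lborel) * ennreal (?\<phi> b) \<partial>lborel) =
      (\<integral>\<^sup>+b. (\<integral>\<^sup>+y. indicator A (c * b * y) * ennreal (ultraspherical v y) * ennreal (?\<phi> b) \<partial>lborel) \<partial>lborel)"
    by (intro nn_integral_cong nn_integral_multc[symmetric]) measurable
  also have "\<dots> = (\<integral>\<^sup>+y. (\<integral>\<^sup>+b. indicator A (c * b * y) * ennreal (ultraspherical v y) * ennreal (?\<phi> b) \<partial>lborel) \<partial>lborel)"
    by (rule lborel_pair.Fubini') measurable
  also have "\<dots> = (\<integral>\<^sup>+y. Q y * ennreal (ultraspherical v y) \<partial>lborel)"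
  proof (rule nn_integral_cong)
    fix y
    have "(\<integral>\<^sup>+b. indicator A (c * b * y) * ennreal (ultraspherical v y) * ennreal (?\<phi> b) \<partial>lborel) =
        (\<integral>\<^sup>+b. indicator A (c * b * y) * ennreal (?\<phi> b) * ennreal (ultraspherical v y) \<partial>lborel)"
      by (intro nn_integral_cong) (simp only: mult_ac)
    also have "\<dots> = Q y * ennreal (ultraspherical v y)"
      unfolding Q_def by (rule nn_integral_multc) measurable
    finally show "(\<integral>\<^sup>+b. indicator A (c * b * y) * ennreal (ultraspherical v y) * ennreal (?\<phi> b) \<partial>lborel) = Q y * ennreal (ultraspherical v y)" .
  qed
  \<comment> \<open>Writing \<open>y\<close> through \<open>c * t * y\<close> prepares the change of
    variable after which the density is that of the motion at time \<open>t\<close> given the number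
    of events.\<close>
  also have "\<dots> = (\<integral>\<^sup>+y. Q (c * t * y / (c * t)) * ennreal (ultraspherical v y) \<partial>lborel)"
    using c t by simp
  also have "\<dots> = (\<integral>\<^sup>+z. Q (z / (c * t)) * ennreal (ultraspherical v (z / (c * t)) / \<bar>c * t\<bar>) \<partial>lborel)"
    using c t v by (intro nn_integral_rescale[of "\<lambda>z. Q (z / (c * t))"]) auto
  also have "\<dots> = (\<integral>\<^sup>+z. ennreal (ultraspherical v (z / (c * t)) / (c * t)) *
      (\<integral>\<^sup>+x\<in>A. ennreal (sqrt t * exp (- (x\<^sup>2 * t / (2 * z\<^sup>2))) / sqrt (2 * pi * z\<^sup>2)) \<partial>lborel) \<partial>lborel)"
  proof (rule nn_integral_cong_AE)
    have "AE z in lborel. z \<noteq> (0::real)" by (rule AE_lborel_singleton)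
    then show "AE z in lborel. Q (z / (c * t)) * ennreal (ultraspherical v (z / (c * t)) / \<bar>c * t\<bar>) =
        ennreal (ultraspherical v (z / (c * t)) / (c * t)) *
        (\<integral>\<^sup>+x\<in>A. ennreal (sqrt t * exp (- (x\<^sup>2 * t / (2 * z\<^sup>2))) / sqrt (2 * pi * z\<^sup>2)) \<partial>lborel)"
    proof eventually_elim
      case (elim z)
      have "Q (z / (c * t)) = (\<integral>\<^sup>+b. indicator A (z / t * b) * ennreal (?\<phi> b) \<partial>lborel)"
        unfolding Q_def using c by (intro nn_integral_cong) (simp add: mult.commute)
      also have "\<dots> = (\<integral>\<^sup>+x. indicator A x * ennreal (?\<phi> (x / (z / t)) / \<bar>z / t\<bar>) \<partial>lborel)"
        using elim t by (intro nn_integral_rescale) auto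
      also have "\<dots> = (\<integral>\<^sup>+x\<in>A. ennreal (sqrt t * exp (- (x\<^sup>2 * t / (2 * z\<^sup>2))) / sqrt (2 * pi * z\<^sup>2)) \<partial>lborel)"
      proof (rule nn_integral_cong)
        fix x
        have "(x / (z / t))\<^sup>2 / (2 * t) = x\<^sup>2 * t / (2 * z\<^sup>2)"
          using t elim by (simp add: power_divide power_mult_distrib field_simps power2_eq_square)
        then have \<phi>: "?\<phi> (x / (z / t)) = 1 / sqrt (2 * pi * t) * exp (- (x\<^sup>2 * t / (2 * z\<^sup>2)))"
          using t by (simp add: normal_density_def)
        have root: "sqrt (2 * pi * t) * \<bar>z / t\<bar> = sqrt (2 * pi * z\<^sup>2) / sqrt t"
          using t by (simp add: real_sqrt_mult abs_divide field_simps)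
        have "?\<phi> (x / (z / t)) / \<bar>z / t\<bar> = exp (- (x\<^sup>2 * t / (2 * z\<^sup>2))) / (sqrt (2 * pi * t) * \<bar>z / t\<bar>)"
          unfolding \<phi> by (simp only: times_divide_eq_left mult_1_left divide_divide_eq_left)
        also have "\<dots> = sqrt t * exp (- (x\<^sup>2 * t / (2 * z\<^sup>2))) / sqrt (2 * pi * z\<^sup>2)"
          unfolding root by simp
        finally have "?\<phi> (x / (z / t)) / \<bar>z / t\<bar> = sqrt t * exp (- (x\<^sup>2 * t / (2 * z\<^sup>2))) / sqrt (2 * pi * z\<^sup>2)" .
        then show "indicator A x * ennreal (?\<phi> (x / (z / t)) / \<bar>z / t\<bar>) =
            ennreal (sqrt t * exp (- (x\<^sup>2 * t / (2 * z\<^sup>2))) / sqrt (2 * pi * z\<^sup>2)) * indicator A x"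
          by (simp add: mult.commute)
      qed
      finally show ?case
        using c t by (simp add: mult.commute)
    qed
  qed
  finally show ?thesis .
qed

section \<open>The series of the motion density, and the motion at the time |B t|\<close>

context random_motion
begin

definition series_scale :: "real \<Rightarrow> real" where
  "series_scale t = (if m = 0 then lam * exp (- lam * t) / (2 * c) else exp (- lam * t) / (c * sqrt (lam * pi * t ^ 3)))"

definition series_term :: "real \<Rightarrow> real \<Rightarrow> nat \<Rightarrow> real" where
  "series_term t z k =
    (if m = 0 then (lam / (2 * c) * sqrt (c\<^sup>2 * t\<^sup>2 - z\<^sup>2)) powr (real k - 1) * (1 / (Gamma ((real k + 1) / 2))\<^sup>2)
     else (lam / (c\<^sup>2 * t) * (c\<^sup>2 * t\<^sup>2 - z\<^sup>2)) powr (real k + 1/2) * ((real k + 1) / Gamma (real k + 3/2)))"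

lemma motion_density_eq:
  "motion_density m c lam z t = (if \<bar>z\<bar> < c * t then series_scale t * (\<Sum>k. series_term t z k) else 0)"
  by (simp add: motion_density_def series_scale_def series_term_def)

text \<open>Term by term, the series in \<open>motion_density\<close> is the Poisson mixture of the
  conditional densities at time \<open>t\<close>.\<close>

lemma poisson_ultraspherical_term:
  assumes t: "0 < t" and z: "\<bar>z\<bar> < c * t"
  shows "exp (- lam * t) * (lam * t) ^ k / fact k * (ultraspherical (shape m k) (z / (c * t)) / (c * t)) =
    series_scale t * series_term t z k"
proof -
  define q where "q = c\<^sup>2 * t\<^sup>2 - z\<^sup>2"
  have ct: "0 < c * t" using c t by simp
  have q: "0 < q"
    using z ct power_strict_mono[of "\<bar>z\<bar>" "c * t" 2] by (simp add: q_def power_mult_distrib)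
  have lt: "\<bar>z / (c * t)\<bar> < 1"
    using z ct by (simp add: abs_divide divide_less_eq)
  have base: "1 - (z / (c * t))\<^sup>2 = q / (c * t)\<^sup>2"
    using c t by (simp add: q_def power_divide power_mult_distrib diff_divide_distrib)
  have "m = 0 \<or> m = 1" using m by simp
  then show ?thesis
  proof
    assume m0: "m = 0"
    define G where "G = Gamma ((real k + 1) / 2)"
    have G: "0 < G" by (auto simp: G_def intro!: Gamma_real_pos)
    define r where "r = sqrt q"
    have r: "0 < r" using q by (simp add: r_def)
    define G' where "G' = Gamma (real k / 2 + 1)"
    \<comment> \<open>Duplication at \<open>(k + 1) / 2\<close> expresses
      \<open>Gamma (v + 1)\<close> through the other Gamma value and \<open>fact k\<close>; this
      cancels the Poisson factorial and leaves the squared Gamma in the denominator.\<close>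
    have leg: "G * G' = sqrt pi * fact k / 2 ^ k"
    proof -
      have "G * Gamma ((real k + 1) / 2 + 1/2) = 2 powr (1 - 2 * ((real k + 1) / 2)) * sqrt pi * Gamma (2 * ((real k + 1) / 2))"
        unfolding G_def by (rule Gamma_legendre_duplication_real) simp
      moreover have "2 powr (1 - 2 * ((real k + 1) / 2)) = 1 / 2 ^ k"
        by (simp add: powr_minus powr_realpow divide_simps)
      moreover have "Gamma (2 * ((real k + 1) / 2)) = fact k"
      proof -
        have "2 * ((real k + 1) / 2) = 1 + real k" by simp
        then show ?thesis
          using Gamma_fact[of k, where 'a = real] by (simp only:)
      qed
      moreover have "(real k + 1) / 2 + 1/2 = real k / 2 + 1"
        by (simp add: field_simps)
      ultimately show ?thesis by (simp add: G'_def)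
    qed
    have pw: "(q / (c * t)\<^sup>2) powr (real k / 2 - 1/2) = (r / (c * t)) powr (real k - 1)"
    proof -
      have "q / (c * t)\<^sup>2 = (r / (c * t)) powr 2"
        using q ct r by (simp add: r_def power_divide)
      then have "(q / (c * t)\<^sup>2) powr (real k / 2 - 1/2) = (r / (c * t)) powr (2 * (real k / 2 - 1/2))"
        by (simp only: powr_powr)
      then show ?thesis by (simp add: algebra_simps)
    qed
    have pk: "x powr (real k - 1) = x ^ k / x" if "0 < x" for x :: real
      using that by (simp add: powr_diff powr_realpow)
    have u: "ultraspherical (real k / 2) (z / (c * t)) = G' / (sqrt pi * G) * ((r / (c * t)) ^ k / (r / (c * t)))"
      using lt r ct by (simp add: ultraspherical_def base pw pk G_def G'_def add_divide_distrib del: abs_divide)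
    have g: "G' = sqrt pi * fact k / (2 ^ k * G)"
      using leg G by (simp add: field_simps)
    have s: "series_scale t * series_term t z k =
        lam * exp (- lam * t) / (2 * c) * ((lam / (2 * c) * r) ^ k / (lam / (2 * c) * r) * (1 / G\<^sup>2))"
      unfolding series_scale_def series_term_def q_def[symmetric] r_def[symmetric] G_def[symmetric]
      using pk[of "lam / (2 * c) * r"] lam c r by (simp add: m0)
    show ?thesis
      unfolding s shape_def using m0 lam c t r G
      by (simp add: u g power_mult_distrib power_divide power2_eq_square field_simps)
  next
    assume m1: "m = 1"
    have pk: "x powr (real k + 1/2) = x ^ k * sqrt x" if "0 < x" for x :: real
      using that by (simp only: powr_add powr_realpow powr_half_sqrt less_imp_le)
    have qpos: "0 < q / (c * t)\<^sup>2" using q ct by (intro divide_pos_pos zero_less_power)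
    have e1: "real k + 1 - 1/2 = real k + 1/2" and e2: "real k + 1 + 1/2 = real k + 3/2" by simp_all
    \<comment> \<open>The value (k + 1)! divided by the Poisson factorial k! gives the factor
      \<open>k + 1\<close> of the series.\<close>
    have e3: "Gamma (real k + 1 + 1) = fact (Suc k)"
      using Gamma_fact[of "Suc k", where 'a = real] by (simp add: add_ac)
    have u: "ultraspherical (real k + 1) (z / (c * t)) =
        fact (Suc k) / (sqrt pi * Gamma (real k + 3/2)) * ((q / (c * t)\<^sup>2) ^ k * sqrt (q / (c * t)\<^sup>2))"
      unfolding ultraspherical_def base e1 e2 e3 pk[OF qpos] by (simp only: lt if_True)
    have s: "series_scale t * series_term t z k =
        exp (- lam * t) / (c * sqrt (lam * pi * t ^ 3)) *
        ((lam / (c\<^sup>2 * t) * q) ^ k * sqrt (lam / (c\<^sup>2 * t) * q) * ((real k + 1) / Gamma (real k + 3/2)))"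
      unfolding series_scale_def series_term_def q_def[symmetric]
      using pk[of "lam / (c\<^sup>2 * t) * q"] lam c t q by (simp add: m1)
    \<comment> \<open>Square roots become atoms, so that the remaining identity is rational in
      them.\<close>
    define l where "l = sqrt lam"
    define h where "h = sqrt t"
    define p where "p = sqrt pi"
    define r where "r = sqrt q"
    have pos: "0 < l" "0 < h" "0 < p" "0 < r" using lam t q by (auto simp: l_def h_def p_def r_def)
    have sq: "t = h * h" "lam = l * l" using lam t by (simp_all add: l_def h_def)
    have r1: "sqrt (q / (c * t)\<^sup>2) = r / (c * t)"
      using ct by (simp add: real_sqrt_divide r_def)
    have r2: "sqrt (lam / (c\<^sup>2 * t) * q) = l * r / (c * h)"
      using c by (simp add: real_sqrt_divide real_sqrt_mult r_def l_def h_def)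
    have r3: "sqrt (lam * pi * t ^ 3) = l * p * t * h"
      using t by (simp add: real_sqrt_mult l_def h_def p_def power3_eq_cube)
    have pows: "(lam * t) ^ k * (q / (c * t)\<^sup>2) ^ k = (lam / (c\<^sup>2 * t) * q) ^ k"
      unfolding power_mult_distrib[symmetric] using c t by (simp add: power2_eq_square field_simps)
    have "exp (- lam * t) * (lam * t) ^ k / fact k * (ultraspherical (shape m k) (z / (c * t)) / (c * t)) =
        ((lam * t) ^ k * (q / (c * t)\<^sup>2) ^ k) * (exp (- lam * t) * (real k + 1) / Gamma (real k + 3/2)) * (r / (c * t) / (c * t) / p)"
      unfolding shape_def using m1 by (simp add: u r1 p_def) (simp add: mult_ac add.commute)
    also have "r / (c * t) / (c * t) / p = (l * r / (c * h)) / (c * (l * p * t * h))"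
      using pos c t by (simp add: sq(1) field_simps)
    finally show ?thesis
      unfolding s r2 r3 pows by (simp only: times_divide_eq_left times_divide_eq_right divide_divide_eq_left divide_divide_eq_right mult_ac add.commute mult_1_left mult_1_right)
  qed
qed

text \<open>The series converge almost everywhere because the mixture has total mass 1.\<close>

lemma AE_motion_density:
  assumes t: "0 < t"
  shows "AE z in lborel. (\<Sum>k. ennreal (exp (- lam * t) * (lam * t) ^ k / fact k) * ennreal (ultraspherical (shape m k) (z / (c * t)) / (c * t))) =
    ennreal (motion_density m c lam z t) \<and> 0 \<le> motion_density m c lam z t"
proof -
  let ?f = "\<lambda>z k. ennreal (exp (- lam * t) * (lam * t) ^ k / fact k) * ennreal (ultraspherical (shape m k) (z / (c * t)) / (c * t))"
  have ct: "0 < c * t" using c t by simp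
  have one: "(\<integral>\<^sup>+z. ennreal (ultraspherical (shape m k) (z / (c * t)) / (c * t)) \<partial>lborel) = 1" for k
    using nn_integral_rescale[of "\<lambda>_. 1" "ultraspherical (shape m k)" "c * t"] c t by simp
  have "(\<integral>\<^sup>+z. (\<Sum>k. ?f z k) \<partial>lborel) = (\<Sum>k. \<integral>\<^sup>+z. ?f z k \<partial>lborel)"
    by (rule nn_integral_suminf) measurable
  also have "\<dots> = (\<Sum>k. ennreal (exp (- lam * t) * (lam * t) ^ k / fact k))"
    by (subst nn_integral_cmult) (measurable, simp only: one mult_1_right)
  also have "\<dots> = 1"
    using lam t by (intro poisson_suminf_ennreal) auto
  finally have "AE z in lborel. (\<Sum>k. ?f z k) \<noteq> \<infinity>"
    by (intro nn_integral_PInf_AE) auto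
  then show ?thesis
  proof eventually_elim
    case (elim z)
    show ?case
    proof (cases "\<bar>z\<bar> < c * t")
      case False
      then have "\<not> \<bar>z / (c * t)\<bar> < 1"
        using ct by (simp add: abs_divide divide_less_eq)
      then show ?thesis
        using False by (simp add: ultraspherical_def motion_density_eq)
    next
      case True
      have C: "0 < series_scale t"
        using lam c t by (simp add: series_scale_def)
      have T: "0 \<le> series_term t z k" for k
        by (simp add: series_term_def Gamma_real_nonneg)
      have f: "?f z k = ennreal (series_scale t * series_term t z k)" for k
        unfolding poisson_ultraspherical_term[OF t True, symmetric] using lam t ct by (intro ennreal_mult[symmetric]) auto
      have "summable (\<lambda>k. series_scale t * series_term t z k)"
        using elim C T unfolding f by (intro summable_suminf_not_top) auto
      moreover from this have "summable (series_term t z)"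
        using C by (subst (asm) summable_cmult_iff) simp
      ultimately show ?thesis
        unfolding f motion_density_eq using True C T
        by (subst suminf_ennreal2) (auto simp: suminf_mult intro!: mult_nonneg_nonneg suminf_nonneg)
    qed
  qed
qed

text \<open>At \<open>x = 0\<close> the integrand is of order 1/|y| near 0, so the real integral
  takes its default value 0 there; equality of the laws does not see this point.\<close>

lemma law_brownian:
  assumes B: "brownian_motion M B" and t: "0 < t"
  shows "law_at_random_time M lam t (event_count W) (motion c W \<Theta>) (\<lambda>\<omega>. \<bar>B t \<omega>\<bar>) =
    density lborel (\<lambda>x. ennreal (LINT y:{-(c * t)..c * t}|lborel.
      sqrt t * exp (- (x\<^sup>2 * t / (2 * y\<^sup>2))) / sqrt (2 * pi * y\<^sup>2) * motion_density m c lam y t))"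
proof (rule law_at_random_time_eq_density)
  let ?\<phi> = "normal_density 0 (sqrt t)"
  let ?n = "\<lambda>z x. sqrt t * exp (- (x\<^sup>2 * t / (2 * z\<^sup>2))) / sqrt (2 * pi * z\<^sup>2)"
  have [measurable]: "B t \<in> borel_measurable M"
    using B t by (intro brownian_motion_measurable) auto
  have md [measurable]: "(\<lambda>z. motion_density m c lam z t) \<in> borel_measurable borel"
    unfolding motion_density_eq series_term_def by measurable
  \<comment> \<open>Known only almost everywhere, since the sign of the real \<open>suminf\<close>
    was obtained together with the convergence of the series.\<close>
  have md0: "AE z in lborel. 0 \<le> motion_density m c lam z t"
    using AE_motion_density[OF t] by eventually_elim simp
  show "(\<lambda>\<omega>. \<bar>B t \<omega>\<bar>) \<in> borel_measurable M"
    by measurable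
  define G where "G x = (\<integral>\<^sup>+y. ennreal (indicator {-(c * t)..c * t} y *\<^sub>R (?n y x * motion_density m c lam y t)) \<partial>lborel)" for x
  show [measurable]: "G \<in> borel_measurable borel"
    unfolding G_def[abs_def] by measurable
  show "(\<Sum>n. ennreal (exp (- lam * t) * (lam * t) ^ n / fact n) *
        (\<integral>\<^sup>+s\<in>{0<..}. (\<integral>\<^sup>+y. indicator A (c * s * y) * ennreal (ultraspherical (shape m n) y) \<partial>lborel) \<partial>distr M borel (\<lambda>\<omega>. \<bar>B t \<omega>\<bar>))) =
      (\<integral>\<^sup>+x\<in>A. G x \<partial>lborel)" if [measurable]: "A \<in> sets borel" for A
  proof -
    define R where "R z = (\<integral>\<^sup>+x\<in>A. ennreal (?n z x) \<partial>lborel)" for z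
    have [measurable]: "R \<in> borel_measurable borel"
      unfolding R_def[abs_def] by measurable
    let ?p = "\<lambda>n. ennreal (exp (- lam * t) * (lam * t) ^ n / fact n)"
    let ?u = "\<lambda>n z. ennreal (ultraspherical (shape m n) (z / (c * t)) / (c * t))"
    have inner: "(\<integral>\<^sup>+s\<in>{0<..}. (\<integral>\<^sup>+y. indicator A (c * s * y) * ennreal (ultraspherical (shape m n) y) \<partial>lborel) \<partial>distr M borel (\<lambda>\<omega>. \<bar>B t \<omega>\<bar>)) =
        (\<integral>\<^sup>+z. ?u n z * R z \<partial>lborel)" for n
    proof -
      define k where "k s = (\<integral>\<^sup>+y. indicator A (c * s * y) * ennreal (ultraspherical (shape m n) y) \<partial>lborel)" for s
      have [measurable]: "k \<in> borel_measurable borel"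
        unfolding k_def[abs_def] by (rule mixing_kernel_measurable) fact
      \<comment> \<open>Reflection of the symmetric variable \<open>Y\<close>, as rescaling by -1;
        it lets the law of |B t| be replaced by that of \<open>B t\<close>.\<close>
      have k_even: "k (- s) = k s" for s
        using nn_integral_rescale[of "\<lambda>y. indicator A (c * s * y)" "ultraspherical (shape m n)" "-1"] by (simp add: k_def)
      have "(\<integral>\<^sup>+s\<in>{0<..}. k s \<partial>distr M borel (\<lambda>\<omega>. \<bar>B t \<omega>\<bar>)) = (\<integral>\<^sup>+\<omega>. k \<bar>B t \<omega>\<bar> * indicator {0<..} \<bar>B t \<omega>\<bar> \<partial>M)"
        by (rule nn_integral_distr) measurable
      also have "\<dots> = (\<integral>\<^sup>+b. k \<bar>b\<bar> * indicator {0<..} \<bar>b\<bar> \<partial>distr M borel (B t))"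
        by (rule nn_integral_distr[symmetric]) measurable
      also have "\<dots> = (\<integral>\<^sup>+b. ennreal (?\<phi> b) * (k \<bar>b\<bar> * indicator {0<..} \<bar>b\<bar>) \<partial>lborel)"
        unfolding distr_brownian_motion[OF B t] by (rule nn_integral_density) measurable
      also have "\<dots> = (\<integral>\<^sup>+b. k b * ennreal (?\<phi> b) \<partial>lborel)"
      proof (rule nn_integral_cong_AE)
        have "AE b in lborel. b \<noteq> (0::real)" by (rule AE_lborel_singleton)
        then show "AE b in lborel. ennreal (?\<phi> b) * (k \<bar>b\<bar> * indicator {0<..} \<bar>b\<bar>) = k b * ennreal (?\<phi> b)"
          by eventually_elim (auto simp: abs_if k_even mult.commute)
      qed
      also have "\<dots> = (\<integral>\<^sup>+z. ?u n z * R z \<partial>lborel)"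
        unfolding k_def R_def by (rule nn_integral_normal_ultraspherical[OF c t]) (simp_all add: that)
      finally show ?thesis by (simp add: k_def)
    qed
    have "(\<Sum>n. ?p n * (\<integral>\<^sup>+z. ?u n z * R z \<partial>lborel)) = (\<Sum>n. \<integral>\<^sup>+z. ?p n * (?u n z * R z) \<partial>lborel)"
      by (intro arg_cong[where f = suminf] ext nn_integral_cmult[symmetric]) measurable
    also have "\<dots> = (\<integral>\<^sup>+z. (\<Sum>n. ?p n * (?u n z * R z)) \<partial>lborel)"
      by (rule nn_integral_suminf[symmetric]) measurable
    also have "\<dots> = (\<integral>\<^sup>+z. ennreal (motion_density m c lam z t) * R z \<partial>lborel)"
    proof (rule nn_integral_cong_AE, use AE_motion_density[OF t] in eventually_elim)
      fix z assume "(\<Sum>n. ?p n * ?u n z) = ennreal (motion_density m c lam z t) \<and> 0 \<le> motion_density m c lam z t"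
      then show "(\<Sum>n. ?p n * (?u n z * R z)) = ennreal (motion_density m c lam z t) * R z"
        by (simp only: mult.assoc[symmetric] ennreal_suminf_multc)
    qed
    also have "\<dots> = (\<integral>\<^sup>+z. \<integral>\<^sup>+x. ennreal (motion_density m c lam z t) * (ennreal (?n z x) * indicator A x) \<partial>lborel \<partial>lborel)"
      unfolding R_def by (intro nn_integral_cong nn_integral_cmult[symmetric]) measurable
    also have "\<dots> = (\<integral>\<^sup>+x. \<integral>\<^sup>+z. ennreal (motion_density m c lam z t) * (ennreal (?n z x) * indicator A x) \<partial>lborel \<partial>lborel)"
      by (rule lborel_pair.Fubini') measurable
    also have "\<dots> = (\<integral>\<^sup>+x\<in>A. G x \<partial>lborel)"
    proof (rule nn_integral_cong)
      fix x
      have "(\<integral>\<^sup>+z. ennreal (motion_density m c lam z t) * (ennreal (?n z x) * indicator A x) \<partial>lborel) =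
          (\<integral>\<^sup>+z. ennreal (indicator {-(c * t)..c * t} z *\<^sub>R (?n z x * motion_density m c lam z t)) * indicator A x \<partial>lborel)"
      proof (rule nn_integral_cong_AE, use md0 in eventually_elim)
        fix z assume md: "0 \<le> motion_density m c lam z t"
        show "ennreal (motion_density m c lam z t) * (ennreal (?n z x) * indicator A x) =
          ennreal (indicator {-(c * t)..c * t} z *\<^sub>R (?n z x * motion_density m c lam z t)) * indicator A x"
        proof (cases "\<bar>z\<bar> < c * t")
          case True
          have "ennreal (?n z x * motion_density m c lam z t) = ennreal (?n z x) * ennreal (motion_density m c lam z t)"
            using md t by (intro ennreal_mult) auto
          moreover have "z \<in> {-(c * t)..c * t}" using True by auto
          ultimately show ?thesis by (simp add: mult_ac)
        qed (simp add: motion_density_eq)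
      qed
      then show "(\<integral>\<^sup>+z. ennreal (motion_density m c lam z t) * (ennreal (?n z x) * indicator A x) \<partial>lborel) = G x * indicator A x"
        unfolding G_def by (simp only:) (rule nn_integral_multc, measurable)
    qed
    finally show ?thesis by (simp only: inner)
  qed
  let ?g = "\<lambda>x. LINT y:{-(c * t)..c * t}|lborel. ?n y x * motion_density m c lam y t"
  have g: "?g x = enn2real (G x)" for x
    unfolding G_def set_lebesgue_integral_def
    by (rule integral_eq_nn_integral) (measurable, use md0 in eventually_elim, use t in simp)
  show "?g \<in> borel_measurable borel"
    unfolding g by measurable
  show "ennreal (?g x) = G x" if "G x \<noteq> \<infinity>" for x
    unfolding g using that by (simp add: less_top)
qed (rule t)

end

theorem theorem4p2:
  fixes M :: "'a measure" and c lam t :: real and m d :: nat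
    and W \<Theta> :: "nat \<Rightarrow> 'a \<Rightarrow> real" and B :: "nat \<Rightarrow> real \<Rightarrow> 'a \<Rightarrow> real"
  assumes "0 < c" and "0 < lam" and "0 < t"
    and "m \<in> {0, 1}"
    and "motion_data M lam m W \<Theta>"
    and "independent_brownian_motions M d B"
    and "independent_of_motion M W \<Theta> (bessel_process d B)"
  shows
    "(d = 1 \<longrightarrow>
        law_at_random_time M lam t (event_count W) (motion c W \<Theta>) (\<lambda>\<omega>. \<bar>B 1 t \<omega>\<bar>) =
        density lborel (\<lambda>x. ennreal
          (LINT y:{-(c * t)..c * t}|lborel.
             sqrt t * exp (- (x\<^sup>2 * t / (2 * y\<^sup>2))) / sqrt (2 * pi * y\<^sup>2) * motion_density m c lam y t)))
     \<and> (d = 2 \<and> m = 0 \<longrightarrow>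
        law_at_random_time M lam t (event_count W) (motion c W \<Theta>) (bessel_process d B t) =
        density lborel (\<lambda>x. ennreal
          (exp (- lam * t) *
            (lam * t / 2 *
               (LINT w:{0..1}|lborel.
                  exp (lam * t * sqrt (1 - w)) / sqrt (1 - w)
                  * (exp (- (x\<^sup>2 / (2 * c\<^sup>2 * t * w))) / (sqrt (2 * pi * t * w) * c)))
             + exp (- (x\<^sup>2 / (2 * c\<^sup>2 * t))) / (sqrt (2 * pi * t) * c)))))
     \<and> (d = 2 \<and> m = 1 \<longrightarrow>
        law_at_random_time M lam t (event_count W) (motion c W \<Theta>) (bessel_process d B t) =
        density lborel (\<lambda>x. ennreal
          (LINT w:{0..1}|lborel.
             exp (- lam * t * w) * (1 + lam * t * (1 - w))
             * (exp (- (x\<^sup>2 / (2 * c\<^sup>2 * t * w))) / (sqrt (2 * pi * t * w) * c)))))"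
proof -
  have motion: "motion_data M lam m W \<Theta>" and BM: "independent_brownian_motions M d B"
    using assms by blast+
  interpret random_motion M c lam m W \<Theta>
    using assms motion by (intro random_motion.intro random_motion_axioms.intro) (auto simp: motion_data_def)
  show ?thesis
  proof (intro conjI impI)
    assume "d = 1"
    then have "brownian_motion M (B 1)"
      using BM by (simp add: independent_brownian_motions_def)
    from law_brownian[OF this \<open>0 < t\<close>]
    show "law_at_random_time M lam t (event_count W) (motion c W \<Theta>) (\<lambda>\<omega>. \<bar>B 1 t \<omega>\<bar>) =
        density lborel (\<lambda>x. ennreal
          (LINT y:{-(c * t)..c * t}|lborel.
             sqrt t * exp (- (x\<^sup>2 * t / (2 * y\<^sup>2))) / sqrt (2 * pi * y\<^sup>2) * motion_density m c lam y t))" .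
  next
    assume dm: "d = 2 \<and> m = 0"
    show "law_at_random_time M lam t (event_count W) (motion c W \<Theta>) (bessel_process d B t) =
        density lborel (\<lambda>x. ennreal
          (exp (- lam * t) *
            (lam * t / 2 *
               (LINT w:{0..1}|lborel.
                  exp (lam * t * sqrt (1 - w)) / sqrt (1 - w)
                  * (exp (- (x\<^sup>2 / (2 * c\<^sup>2 * t * w))) / (sqrt (2 * pi * t * w) * c)))
             + exp (- (x\<^sup>2 / (2 * c\<^sup>2 * t))) / (sqrt (2 * pi * t) * c))))"
      using law_bessel_2_shape_0[of B t] BM dm \<open>0 < t\<close> by metis
  next
    assume dm: "d = 2 \<and> m = 1"
    show "law_at_random_time M lam t (event_count W) (motion c W \<Theta>) (bessel_process d B t) =
        density lborel (\<lambda>x. ennreal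
          (LINT w:{0..1}|lborel.
             exp (- lam * t * w) * (1 + lam * t * (1 - w))
             * (exp (- (x\<^sup>2 / (2 * c\<^sup>2 * t * w))) / (sqrt (2 * pi * t * w) * c))))"
      using law_bessel_2_shape_1[of B t] BM dm \<open>0 < t\<close> by metis
  qed
qed

end
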